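(* Assume that $(A_1)$–$(A_3)$ hold and that $\varepsilon>0$ is sufficiently small. Then the slow-fast system with jumps $$dx^\varepsilon=Sx^\varepsilon dt+g_1(x^\varepsilon,y^\varepsilon)dt,\qquad dy^\varepsilon=\tfrac1\varepsilon Fy^\varepsilon dt+\tfrac1\varepsilon g_2(x^\varepsilon,y^\varepsilon)dt+\sigma\varepsilon^{-\frac1\alpha}dL_t^\alpha$$ has a slow manifold $$M^\varepsilon(\omega)=(T^\varepsilon)^{-1}(\omega,\mathcal M^\varepsilon(\omega))=\mathcal M^\varepsilon(\omega)+(0,\sigma\eta^{\frac1\varepsilon}(\omega))=\{(x_0,h^\varepsilon(\omega,x_0)):x_0\in\mathbb R^{n_1}\}$$ with $h^\varepsilon(\omega,x_0)=\hat h^\varepsilon(\omega,x_0)+\sigma\eta^{\frac1\varepsilon}(\omega)$.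
   Context: Setting. $|\cdot|$ is the Euclidean norm, $n=n_1+n_2$, $\sigma>0$, $1<\alpha<2$. $S$ is an $n_1\times n_1$ matrix all of whose eigenvalues have non-negative real part, $F$ is an $n_2\times n_2$ matrix all of whose eigenvalues have negative real part, and $g_i:\mathbb R^{n_1}\times\mathbb R^{n_2}\to\mathbb R^{n_i}$ ($i=1,2$) are Lipschitz continuous with $g_i(0,0)=0$. Hypotheses. $(A_1)$: there are constants $\gamma_s>0$ and $\gamma_f<0$ such that $|e^{St}x|\le e^{\gamma_st}|x|$ for $t\le0$, $x\in\mathbb R^{n_1}$, and $|e^{Ft}y|\le e^{\gamma_ft}|y|$ for $t\ge0$, $y\in\mathbb R^{n_2}$. $(A_2)$: there is $K>0$ with $|g_i(x_1,y_1)-g_i(x_2,y_2)|\le K(|x_1-x_2|+|y_1-y_2|)$ for all $(x_j,y_j)\in\mathbb R^n$, $i=1,2$. $(A_3)$: $K<-\gamma_f$. A number $\gamma>0$ with $K<-(\gamma+\gamma_f)$ is fixed, and $\beta=-\gamma/\varepsilon$. Noise. $\Omega=\mathcal D_0(\mathbb R,\mathbb R^{n_2})$ is the space of càdlàg functions $\omega:\mathbb R\to\mathbb R^{n_2}$ with $\omega(0)=0$, with the Borel $\sigma$-algebra of the Skorokhod topology; $\mathbb P$ is the law making $L_t^\alpha(\omega)=\omega(t)$ a two-sided $\alpha$-stable Lévy process; $\theta_t\omega=\omega(\cdot+t)-\omega(t)$ is the shift flow, which preserves $\mathbb P$. $\Omega$ is replaced, without change of notation, by a $\theta$-invariant subset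 of full measure on which $\eta^{\frac1\varepsilon}(\omega)=\varepsilon^{-\frac1\alpha}\int_{-\infty}^0e^{-Fs/\varepsilon}dL_s^\alpha(\omega)$ is defined, $t\mapsto\eta^{\frac1\varepsilon}(\theta_t\omega)$ is the càdlàg stationary solution of $d\eta=\frac1\varepsilon F\eta\,dt+\varepsilon^{-1/\alpha}dL_t^\alpha$ (with sublinear growth in $t$), and the transformed system below is solvable for every initial condition. Transformation. $T^\varepsilon(\omega,x,y)=(x,\,y-\sigma\eta^{\frac1\varepsilon}(\omega))$, and $(T^\varepsilon)^{-1}(\omega,\cdot)$ is its inverse for fixed $\omega$. The transformed (random differential) system is $$d\hat x^\varepsilon=S\hat x^\varepsilon dt+g_1(\hat x^\varepsilon,\hat y^\varepsilon+\sigma\eta^{\frac1\varepsilon}(\theta_t\omega))dt,\qquad d\hat y^\varepsilon=\tfrac1\varepsilon F\hat y^\varepsilon dt+\tfrac1\varepsilon g_2(\hat x^\varepsilon,\hat y^\varepsilon+\sigma\eta^{\frac1\varepsilon}(\theta_t\omega))dt,$$ and $\hat\phi^\varepsilon(t,\omega,(x_0,y_0))$ is its solution starting at $(x_0,y_0)$. The random dynamical system generated by the original slow-fast system is $\varphi^\varepsilon(t,\omega,z)=(T^\varepsilon)^{-1}\big(\theta_t\omega,\hat\phi^\varepsilon(t,\omega,T^\varepsilon(\omega,z))\big)$. The manifold $\mathcal M^\varepsilon$. $C_\beta^-$ is the Banach space of continuous $(\phi^s,\phi^f):(-\infty,0]\to\mathbb R^{n_1}\times\mathbb R^{n_2}$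 with finite norm $\sup_{t\le0}|e^{-\beta t}\phi^s_t|+\sup_{t\le0}|e^{-\beta t}\phi^f_t|$, and $\mathcal M^\varepsilon(\omega)=\{(x_0,y_0)\in\mathbb R^n:\hat\phi^\varepsilon(\cdot,\omega,(x_0,y_0))\in C_\beta^-\}$; for sufficiently small $\varepsilon$ it is the graph $\{(x_0,\hat h^\varepsilon(\omega,x_0)):x_0\in\mathbb R^{n_1}\}$ of a function $\hat h^\varepsilon(\omega,\cdot)$, which is Lipschitz. Slow manifold. For a random dynamical system $\varphi$ on $\mathbb R^n$ over $\theta$ (jointly measurable, $\varphi(0,\omega,\cdot)=\mathrm{id}$, $\varphi(t+s,\omega,\cdot)=\varphi(t,\theta_s\omega,\varphi(s,\omega,\cdot))$), a random set is a family of nonempty closed sets $M(\omega)$ with $\omega\mapsto\inf_{z'\in M(\omega)}|z-z'|$ measurable for every $z$; it is (positively) invariant if $\varphi(t,\omega,M(\omega))\subseteq M(\theta_t\omega)$ (for $t\ge 0$). A Lipschitz invariant manifold is an invariant random set that is the graph $\{(x,h(\omega,x)):x\in\mathbb R^{n_1}\}$ with $h(\omega,\cdot)$ Lipschitz for every $\omega$ and $h(\cdot,x)$ a random variable for every $x$. It has the exponential tracking property if for all $\omega\in\Omega$ and every $z\in\mathbb R^n$ there is $z'\in M(\omega)$ with $|\varphi(t,\omega,z)-\varphi(t,\omega,z')|\le C(z,z',\omega)e^{-ct}|z-z'|$ for $t\ge0$, where $C$ is a positive random variable depending on $z,z'$ and $c>0$ is a constant. A slow manifold is a Lipschitz invariant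 manifold with the exponential tracking property. *)

theory Defs
  imports "HOL-Probability.Probability"
begin

section \<open>Matrices\<close>

definition eigenvalue_of :: "real^'n^'n \<Rightarrow> complex \<Rightarrow> bool" where
  "eigenvalue_of A l \<longleftrightarrow> (\<exists>v::complex^'n. v \<noteq> 0 \<and> map_matrix complex_of_real A *v v = l *s v)"

definition matrix_exp :: "real^'n^'n \<Rightarrow> real^'n^'n" where
  "matrix_exp A = (\<Sum>k. inverse (fact k) *\<^sub>R (((**) A ^^ k) (mat 1)))"


section \<open>The Skorokhod space of two-sided paths\<close>

definition cadlag :: "(real \<Rightarrow> 'a::topological_space) \<Rightarrow> bool" where
  "cadlag \<omega> \<longleftrightarrow> (\<forall>t. continuous (at_right t) \<omega> \<and> (\<exists>l. (\<omega> \<longlongrightarrow> l) (at_left t)))"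

definition D0 :: "(real \<Rightarrow> 'a::real_normed_vector) set" where
  "D0 = {\<omega>. cadlag \<omega> \<and> \<omega> 0 = 0}"

definition time_changes :: "real \<Rightarrow> (real \<Rightarrow> real) set" where
  "time_changes m =
     {l. strict_mono_on {-m..m} l \<and> continuous_on {-m..m} l \<and> l (-m) = -m \<and> l m = m}"

text \<open>The complete Billingsley version of the Skorokhod (J1) distance on a compact window
  \<open>[-m, m]\<close>: both the time distortion, measured by logarithms of slopes, and the uniform
  distance after the time change are at most \<open>e\<close>. The identity is a time change, so for
  bounded paths the infimum is over a nonempty set.\<close>
definition skorokhod_window_dist ::
    "real \<Rightarrow> (real \<Rightarrow> 'a::real_normed_vector) \<Rightarrow> (real \<Rightarrow> 'a) \<Rightarrow> real" where
  "skorokhod_window_dist m f g = Inf {e. 0 \<le> e \<and> (\<exists>l\<in>time_changes m.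
      (\<forall>s t. -m \<le> s \<and> s < t \<and> t \<le> m \<longrightarrow> \<bar>ln ((l t - l s) / (t - s))\<bar> \<le> e) \<and>
      (\<forall>t\<in>{-m..m}. norm (f t - g (l t)) \<le> e))}"

text \<open>The factor equals 1 on \<open>[-(m-1), m-1]\<close> and vanishes outside \<open>[-m, m]\<close>. It prevents
  jumps near the end points of the window from destroying convergence.\<close>
definition taper :: "real \<Rightarrow> (real \<Rightarrow> 'a::real_normed_vector) \<Rightarrow> real \<Rightarrow> 'a" where
  "taper m f t = max 0 (min 1 (m - \<bar>t\<bar>)) *\<^sub>R f t"

definition skorokhod_dist :: "(real \<Rightarrow> 'a::real_normed_vector) \<Rightarrow> (real \<Rightarrow> 'a) \<Rightarrow> real" where
  "skorokhod_dist f g =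
     (\<Sum>k. (1/2) ^ Suc k *
        min 1 (skorokhod_window_dist (real (Suc k)) (taper (real (Suc k)) f) (taper (real (Suc k)) g)))"

definition skorokhod_topology :: "(real \<Rightarrow> 'a::real_normed_vector) topology" where
  "skorokhod_topology =
     topology (\<lambda>U. U \<subseteq> D0 \<and> (\<forall>f\<in>U. \<exists>r>0. \<forall>g\<in>D0. skorokhod_dist f g < r \<longrightarrow> g \<in> U))"

lemma openin_skorokhod_topology:
  "openin skorokhod_topology U \<longleftrightarrow>
     U \<subseteq> D0 \<and> (\<forall>f\<in>U. \<exists>r>0. \<forall>g\<in>D0. skorokhod_dist f g < r \<longrightarrow> g \<in> U)"
proof -
  have "istopology (\<lambda>U::(real \<Rightarrow> 'a) set. U \<subseteq> D0 \<and>
          (\<forall>f\<in>U. \<exists>r>0. \<forall>g\<in>D0. skorokhod_dist f g < r \<longrightarrow> g \<in> U))"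
    unfolding istopology_def
  proof (intro conjI allI impI ballI)
    fix U V :: "(real \<Rightarrow> 'a) set" and f
    assume U: "U \<subseteq> D0 \<and> (\<forall>f\<in>U. \<exists>r>0. \<forall>g\<in>D0. skorokhod_dist f g < r \<longrightarrow> g \<in> U)"
      and V: "V \<subseteq> D0 \<and> (\<forall>f\<in>V. \<exists>r>0. \<forall>g\<in>D0. skorokhod_dist f g < r \<longrightarrow> g \<in> V)"
      and f: "f \<in> U \<inter> V"
    obtain r s where "r > 0" "\<forall>g\<in>D0. skorokhod_dist f g < r \<longrightarrow> g \<in> U"
      "s > 0" "\<forall>g\<in>D0. skorokhod_dist f g < s \<longrightarrow> g \<in> V"
      using U V f by blast
    then show "\<exists>r>0. \<forall>g\<in>D0. skorokhod_dist f g < r \<longrightarrow> g \<in> U \<inter> V"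
      by (intro exI[of _ "min r s"]) auto
  next
    fix \<K> :: "(real \<Rightarrow> 'a) set set" and f
    assume \<K>: "\<forall>U\<in>\<K>. U \<subseteq> D0 \<and> (\<forall>f\<in>U. \<exists>r>0. \<forall>g\<in>D0. skorokhod_dist f g < r \<longrightarrow> g \<in> U)"
      and "f \<in> \<Union> \<K>"
    then obtain U where "U \<in> \<K>" "f \<in> U" by blast
    then obtain r where "r > 0" "\<forall>g\<in>D0. skorokhod_dist f g < r \<longrightarrow> g \<in> U"
      using \<K> by blast
    then show "\<exists>r>0. \<forall>g\<in>D0. skorokhod_dist f g < r \<longrightarrow> g \<in> \<Union> \<K>"
      using \<open>U \<in> \<K>\<close> by blast
  qed blast+
  then show ?thesis
    unfolding skorokhod_topology_def by (simp add: topology_inverse')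
qed

definition skorokhod_borel :: "(real \<Rightarrow> 'a::real_normed_vector) measure" where
  "skorokhod_borel = sigma D0 {U. openin skorokhod_topology U}"

definition path_shift :: "real \<Rightarrow> (real \<Rightarrow> 'a::real_normed_vector) \<Rightarrow> real \<Rightarrow> 'a" where
  "path_shift t \<omega> = (\<lambda>s. \<omega> (s + t) - \<omega> t)"


section \<open>Two-sided stable Levy processes\<close>

text \<open>For independent \<open>X\<close>, \<open>Y\<close> with law \<open>\<mu>\<close> the sum \<open>a X + b Y\<close> has, up to a translation, the
  law of \<open>(a\<^sup>\<alpha> + b\<^sup>\<alpha>)\<^bsup>1/\<alpha>\<^esup> X\<close>. Skewed, non-isotropic and degenerate stable laws are included.\<close>
definition stable_law :: "real \<Rightarrow> 'a::euclidean_space measure \<Rightarrow> bool" where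
  "stable_law \<alpha> \<mu> \<longleftrightarrow> prob_space \<mu> \<and> sets \<mu> = sets borel \<and>
     (\<forall>a>0. \<forall>b>0. \<exists>d.
        distr (\<mu> \<Otimes>\<^sub>M \<mu>) borel (\<lambda>(x, y). a *\<^sub>R x + b *\<^sub>R y) =
        distr \<mu> borel (\<lambda>x. ((a powr \<alpha> + b powr \<alpha>) powr (1 / \<alpha>)) *\<^sub>R x + d))"

text \<open>\<open>P\<close> is the law on path space for which the coordinate process \<open>L\<^sub>t(\<omega>) = \<omega>(t)\<close>, \<open>t \<in> \<real>\<close>, is
  an \<open>\<alpha>\<close>-stable Levy process; \<open>L\<^sub>0 = 0\<close> and the cadlag property are part of \<^const>\<open>D0\<close>.\<close>
definition stable_levy_law :: "real \<Rightarrow> (real \<Rightarrow> 'a::euclidean_space) measure \<Rightarrow> bool" where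
  "stable_levy_law \<alpha> P \<longleftrightarrow>
     prob_space P \<and> space P = D0 \<and> sets P = sets skorokhod_borel \<and>
     (\<forall>(t::nat \<Rightarrow> real) n. strict_mono t \<longrightarrow>
        prob_space.indep_vars P (\<lambda>_. borel) (\<lambda>i \<omega>. \<omega> (t (Suc i)) - \<omega> (t i)) {..<n}) \<and>
     (\<forall>s. \<forall>h\<ge>0. distr P borel (\<lambda>\<omega>. \<omega> (s + h) - \<omega> s) = distr P borel (\<lambda>\<omega>. \<omega> h)) \<and>
     (\<forall>t>0. stable_law \<alpha> (distr P borel (\<lambda>\<omega>. \<omega> t)))"


section \<open>The stationary Ornstein--Uhlenbeck process\<close>

text \<open>Riemann--Stieltjes integral of a matrix-valued integrand against a vector-valued path, as a
  limit of tagged sums for mesh tending to 0. For smooth deterministic integrands and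
  cadlag paths it exists path by path and is a version of the stochastic integral.\<close>
definition has_RS_integral ::
    "(real \<Rightarrow> real^'n^'m) \<Rightarrow> (real \<Rightarrow> real^'n) \<Rightarrow> real^'m \<Rightarrow> real \<Rightarrow> real \<Rightarrow> bool" where
  "has_RS_integral \<Phi> \<omega> I a b \<longleftrightarrow>
     (\<forall>e>0. \<exists>d>0. \<forall>p. p tagged_division_of {a..b} \<and> (\<lambda>x. ball x d) fine p \<longrightarrow>
        norm ((\<Sum>(x, k)\<in>p. \<Phi> x *v (\<omega> (Sup k) - \<omega> (Inf k))) - I) < e)"

definition has_OU_integral ::
    "real^'n^'n \<Rightarrow> real \<Rightarrow> (real \<Rightarrow> real^'n) \<Rightarrow> real^'n \<Rightarrow> bool" where
  "has_OU_integral F \<epsilon> \<omega> I \<longleftrightarrow>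
     (\<exists>J. (\<forall>a\<le>0. has_RS_integral (\<lambda>s. matrix_exp ((- s / \<epsilon>) *\<^sub>R F)) \<omega> (J a) a 0) \<and>
          (J \<longlongrightarrow> I) at_bot)"

definition eta :: "real^'n^'n \<Rightarrow> real \<Rightarrow> real \<Rightarrow> (real \<Rightarrow> real^'n) \<Rightarrow> real^'n" where
  "eta F \<alpha> \<epsilon> \<omega> = (\<epsilon> powr (- 1 / \<alpha>)) *\<^sub>R (THE I. has_OU_integral F \<epsilon> \<omega> I)"


section \<open>The slow-fast system and its transformation\<close>

text \<open>Integral form on all subintervals \<open>[a, b]\<close> of the real line; both time
  directions are covered.\<close>
definition slow_fast_solution ::
    "real^'m^'m \<Rightarrow> real^'n^'n \<Rightarrow> ((real^'m) \<times> (real^'n) \<Rightarrow> real^'m) \<Rightarrow> ((real^'m) \<times> (real^'n) \<Rightarrow> real^'n) \<Rightarrow>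
     real \<Rightarrow> real \<Rightarrow> real \<Rightarrow> (real \<Rightarrow> real^'n) \<Rightarrow> (real \<Rightarrow> (real^'m) \<times> (real^'n)) \<Rightarrow> bool" where
  "slow_fast_solution S F g1 g2 \<sigma> \<alpha> \<epsilon> \<omega> u \<longleftrightarrow>
     cadlag u \<and>
     (\<forall>a b. a \<le> b \<longrightarrow>
       ((\<lambda>s. S *v fst (u s) + g1 (u s)) has_integral (fst (u b) - fst (u a))) {a..b} \<and>
       ((\<lambda>s. (1 / \<epsilon>) *\<^sub>R (F *v snd (u s)) + (1 / \<epsilon>) *\<^sub>R g2 (u s)) has_integral
          (snd (u b) - snd (u a) - (\<sigma> * \<epsilon> powr (- 1 / \<alpha>)) *\<^sub>R (\<omega> b - \<omega> a))) {a..b})"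

definition transformed_solution ::
    "real^'m^'m \<Rightarrow> real^'n^'n \<Rightarrow> ((real^'m) \<times> (real^'n) \<Rightarrow> real^'m) \<Rightarrow> ((real^'m) \<times> (real^'n) \<Rightarrow> real^'n) \<Rightarrow>
     real \<Rightarrow> real \<Rightarrow> real \<Rightarrow> (real \<Rightarrow> real^'n) \<Rightarrow> (real \<Rightarrow> (real^'m) \<times> (real^'n)) \<Rightarrow> bool" where
  "transformed_solution S F g1 g2 \<sigma> \<alpha> \<epsilon> \<omega> u \<longleftrightarrow>
     continuous_on UNIV u \<and>
     (\<forall>a b. a \<le> b \<longrightarrow>
       ((\<lambda>s. S *v fst (u s) + g1 (fst (u s), snd (u s) + \<sigma> *\<^sub>R eta F \<alpha> \<epsilon> (path_shift s \<omega>)))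
          has_integral (fst (u b) - fst (u a))) {a..b} \<and>
       ((\<lambda>s. (1 / \<epsilon>) *\<^sub>R (F *v snd (u s)) +
             (1 / \<epsilon>) *\<^sub>R g2 (fst (u s), snd (u s) + \<sigma> *\<^sub>R eta F \<alpha> \<epsilon> (path_shift s \<omega>)))
          has_integral (snd (u b) - snd (u a))) {a..b})"

definition phi_hat ::
    "real^'m^'m \<Rightarrow> real^'n^'n \<Rightarrow> ((real^'m) \<times> (real^'n) \<Rightarrow> real^'m) \<Rightarrow> ((real^'m) \<times> (real^'n) \<Rightarrow> real^'n) \<Rightarrow>
     real \<Rightarrow> real \<Rightarrow> real \<Rightarrow> real \<Rightarrow> (real \<Rightarrow> real^'n) \<Rightarrow> (real^'m) \<times> (real^'n) \<Rightarrow> (real^'m) \<times> (real^'n)" where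
  "phi_hat S F g1 g2 \<sigma> \<alpha> \<epsilon> t \<omega> z =
     (THE u. transformed_solution S F g1 g2 \<sigma> \<alpha> \<epsilon> \<omega> u \<and> u 0 = z) t"

definition T_eps ::
    "real^'n^'n \<Rightarrow> real \<Rightarrow> real \<Rightarrow> real \<Rightarrow> (real \<Rightarrow> real^'n) \<Rightarrow>
     (real^'m) \<times> (real^'n) \<Rightarrow> (real^'m) \<times> (real^'n)" where
  "T_eps F \<sigma> \<alpha> \<epsilon> \<omega> = (\<lambda>(x, y). (x, y - \<sigma> *\<^sub>R eta F \<alpha> \<epsilon> \<omega>))"

definition phi ::
    "real^'m^'m \<Rightarrow> real^'n^'n \<Rightarrow> ((real^'m) \<times> (real^'n) \<Rightarrow> real^'m) \<Rightarrow> ((real^'m) \<times> (real^'n) \<Rightarrow> real^'n) \<Rightarrow>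
     real \<Rightarrow> real \<Rightarrow> real \<Rightarrow> real \<Rightarrow> (real \<Rightarrow> real^'n) \<Rightarrow> (real^'m) \<times> (real^'n) \<Rightarrow> (real^'m) \<times> (real^'n)" where
  "phi S F g1 g2 \<sigma> \<alpha> \<epsilon> t \<omega> z =
     inv (T_eps F \<sigma> \<alpha> \<epsilon> (path_shift t \<omega>)) (phi_hat S F g1 g2 \<sigma> \<alpha> \<epsilon> t \<omega> (T_eps F \<sigma> \<alpha> \<epsilon> \<omega> z))"

text \<open>The shift-invariant set of full measure to which the path space is restricted.\<close>
definition admissible_paths ::
    "real^'m^'m \<Rightarrow> real^'n^'n \<Rightarrow> ((real^'m) \<times> (real^'n) \<Rightarrow> real^'m) \<Rightarrow> ((real^'m) \<times> (real^'n) \<Rightarrow> real^'n) \<Rightarrow>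
     real \<Rightarrow> real \<Rightarrow> real \<Rightarrow> (real \<Rightarrow> real^'n) measure \<Rightarrow> (real \<Rightarrow> real^'n) set \<Rightarrow> bool" where
  "admissible_paths S F g1 g2 \<sigma> \<alpha> \<epsilon> P \<Omega> \<longleftrightarrow>
     \<Omega> \<in> sets P \<and> measure P \<Omega> = 1 \<and> (\<forall>t. path_shift t ` \<Omega> = \<Omega>) \<and>
     (\<forall>\<omega>\<in>\<Omega>.
        (\<exists>I. has_OU_integral F \<epsilon> \<omega> I) \<and>
        cadlag (\<lambda>t. eta F \<alpha> \<epsilon> (path_shift t \<omega>)) \<and>
        (\<forall>a b. a \<le> b \<longrightarrow>
           ((\<lambda>s. (1 / \<epsilon>) *\<^sub>R (F *v eta F \<alpha> \<epsilon> (path_shift s \<omega>))) has_integral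
              (eta F \<alpha> \<epsilon> (path_shift b \<omega>) - eta F \<alpha> \<epsilon> (path_shift a \<omega>)
                 - (\<epsilon> powr (- 1 / \<alpha>)) *\<^sub>R (\<omega> b - \<omega> a))) {a..b}) \<and>
        ((\<lambda>t. norm (eta F \<alpha> \<epsilon> (path_shift t \<omega>)) / \<bar>t\<bar>) \<longlongrightarrow> 0) at_infinity \<and>
        (\<forall>z. \<exists>u. transformed_solution S F g1 g2 \<sigma> \<alpha> \<epsilon> \<omega> u \<and> u 0 = z))"

definition C_minus :: "real \<Rightarrow> (real \<Rightarrow> 'a::real_normed_vector \<times> 'b::real_normed_vector) set" where
  "C_minus \<beta> = {u. continuous_on {..0} u \<and>
     bdd_above ((\<lambda>t. norm (exp (- \<beta> * t) *\<^sub>R fst (u t))) ` {..0}) \<and>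
     bdd_above ((\<lambda>t. norm (exp (- \<beta> * t) *\<^sub>R snd (u t))) ` {..0})}"

definition M_hat ::
    "real^'m^'m \<Rightarrow> real^'n^'n \<Rightarrow> ((real^'m) \<times> (real^'n) \<Rightarrow> real^'m) \<Rightarrow> ((real^'m) \<times> (real^'n) \<Rightarrow> real^'n) \<Rightarrow>
     real \<Rightarrow> real \<Rightarrow> real \<Rightarrow> real \<Rightarrow> (real \<Rightarrow> real^'n) \<Rightarrow> ((real^'m) \<times> (real^'n)) set" where
  "M_hat S F g1 g2 \<sigma> \<alpha> \<gamma> \<epsilon> \<omega> =
     {z. (\<lambda>t. phi_hat S F g1 g2 \<sigma> \<alpha> \<epsilon> t \<omega> z) \<in> C_minus (- \<gamma> / \<epsilon>)}"

text \<open>The function whose graph is \<^const>\<open>M_hat\<close>.\<close>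
definition h_hat ::
    "real^'m^'m \<Rightarrow> real^'n^'n \<Rightarrow> ((real^'m) \<times> (real^'n) \<Rightarrow> real^'m) \<Rightarrow> ((real^'m) \<times> (real^'n) \<Rightarrow> real^'n) \<Rightarrow>
     real \<Rightarrow> real \<Rightarrow> real \<Rightarrow> real \<Rightarrow> (real \<Rightarrow> real^'n) \<Rightarrow> real^'m \<Rightarrow> real^'n" where
  "h_hat S F g1 g2 \<sigma> \<alpha> \<gamma> \<epsilon> \<omega> x = (THE y. (x, y) \<in> M_hat S F g1 g2 \<sigma> \<alpha> \<gamma> \<epsilon> \<omega>)"


section \<open>Random dynamical systems and slow manifolds\<close>

definition random_dynamical_system ::
    "'w measure \<Rightarrow> (real \<Rightarrow> 'w \<Rightarrow> 'w) \<Rightarrow> (real \<Rightarrow> 'w \<Rightarrow> 'e::euclidean_space \<Rightarrow> 'e) \<Rightarrow> bool" where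
  "random_dynamical_system M \<theta> \<phi> \<longleftrightarrow>
     (\<lambda>(t, \<omega>, z). \<phi> t \<omega> z) \<in> borel_measurable (borel \<Otimes>\<^sub>M (M \<Otimes>\<^sub>M borel)) \<and>
     (\<forall>\<omega>\<in>space M. \<phi> 0 \<omega> = id) \<and>
     (\<forall>\<omega>\<in>space M. \<forall>t s. \<phi> (t + s) \<omega> = \<phi> t (\<theta> s \<omega>) \<circ> \<phi> s \<omega>)"

definition random_set :: "'w measure \<Rightarrow> ('w \<Rightarrow> 'e::metric_space set) \<Rightarrow> bool" where
  "random_set M A \<longleftrightarrow>
     (\<forall>\<omega>\<in>space M. A \<omega> \<noteq> {} \<and> closed (A \<omega>)) \<and>
     (\<forall>z. (\<lambda>\<omega>. infdist z (A \<omega>)) \<in> borel_measurable M)"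

text \<open>Invariance is required for all real times, hence in particular positive invariance.\<close>
definition invariant_under ::
    "'w measure \<Rightarrow> (real \<Rightarrow> 'w \<Rightarrow> 'w) \<Rightarrow> (real \<Rightarrow> 'w \<Rightarrow> 'e \<Rightarrow> 'e) \<Rightarrow> ('w \<Rightarrow> 'e set) \<Rightarrow> bool" where
  "invariant_under M \<theta> \<phi> A \<longleftrightarrow> (\<forall>\<omega>\<in>space M. \<forall>t. \<phi> t \<omega> ` A \<omega> \<subseteq> A (\<theta> t \<omega>))"

definition lipschitz_invariant_manifold ::
    "'w measure \<Rightarrow> (real \<Rightarrow> 'w \<Rightarrow> 'w) \<Rightarrow>
     (real \<Rightarrow> 'w \<Rightarrow> 'x \<times> 'y \<Rightarrow> 'x::euclidean_space \<times> 'y::euclidean_space) \<Rightarrow>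
     ('w \<Rightarrow> ('x \<times> 'y) set) \<Rightarrow> bool" where
  "lipschitz_invariant_manifold M \<theta> \<phi> A \<longleftrightarrow>
     random_set M A \<and> invariant_under M \<theta> \<phi> A \<and>
     (\<exists>h. (\<forall>\<omega>\<in>space M. A \<omega> = {(x, h \<omega> x) | x. True}) \<and>
          (\<forall>\<omega>\<in>space M. \<exists>L. L-lipschitz_on UNIV (h \<omega>)) \<and>
          (\<forall>x. (\<lambda>\<omega>. h \<omega> x) \<in> borel_measurable M))"

definition exponential_tracking ::
    "'w measure \<Rightarrow> (real \<Rightarrow> 'w \<Rightarrow> 'e \<Rightarrow> 'e::real_normed_vector) \<Rightarrow> ('w \<Rightarrow> 'e set) \<Rightarrow> bool" where
  "exponential_tracking M \<phi> A \<longleftrightarrow>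
     (\<exists>c>0. \<exists>C. (\<forall>z z'. C z z' \<in> borel_measurable M \<and> (\<forall>\<omega>\<in>space M. 0 < C z z' \<omega>)) \<and>
        (\<forall>\<omega>\<in>space M. \<forall>z. \<exists>z'\<in>A \<omega>. \<forall>t\<ge>0.
           norm (\<phi> t \<omega> z - \<phi> t \<omega> z') \<le> C z z' \<omega> * exp (- c * t) * norm (z - z')))"

definition slow_manifold ::
    "'w measure \<Rightarrow> (real \<Rightarrow> 'w \<Rightarrow> 'w) \<Rightarrow>
     (real \<Rightarrow> 'w \<Rightarrow> 'x \<times> 'y \<Rightarrow> 'x::euclidean_space \<times> 'y::euclidean_space) \<Rightarrow>
     ('w \<Rightarrow> ('x \<times> 'y) set) \<Rightarrow> bool" where
  "slow_manifold M \<theta> \<phi> A \<longleftrightarrow>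
     random_dynamical_system M \<theta> \<phi> \<and> lipschitz_invariant_manifold M \<theta> \<phi> A \<and>
     exponential_tracking M \<phi> A"

end

theory Submission
  imports Defs
begin

text \<open>By (A1), \<open>x \<bullet> S x \<ge> 0\<close> and \<open>y \<bullet> F y \<le> \<gamma>\<^sub>f |y|\<^sup>2\<close>, so the Lyapunov-Perron integral equations can be
  avoided. Write \<open>p\<close>, \<open>q\<close> for the slow and fast components of the difference of two solutions of the
  transformed system and \<open>V = |q|\<^sup>2 - l\<^sup>2 |p|\<^sup>2\<close>. For large \<open>l\<close> and small \<open>\<epsilon>\<close> one has \<open>V' \<le> - 2 \<mu> V\<close> with a
  rate \<open>\<mu> > \<gamma> / \<epsilon>\<close>; as the noise is only right-continuous, the derivatives are right derivatives.

  If \<open>V > 0\<close> at time 0, then \<open>|q|\<close> grows backwards at rate \<open>\<mu>\<close>, which is faster than \<open>C\<^sub>\<beta>\<^sup>-\<close> permits: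
  the manifold is contained in a Lipschitz graph. The cone \<open>V \<le> 0\<close> is forward invariant, and in
  it \<open>|p|\<close> decreases at most exponentially, so the slow component of the flow on a Lipschitz graph is an expanding map,
  hence onto by invariance of domain. This gives, for every \<open>n\<close>, an orbit over a given \<open>x\<close> which
  has no fast component at time \<open>- n\<close>; an a priori bound (the inequality for \<open>V\<close> with the noise as
  forcing) allows to pass to the limit and yields a point of the manifold over \<open>x\<close>. In the same
  way there are orbits on the manifold having the same slow component at time \<open>n\<close> as a given
  orbit; then \<open>V \<ge> 0\<close> on \<open>[0, n]\<close>, and in the limit \<open>V \<ge> 0\<close> for all \<open>t \<ge> 0\<close>, where \<open>|q|\<close> decays like
  \<open>e\<^bsup>-\<gamma>t/\<epsilon>\<^esup>\<close> and dominates \<open>|p|\<close>: this is exponential tracking.\<close>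

section \<open>Right derivatives\<close>

text \<open>The form \<open>V\<close> is used with two slopes. Slope \<open>L\<close> shows that the
  manifold is an \<open>L\<close>-Lipschitz graph. Tracking uses slope \<open>2 * L\<close>: the
  orbit that shares the slow component of the given orbit at time \<open>n\<close> starts on that
  graph at a point depending on \<open>n\<close>, and the difference of the two slopes keeps these
  points in a bounded set. The inequality for \<open>V\<close> is therefore proved for every slope
  in between. The estimates concern squared norms, which are differentiable also at zero, and
  \<open>V\<close>, whose sign is indefinite, so the Gronwall lemmas must not assume positivity.

  The constants come from one number, the gap \<open>\<delta> = - \<gamma>f - K - \<gamma>\<close>.
  The slope \<open>L = 4 * K / \<delta>\<close> makes the influence of the slow on the fast
  component small against \<delta>, and a small \<epsilon> makes the slow equation negligible
  against \<open>\<delta> / \<epsilon>\<close>.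

  The flow and the manifold are given by descriptions, which carry no measurability. The flow is
  recovered as a limit of Picard iterates, the graph from a criterion with countable
  quantifiers.\<close>

lemma right_derivative_nonpos_imp_le:
  fixes f :: "real \<Rightarrow> real"
  assumes ab: "a \<le> b" and cont: "continuous_on {a..b} f"
    and der: "\<And>t. a \<le> t \<Longrightarrow> t < b \<Longrightarrow> \<exists>D\<le>0. (f has_real_derivative D) (at_right t)"
  shows "f b \<le> f a"
proof (rule ccontr)
  assume "\<not> f b \<le> f a"
  then have less: "f a < f b" and "a < b" using ab by (auto simp: not_le order.order_iff_strict)
  \<comment> \<open>Half the mean slope of the supposed increase: subtracting a line of slope
    \<open>e\<close> leaves \<open>g b\<close> positive, while every right derivative of
    \<open>g\<close> is at most \<open>- e\<close>. Right after the last point \<open>c\<close> with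
    \<open>g c \<le> 0\<close> the function \<open>g\<close> then falls, against the choice of
    \<open>c\<close>.\<close>
  define e where "e = (f b - f a) / (2 * (b - a))"
  have e: "e > 0" using less \<open>a < b\<close> by (simp add: e_def)
  define g where "g t = f t - f a - e * (t - a)" for t
  have "e * (b - a) = (f b - f a) / 2" using \<open>a < b\<close> unfolding e_def by (simp add: divide_simps)
  then have "g b = (f b - f a) / 2" by (simp add: g_def)
  then have gb: "g b > 0" using less by simp
  have contg: "continuous_on {a..b} g" unfolding g_def by (intro continuous_intros cont)
  define X where "X = {t\<in>{a..b}. g t \<in> {..0}}"
  have "closed ({a..b} \<inter> g -` {..0})"
    using contg by (rule continuous_closed_preimage) auto
  also have "{a..b} \<inter> g -` {..0} = X" by (auto simp: X_def)
  finally have "closed X" .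
  moreover have "X \<noteq> {}" "bdd_above X" using ab by (auto simp: X_def g_def)
  ultimately have "Sup X \<in> X" by (intro closed_contains_Sup)
  define c where "c = Sup X"
  have c: "a \<le> c" "c \<le> b" "g c \<le> 0" using \<open>Sup X \<in> X\<close> by (auto simp: X_def c_def)
  with gb have "c < b" by (cases "c = b") auto
  have pos: "g t > 0" if "c < t" "t \<le> b" for t
  proof (rule ccontr)
    assume "\<not> g t > 0"
    then have "t \<in> X" using that c by (auto simp: X_def)
    then have "t \<le> c" unfolding c_def by (intro cSup_upper \<open>bdd_above X\<close>)
    with that show False by simp
  qed
  obtain D where D: "D \<le> 0" "(f has_real_derivative D) (at_right c)" using der c \<open>c < b\<close> by blast
  have "(g has_real_derivative (D - e)) (at_right c)"
    unfolding g_def by (auto intro!: derivative_eq_intros D)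
  then have "((\<lambda>t. (g t - g c) / (t - c)) \<longlongrightarrow> D - e) (at_right c)"
    by (simp add: has_field_derivative_iff)
  then have "eventually (\<lambda>t. (g t - g c) / (t - c) < 0) (at_right c)"
    using D e by (intro order_tendstoD) auto
  moreover have "eventually (\<lambda>t. t \<in> {c<..<b}) (at_right c)"
    using \<open>c < b\<close> by (rule eventually_at_right_real)
  ultimately have "eventually (\<lambda>t. False) (at_right c)"
  proof eventually_elim
    case (elim t)
    then have "g t < g c" by (auto simp: divide_less_0_iff)
    with pos[of t] elim c show False by auto
  qed
  then show False by (simp add: trivial_limit_at_right_real)
qed

text \<open>The integrating factor \<open>exp (- k * t)\<close> reduces this to monotonicity.
  Neither \<open>f\<close> nor \<open>k\<close> has a prescribed sign, as the lemma is applied to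
  the indefinite form \<open>cone\<close> with a negative rate.\<close>

lemma right_gronwall:
  fixes f :: "real \<Rightarrow> real"
  assumes ab: "a \<le> b" and cont: "continuous_on {a..b} f"
    and der: "\<And>t. a \<le> t \<Longrightarrow> t < b \<Longrightarrow> \<exists>D. (f has_real_derivative D) (at_right t) \<and> D \<le> k * f t"
  shows "f b \<le> exp (k * (b - a)) * f a"
proof -
  have "exp (- k * b) * f b \<le> exp (- k * a) * f a"
  proof (rule right_derivative_nonpos_imp_le[OF ab])
    show "continuous_on {a..b} (\<lambda>t. exp (- k * t) * f t)" by (intro continuous_intros cont)
    fix t assume "a \<le> t" "t < b"
    then obtain D where D: "(f has_real_derivative D) (at_right t)" "D \<le> k * f t" using der by blast
    have "((\<lambda>t. exp (- k * t) * f t) has_real_derivative exp (- k * t) * (D - k * f t)) (at_right t)"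
      by (auto intro!: derivative_eq_intros D simp: algebra_simps)
    then show "\<exists>D\<le>0. ((\<lambda>t. exp (- k * t) * f t) has_real_derivative D) (at_right t)"
      using D by (intro exI[of _ "exp (- k * t) * (D - k * f t)"]) (auto simp: mult_le_0_iff)
  qed
  then have "exp (k * b) * (exp (- k * b) * f b) \<le> exp (k * b) * (exp (- k * a) * f a)"
    by (intro mult_left_mono) auto
  moreover have "exp (k * b) * exp (- k * b) = 1" "exp (k * b) * exp (- k * a) = exp (k * (b - a))"
    by (simp_all only: exp_add[symmetric]) (simp_all add: algebra_simps)
  ultimately show ?thesis by (simp only: mult.assoc[symmetric] mult_1)
qed

lemma right_gronwall_lower:
  fixes f :: "real \<Rightarrow> real"
  assumes ab: "a \<le> b" and cont: "continuous_on {a..b} f"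
    and der: "\<And>t. a \<le> t \<Longrightarrow> t < b \<Longrightarrow> \<exists>D. (f has_real_derivative D) (at_right t) \<and> k * f t \<le> D"
  shows "exp (k * (b - a)) * f a \<le> f b"
proof -
  have "- f b \<le> exp (k * (b - a)) * (- f a)"
  proof (rule right_gronwall[OF ab])
    fix t assume "a \<le> t" "t < b"
    then obtain D where D: "(f has_real_derivative D) (at_right t)" "k * f t \<le> D" using der by blast
    then show "\<exists>D. ((\<lambda>t. - f t) has_real_derivative D) (at_right t) \<and> D \<le> k * - f t"
      by (intro exI[of _ "- D"]) (auto intro!: derivative_eq_intros)
  qed (intro continuous_intros cont)
  then show ?thesis by simp
qed

text \<open>On a window around \<open>t\<close>, \<open>U\<close> is an indefinite integral up to a
  constant. This supplies the continuity of the transformed path when only the original path is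
  known, which is merely cadlag.\<close>

lemma has_integral_imp_continuous_on:
  fixes f :: "real \<Rightarrow> 'a::banach"
  assumes "\<And>a b. a \<le> b \<Longrightarrow> (f has_integral (U b - U a)) {a..b}"
  shows "continuous_on UNIV U"
proof (rule continuous_at_imp_continuous_on, rule ballI)
  fix t
  have "continuous_on {t-1..t+1} (\<lambda>x. U (t-1) + integral {t-1..x} f)"
    by (intro continuous_on_add continuous_on_const indefinite_integral_continuous_1
        has_integral_integrable[OF assms]) simp
  also have "?this \<longleftrightarrow> continuous_on {t-1..t+1} U"
  proof (rule continuous_on_cong[OF refl])
    fix x assume "x \<in> {t-1..t+1}"
    then show "U (t-1) + integral {t-1..x} f = U x"
      using integral_unique[OF assms[of "t-1" x]] by simp
  qed
  finally show "isCont U t" by (rule continuous_on_interior) auto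
qed

text \<open>The fundamental theorem at the left end of \<open>{t..t+1}\<close>, where the filter
  within the interval is \<open>at_right t\<close>. An integrand containing the cadlag noise is in
  general continuous from the right only.\<close>

lemma has_integral_imp_right_derivative:
  fixes f :: "real \<Rightarrow> 'a::banach"
  assumes int: "\<And>a b. a \<le> b \<Longrightarrow> (f has_integral (U b - U a)) {a..b}"
    and cont: "continuous (at_right t) f"
  shows "(U has_vector_derivative f t) (at_right t)"
proof -
  have "((\<lambda>x. integral {t..x} f) has_vector_derivative f t) (at t within ({t..t+1} - {}))"
  proof (rule integral_has_vector_derivative_continuous_at)
    show "f integrable_on {t..t+1}" using int[of t "t+1"] by auto
    have "at t within {t..t+1} = at_right t"
      by (rule at_within_Icc_at_right) simp
    with cont show "continuous (at t within ({t..t+1} - {})) f"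
      by simp
  qed auto
  then have der: "((\<lambda>x. integral {t..x} f) has_vector_derivative f t) (at t within {t..t+1})"
    by simp
  have "((\<lambda>x. U x - U t) has_vector_derivative f t) (at t within {t..t+1})"
  proof (rule has_vector_derivative_transform[OF _ _ der])
    show "U x - U t = integral {t..x} f" if "x \<in> {t..t+1}" for x
      using integral_unique[OF int[of t x]] that by simp
  qed simp
  then have "((\<lambda>x. U t + (U x - U t)) has_vector_derivative 0 + f t) (at t within {t..t+1})"
    by (intro has_vector_derivative_add has_vector_derivative_const)
  moreover have "at t within {t..t+1} = at_right t"
    by (rule at_within_Icc_at_right) simp
  ultimately show ?thesis by simp
qed

text \<open>One-sided limits give a bound near every point, and finitely many such neighbourhoods
  cover the compact interval.\<close>

lemma cadlag_bounded_Icc: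
  fixes f :: "real \<Rightarrow> 'a::real_normed_vector"
  assumes "cadlag f"
  obtains B where "\<And>t. a \<le> t \<Longrightarrow> t \<le> b \<Longrightarrow> norm (f t) \<le> B"
proof -
  have "\<exists>U B. open U \<and> t \<in> U \<and> (\<forall>s\<in>U. norm (f s) \<le> B)" for t
  proof -
    obtain l where l: "(f \<longlongrightarrow> l) (at_left t)" and r: "(f \<longlongrightarrow> f t) (at_right t)"
      using assms by (auto simp: cadlag_def continuous_within)
    have "eventually (\<lambda>s. dist (f s) l < 1) (at_left t)" "eventually (\<lambda>s. dist (f s) (f t) < 1) (at_right t)"
      using l r by (auto intro: tendstoD)
    then have "eventually (\<lambda>s. norm (f s) \<le> norm l + norm (f t) + 1) (at_left t)"
       "eventually (\<lambda>s. norm (f s) \<le> norm l + norm (f t) + 1) (at_right t)"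
      by (elim eventually_mono, smt (verit) dist_norm norm_triangle_sub norm_ge_zero)+
    then have "eventually (\<lambda>s. norm (f s) \<le> norm l + norm (f t) + 1) (at t)"
      by (simp add: eventually_at_split)
    then have "eventually (\<lambda>s. norm (f s) \<le> norm l + norm (f t) + 1) (nhds t)"
      by (subst eventually_nhds_conv_at) auto
    then show ?thesis by (auto simp: eventually_nhds)
  qed
  then obtain U B where UB: "\<And>t. open (U t)" "\<And>t. t \<in> U t" "\<And>t s. s \<in> U t \<Longrightarrow> norm (f s) \<le> B t"
    by metis
  have "{a..b} \<subseteq> (\<Union>t\<in>{a..b}. U t)" using UB by auto
  then obtain C where C: "C \<subseteq> {a..b}" "finite C" "{a..b} \<subseteq> (\<Union>t\<in>C. U t)"
    using compactE_image[OF compact_Icc, of "{a..b}" U] UB by metis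
  show ?thesis
  \<comment> \<open>The sum stands in for the maximum of the local bounds and covers the empty
    interval as well.\<close>
  proof (rule that[of "\<Sum>t\<in>C. \<bar>B t\<bar>"])
    fix s assume "a \<le> s" "s \<le> b"
    then obtain t where t: "t \<in> C" "s \<in> U t" using C by force
    then have "norm (f s) \<le> \<bar>B t\<bar>" using UB(3)[of s t] by linarith
    also have "\<dots> \<le> (\<Sum>t\<in>C. \<bar>B t\<bar>)" using C t by (intro member_le_sum) auto
    finally show "norm (f s) \<le> (\<Sum>t\<in>C. \<bar>B t\<bar>)" .
  qed
qed

text \<open>Turns the sublinear growth of the stationary process into the weight of the path space:
  for large \<open>\<bar>t\<bar>\<close> one has \<open>norm (f t) \<le> k * \<bar>t\<bar> \<le> exp
  (k * \<bar>t\<bar>)\<close>, and what remains is a compact interval.\<close>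

lemma cadlag_sublinear_exp_bound:
  fixes f :: "real \<Rightarrow> 'a::real_normed_vector"
  assumes cad: "cadlag f" and sub: "((\<lambda>t. norm (f t) / \<bar>t\<bar>) \<longlongrightarrow> 0) at_infinity" and "k > 0"
  obtains A where "A \<ge> 0" "\<And>t. t \<le> 0 \<Longrightarrow> norm (f t) \<le> A * exp (- k * t)"
proof -
  have "eventually (\<lambda>t. norm (f t) / \<bar>t\<bar> < k) at_infinity"
    using sub \<open>k > 0\<close> by (intro order_tendstoD) auto
  then obtain R where R: "\<And>t. norm t \<ge> R \<Longrightarrow> norm (f t) / \<bar>t\<bar> < k"
    unfolding eventually_at_infinity by blast
  \<comment> \<open>At least 1, so that \<open>t\<close> is nonzero beyond the window and the
    division by \<open>\<bar>t\<bar>\<close> can be undone.\<close>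
  define T where "T = max R 1"
  obtain B where B: "\<And>t. - T \<le> t \<Longrightarrow> t \<le> 0 \<Longrightarrow> norm (f t) \<le> B"
    using cadlag_bounded_Icc[OF cad, of "- T" 0] by blast
  show ?thesis
  proof (rule that[of "max 1 B"])
    fix t :: real assume t: "t \<le> 0"
    show "norm (f t) \<le> max 1 B * exp (- k * t)"
    proof (cases "t \<ge> - T")
      case True
      have "norm (f t) \<le> max 1 B * 1" using B[OF True t] by simp
      also have "\<dots> \<le> max 1 B * exp (- k * t)"
        using t \<open>k > 0\<close> by (intro mult_left_mono) (auto simp: mult_nonneg_nonpos)
      finally show ?thesis .
    next
      case False
      then have "norm t \<ge> R" "\<bar>t\<bar> > 0" using t by (auto simp: T_def)
      then have "norm (f t) < k * \<bar>t\<bar>" using R[of t] by (simp only: pos_divide_less_eq)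
      also have "\<dots> = - k * t" using t by simp
      also have "\<dots> \<le> 1 * exp (- k * t)" using exp_ge_add_one_self[of "- k * t"] by linarith
      also have "\<dots> \<le> max 1 B * exp (- k * t)" by (intro mult_right_mono) auto
      finally show ?thesis by simp
    qed
  qed simp
qed

section \<open>Surjectivity of expanding maps\<close>

text \<open>The range is open by invariance of domain. It is closed, because expansion makes the
  preimages of a convergent sequence of images a Cauchy sequence. In a connected space a nonempty
  set that is open and closed is everything.\<close>

lemma expanding_imp_surj:
  fixes f :: "'a::euclidean_space \<Rightarrow> 'a"
  assumes cont: "continuous_on UNIV f" and "c > 0"
    and expand: "\<And>x y. c * norm (x - y) \<le> norm (f x - f y)"
  shows "surj f"
proof -
  have inj: "inj f"
  proof (rule injI)
    fix x y assume "f x = f y"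
    with expand[of x y] \<open>c > 0\<close> show "x = y" by (simp add: mult_le_0_iff)
  qed
  have "open (range f)" by (rule invariance_of_domain[OF cont open_UNIV inj])
  moreover have "closed (range f)"
    unfolding closed_sequential_limits
  proof (intro allI impI, elim conjE)
    fix X l assume "\<forall>n. X n \<in> range f" and lim: "X \<longlonglongrightarrow> l"
    then have "\<forall>n. \<exists>y. X n = f y" by blast
    then obtain x where x: "\<And>n. X n = f (x n)" using choice_iff[of "\<lambda>n y. X n = f y"] by blast
    have "Cauchy X" using lim by (rule LIMSEQ_imp_Cauchy)
    have "Cauchy x"
    proof (rule metric_CauchyI)
      fix e :: real assume "e > 0"
      then have "c * e > 0" using \<open>c > 0\<close> by simp
      then obtain M where M: "\<And>m n. m \<ge> M \<Longrightarrow> n \<ge> M \<Longrightarrow> dist (X m) (X n) < c * e"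
        using metric_CauchyD[OF \<open>Cauchy X\<close>] by metis
      show "\<exists>M. \<forall>m\<ge>M. \<forall>n\<ge>M. dist (x m) (x n) < e"
      proof (intro exI allI impI)
        fix m n assume "m \<ge> M" "n \<ge> M"
        then have "norm (f (x m) - f (x n)) < c * e" using M[of m n] by (simp add: x dist_norm)
        then have "c * norm (x m - x n) < c * e" using expand[of "x m" "x n"] by linarith
        then show "dist (x m) (x n) < e" using \<open>c > 0\<close> by (simp add: dist_norm)
      qed
    qed
    then obtain y where "x \<longlonglongrightarrow> y" by (auto simp: Cauchy_convergent_iff convergent_def)
    then have "(\<lambda>n. f (x n)) \<longlonglongrightarrow> f y"
      using cont by (intro continuous_on_tendsto_compose[of UNIV f]) auto
    then have "X \<longlonglongrightarrow> f y" by (simp add: x[symmetric])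
    with lim have "l = f y" by (rule LIMSEQ_unique)
    then show "l \<in> range f" by simp
  qed
  ultimately show ?thesis using clopen[of "range f"] by auto
qed

section \<open>Measurability\<close>

text \<open>Evaluating at the next point to the right of \<open>t\<close> on a grid of mesh
  \<open>1 / Suc n\<close> involves countably many times only, so it is measurable; right continuity
  makes these functions converge.\<close>

lemma borel_measurable_right_continuous_pair:
  fixes X :: "real \<Rightarrow> 'w \<Rightarrow> 'a::metric_space"
  assumes X[measurable]: "\<And>t. X t \<in> borel_measurable M"
    and cont: "\<And>t \<omega>. \<omega> \<in> space M \<Longrightarrow> continuous (at_right t) (\<lambda>t. X t \<omega>)"
  shows "(\<lambda>(t, \<omega>). X t \<omega>) \<in> borel_measurable (borel \<Otimes>\<^sub>M M)"
proof (rule borel_measurable_LIMSEQ_metric)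
  \<comment> \<open>The summand 1 makes the grid point strictly larger than \<open>t\<close>, as
    convergence along \<open>at_right t\<close> requires.\<close>
  define q where "q n i = (real_of_int i + 1) / real (Suc n)" for n i
  show "(\<lambda>x. X (q n \<lfloor>fst x * real (Suc n)\<rfloor>) (snd x)) \<in> borel_measurable (borel \<Otimes>\<^sub>M M)" for n
    by (rule measurable_compose_countable[where f = "\<lambda>i x. X (q n i) (snd x)"]) measurable
  fix x :: "real \<times> 'w" assume x: "x \<in> space (borel \<Otimes>\<^sub>M M)"
  obtain t \<omega> where x_eq: "x = (t, \<omega>)" by force
  then have \<omega>: "\<omega> \<in> space M" using x by (simp add: space_pair_measure)
  have "(\<lambda>n. q n \<lfloor>t * real (Suc n)\<rfloor>) \<longlonglongrightarrow> t"
  proof (rule tendsto_sandwich[of "\<lambda>n. t" _ _ "\<lambda>n. t + 1 / real (Suc n)"])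
    show "(\<lambda>n. t + 1 / real (Suc n)) \<longlonglongrightarrow> t"
      using tendsto_add[OF tendsto_const LIMSEQ_inverse_real_of_nat, of t] by (simp add: inverse_eq_divide)
    have "q n \<lfloor>t * real (Suc n)\<rfloor> \<le> (t * real (Suc n) + 1) / real (Suc n)" for n
      unfolding q_def by (intro divide_right_mono add_right_mono) auto
    also have "(t * real (Suc n) + 1) / real (Suc n) = t + 1 / real (Suc n)" for n
      by (simp add: add_divide_distrib del: of_nat_Suc)
    finally show "\<forall>\<^sub>F n in sequentially. q n \<lfloor>t * real (Suc n)\<rfloor> \<le> t + 1 / real (Suc n)"
      by (intro always_eventually allI)
  qed (auto simp: q_def pos_le_divide_eq intro!: always_eventually less_imp_le simp del: of_nat_Suc)
  moreover have "t < q n \<lfloor>t * real (Suc n)\<rfloor>" for n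
    unfolding q_def by (subst pos_less_divide_eq) (auto simp del: of_nat_Suc)
  then have "q n \<lfloor>t * real (Suc n)\<rfloor> \<in> {t<..} \<and> q n \<lfloor>t * real (Suc n)\<rfloor> \<noteq> t" for n
    by (metis greaterThan_iff less_irrefl)
  ultimately have "filterlim (\<lambda>n. q n \<lfloor>t * real (Suc n)\<rfloor>) (at_right t) sequentially"
    unfolding filterlim_at by (auto intro!: always_eventually simp only:)
  with cont[OF \<omega>, of t]
  have "(\<lambda>n. X (q n \<lfloor>t * real (Suc n)\<rfloor>) \<omega>) \<longlonglongrightarrow> X t \<omega>"
    unfolding continuous_within by (rule filterlim_compose)
  then show "(\<lambda>n. X (q n \<lfloor>fst x * real (Suc n)\<rfloor>) (snd x)) \<longlonglongrightarrow> (case x of (t, \<omega>) \<Rightarrow> X t \<omega>)"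
    by (simp add: x_eq)
qed

section \<open>Picard iterates and the measurability of flows\<close>

text \<open>The weight that turns an integral over the line into the oriented integral from 0 to
  \<open>t\<close>; at \<open>t = 0\<close> the two terms cancel. It is jointly measurable, so
  forward and backward time are handled by one parameter integral.\<close>

definition signed_indicator :: "real \<Rightarrow> real \<Rightarrow> real" where
  "signed_indicator t s = (if 0 \<le> s \<and> s \<le> t then 1 else 0) - (if t \<le> s \<and> s \<le> 0 then 1 else 0)"

text \<open>The initial value sits in the second component of \<open>x\<close>. The Bochner integral
  has a default value, so the iterates are total and measurable before integrability is
  known.\<close>

primrec picard :: "(real \<Rightarrow> 'w \<Rightarrow> 'e \<Rightarrow> 'e::euclidean_space) \<Rightarrow> nat \<Rightarrow> real \<Rightarrow> 'w \<times> 'e \<Rightarrow> 'e" where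
  "picard f 0 = (\<lambda>t x. snd x)"
| "picard f (Suc k) = (\<lambda>t x. snd x + (\<integral>s. signed_indicator t s *\<^sub>R f s (fst x) (picard f k s x) \<partial>lborel))"

lemma borel_measurable_picard:
  assumes f[measurable]: "(\<lambda>(t, \<omega>, z). f t \<omega> z) \<in> borel_measurable (borel \<Otimes>\<^sub>M (M \<Otimes>\<^sub>M borel))"
  shows "(\<lambda>(t, x). picard f k t x) \<in> borel_measurable (borel \<Otimes>\<^sub>M (M \<Otimes>\<^sub>M borel))"
proof (induction k)
  case 0
  show ?case by simp
next
  case (Suc k)
  note [measurable] = Suc
  have [measurable]: "(\<lambda>(t, s). signed_indicator t s) \<in> borel_measurable (borel \<Otimes>\<^sub>M borel)"
    unfolding signed_indicator_def by measurable
  have [measurable]: "(\<lambda>y. picard f k (snd y) (snd (fst y)))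
      \<in> borel_measurable ((borel \<Otimes>\<^sub>M (M \<Otimes>\<^sub>M borel)) \<Otimes>\<^sub>M lborel)"
    using measurable_compose[OF _ Suc, of "\<lambda>y. (snd y, snd (fst y))" "(borel \<Otimes>\<^sub>M (M \<Otimes>\<^sub>M borel)) \<Otimes>\<^sub>M lborel"]
    by simp
  have [measurable]: "(\<lambda>y. f (snd y) (fst (snd (fst y))) (picard f k (snd y) (snd (fst y))))
      \<in> borel_measurable ((borel \<Otimes>\<^sub>M (M \<Otimes>\<^sub>M borel)) \<Otimes>\<^sub>M lborel)"
    using measurable_compose[OF _ f, of "\<lambda>y. (snd y, fst (snd (fst y)), picard f k (snd y) (snd (fst y)))"
        "(borel \<Otimes>\<^sub>M (M \<Otimes>\<^sub>M borel)) \<Otimes>\<^sub>M lborel"]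
    by simp
  have [measurable]: "(\<lambda>y. signed_indicator (fst (fst y)) (snd y))
      \<in> borel_measurable ((borel \<Otimes>\<^sub>M (M \<Otimes>\<^sub>M borel)) \<Otimes>\<^sub>M lborel)"
    unfolding signed_indicator_def by measurable
  have "(\<lambda>(x, s). signed_indicator (fst x) s *\<^sub>R f s (fst (snd x)) (picard f k s (snd x)))
      \<in> borel_measurable ((borel \<Otimes>\<^sub>M (M \<Otimes>\<^sub>M borel)) \<Otimes>\<^sub>M lborel)"
    by (simp add: case_prod_beta')
  then have [measurable]: "(\<lambda>x. \<integral>s. signed_indicator (fst x) s *\<^sub>R f s (fst (snd x)) (picard f k s (snd x)) \<partial>lborel)
      \<in> borel_measurable (borel \<Otimes>\<^sub>M (M \<Otimes>\<^sub>M borel))"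
    by (rule lborel.borel_measurable_lebesgue_integral)
  show ?case by (simp add: case_prod_beta')
qed

text \<open>The gain \<open>1 / (2 * L)\<close> under the weight
  \<open>exp (2 * L * \<bar>t\<bar>)\<close>: together with a Lipschitz constant \<open>L\<close> it
  makes the Picard map a contraction with factor 1/2, whatever the length of the time
  interval.\<close>

lemma integral_exp_abs_le:
  fixes L :: real
  assumes "0 < L"
  shows "integral {min 0 t..max 0 t} (\<lambda>s. exp (2 * L * \<bar>s\<bar>)) \<le> exp (2 * L * \<bar>t\<bar>) / (2 * L)"
proof -
  have "((\<lambda>s. exp (2 * L * \<bar>s\<bar>)) has_integral (exp (2 * L * \<bar>t\<bar>) - 1) / (2 * L)) {min 0 t..max 0 t}"
  proof (cases "0 \<le> t")
    case True
    have "((\<lambda>s. exp (2 * L * s)) has_integral exp (2 * L * t) / (2 * L) - exp (2 * L * 0) / (2 * L)) {0..t}"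
      using True assms
      by (intro fundamental_theorem_of_calculus)
         (auto intro!: derivative_eq_intros simp: has_real_derivative_iff_has_vector_derivative[symmetric])
    then have "((\<lambda>s. exp (2 * L * \<bar>s\<bar>)) has_integral exp (2 * L * t) / (2 * L) - exp (2 * L * 0) / (2 * L)) {0..t}"
      by (rule has_integral_eq[rotated]) auto
    then show ?thesis using True by (simp add: min_def max_def diff_divide_distrib)
  next
    case False
    have "((\<lambda>s. exp (- 2 * L * s)) has_integral - exp (- 2 * L * 0) / (2 * L) - (- exp (- 2 * L * t) / (2 * L))) {t..0}"
      using False assms
      by (intro fundamental_theorem_of_calculus)
         (auto intro!: derivative_eq_intros simp: has_real_derivative_iff_has_vector_derivative[symmetric])
    then have "((\<lambda>s. exp (2 * L * \<bar>s\<bar>)) has_integral - exp (- 2 * L * 0) / (2 * L) - (- exp (- 2 * L * t) / (2 * L))) {t..0}"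
      by (rule has_integral_eq[rotated]) auto
    then show ?thesis using False by (simp add: min_def max_def diff_divide_distrib)
  qed
  then have "integral {min 0 t..max 0 t} (\<lambda>s. exp (2 * L * \<bar>s\<bar>)) = (exp (2 * L * \<bar>t\<bar>) - 1) / (2 * L)"
    by (rule integral_unique)
  also have "\<dots> \<le> exp (2 * L * \<bar>t\<bar>) / (2 * L)" using assms by (intro divide_right_mono) auto
  finally show "integral {min 0 t..max 0 t} (\<lambda>s. exp (2 * L * \<bar>s\<bar>)) \<le> exp (2 * L * \<bar>t\<bar>) / (2 * L)" .
qed

text \<open>Connects the Lebesgue integral of the iterates, which gives measurability, with the
  gauge integral in which solutions are stated.\<close>

lemma signed_integral:
  fixes h :: "real \<Rightarrow> 'e::euclidean_space"
  assumes h: "h \<in> borel_measurable borel" and "t \<noteq> 0"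
    and bdd: "\<And>s. \<bar>s\<bar> \<le> \<bar>t\<bar> \<Longrightarrow> norm (h s) \<le> B"
  shows "h integrable_on {min 0 t..max 0 t}"
    "(\<integral>s. signed_indicator t s *\<^sub>R h s \<partial>lborel) = sgn t *\<^sub>R integral {min 0 t..max 0 t} h"
proof -
  let ?J = "{min 0 t..max 0 t}"
  have "integrable lborel (\<lambda>s. indicator ?J s *\<^sub>R h s)"
    using h bdd by (intro integrableI_bounded_set_indicator[where B = B]) (auto intro!: AE_I2)
  then have "set_integrable lborel ?J h" by (simp add: set_integrable_def)
  from set_borel_integral_eq_integral[OF this]
  show "h integrable_on ?J" by auto
  have eq: "(LINT s:?J|lborel. h s) = integral ?J h"
    by (rule set_borel_integral_eq_integral[OF \<open>set_integrable lborel ?J h\<close>])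
  have eq2: "signed_indicator t s *\<^sub>R h s = sgn t *\<^sub>R (indicator ?J s *\<^sub>R h s)" for s
    using \<open>t \<noteq> 0\<close> by (auto simp: signed_indicator_def indicator_def sgn_if)
  then show "(\<integral>s. signed_indicator t s *\<^sub>R h s \<partial>lborel) = sgn t *\<^sub>R integral ?J h"
    by (simp only: eq2 integral_scaleR_right eq[unfolded set_lebesgue_integral_def])
qed

text \<open>The solution \<open>u\<close> is given, so no existence argument is involved: in the
  norm weighted by \<open>exp (2 * L * \<bar>s\<bar>)\<close> the error bound for the iterates
  against \<open>u\<close> is halved at each step.\<close>

lemma picard_converges:
  fixes f :: "real \<Rightarrow> 'w \<Rightarrow> 'e::euclidean_space \<Rightarrow> 'e"
  assumes f: "(\<lambda>(t, \<omega>, z). f t \<omega> z) \<in> borel_measurable (borel \<Otimes>\<^sub>M (M \<Otimes>\<^sub>M borel))"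
    and "0 < L" and lip: "\<And>t z z'. norm (f t \<omega> z - f t \<omega> z') \<le> L * norm (z - z')"
    and bdd: "\<And>T. \<exists>B. \<forall>s. \<bar>s\<bar> \<le> T \<longrightarrow> norm (f s \<omega> 0) \<le> B"
    and \<omega>: "\<omega> \<in> space M" and cont: "continuous_on UNIV u" and init: "u 0 = z"
    and int: "\<And>a b. a \<le> b \<Longrightarrow> ((\<lambda>s. f s \<omega> (u s)) has_integral (u b - u a)) {a..b}"
  shows "(\<lambda>k. picard f k t (\<omega>, z)) \<longlonglongrightarrow> u t"
proof -
  define T where "T = \<bar>t\<bar>"
  have sect: "(\<lambda>s. f s \<omega> (v s)) \<in> borel_measurable borel" if [measurable]: "v \<in> borel_measurable borel" for v
    using measurable_compose[OF _ f, of "\<lambda>s. (s, \<omega>, v s)" borel] \<omega> by simp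
  have u_meas: "u \<in> borel_measurable borel" using cont by (rule borel_measurable_continuous_onI)
  have v_meas: "(\<lambda>s. picard f k s (\<omega>, z)) \<in> borel_measurable borel" for k
    using measurable_compose[OF _ borel_measurable_picard[OF f], of "\<lambda>s. (s, \<omega>, z)" borel k] \<omega> by simp
  obtain F where F: "\<And>s. \<bar>s\<bar> \<le> T \<Longrightarrow> norm (f s \<omega> 0) \<le> F" using bdd by blast
  have "bounded (u ` {- T..T})"
    using cont by (intro compact_imp_bounded compact_continuous_image) (auto intro: continuous_on_subset)
  then obtain U where U: "\<And>s. \<bar>s\<bar> \<le> T \<Longrightarrow> norm (u s) \<le> U" by (fastforce simp: bounded_iff abs_le_iff)
  have U0: "0 \<le> U" by (rule order.trans[OF norm_ge_zero U[of 0]]) (simp add: T_def)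
  \<comment> \<open>Bounds the distance of the constant zeroth iterate \<open>z\<close> from
    \<open>u\<close>.\<close>
  define B where "B = norm z + U"
  have B0: "0 \<le> B" using U0 by (simp add: B_def)
  have f_bdd: "norm (f s \<omega> v) \<le> F + L * R" if "\<bar>s\<bar> \<le> T" "norm v \<le> R" for s v R
  proof -
    have "norm (f s \<omega> v) \<le> norm (f s \<omega> 0) + norm (f s \<omega> v - f s \<omega> 0)" by (rule norm_triangle_sub)
    also have "\<dots> \<le> F + L * norm v" using F[OF that(1)] lip[of s v 0] by (intro add_mono) auto
    also have "\<dots> \<le> F + L * R" using that \<open>0 < L\<close> by simp
    finally show ?thesis .
  qed
  have bound: "norm (picard f k s (\<omega>, z) - u s) \<le> B * (1 / 2) ^ k * exp (2 * L * \<bar>s\<bar>)" if "\<bar>s\<bar> \<le> T" for k s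
    using that
  proof (induction k arbitrary: s)
    case 0
    have "norm (z - u s) \<le> B * 1" unfolding B_def using norm_triangle_ineq4[of z "u s"] U[OF 0] by simp
    also have "\<dots> \<le> B * exp (2 * L * \<bar>s\<bar>)" using B0 \<open>0 < L\<close> by (intro mult_left_mono) auto
    finally show ?case by simp
  next
    case (Suc k)
    let ?v = "\<lambda>s. picard f k s (\<omega>, z)"
    show ?case
    proof (cases "s = 0")
      case True
      have "signed_indicator 0 = (\<lambda>s. 0)" by (auto simp: signed_indicator_def)
      then show ?thesis using True B0 init by simp
    next
      case False
      let ?J = "{min 0 s..max 0 s}"
      have v_bdd: "norm (?v r) \<le> U + B * (1 / 2) ^ k * exp (2 * L * T)" if "\<bar>r\<bar> \<le> \<bar>s\<bar>" for r
      proof -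
        have r: "\<bar>r\<bar> \<le> T" using that Suc.prems by linarith
        have "norm (?v r) \<le> norm (u r) + norm (?v r - u r)" by (rule norm_triangle_sub)
        also have "\<dots> \<le> U + B * (1 / 2) ^ k * exp (2 * L * \<bar>r\<bar>)" by (intro add_mono U Suc.IH r)
        also have "\<dots> \<le> U + B * (1 / 2) ^ k * exp (2 * L * T)"
          using r B0 \<open>0 < L\<close> by (intro add_left_mono mult_left_mono) auto
        finally show ?thesis .
      qed
      have intv: "(\<lambda>r. f r \<omega> (?v r)) integrable_on ?J"
        "(\<integral>r. signed_indicator s r *\<^sub>R f r \<omega> (?v r) \<partial>lborel) = sgn s *\<^sub>R integral ?J (\<lambda>r. f r \<omega> (?v r))"
        using signed_integral[OF sect[OF v_meas] False, where B = "F + L * (U + B * (1 / 2) ^ k * exp (2 * L * T))"]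
          f_bdd[OF _ v_bdd] Suc.prems by (auto intro: order.trans)
      have intu: "((\<lambda>r. f r \<omega> (u r)) has_integral (u (max 0 s) - u (min 0 s))) ?J"
        by (intro int) auto
      have "u s - z = sgn s *\<^sub>R integral ?J (\<lambda>r. f r \<omega> (u r))"
        unfolding integral_unique[OF intu] using False init by (auto simp: sgn_if min_def max_def)
      then have "picard f (Suc k) s (\<omega>, z) - u s
          = sgn s *\<^sub>R (integral ?J (\<lambda>r. f r \<omega> (?v r)) - integral ?J (\<lambda>r. f r \<omega> (u r)))"
        using intv(2) by (simp add: algebra_simps)
      also have "norm \<dots> = norm (integral ?J (\<lambda>r. f r \<omega> (?v r) - f r \<omega> (u r)))"
        using False intv(1) intu by (subst integral_diff) (auto simp: sgn_if)
      also have "\<dots> \<le> integral ?J (\<lambda>r. L * (B * (1 / 2) ^ k) * exp (2 * L * \<bar>r\<bar>))"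
      proof (rule integral_norm_bound_integral)
        show "(\<lambda>r. f r \<omega> (?v r) - f r \<omega> (u r)) integrable_on ?J"
          using intv(1) intu by (intro integrable_diff) auto
        show "(\<lambda>r. L * (B * (1 / 2) ^ k) * exp (2 * L * \<bar>r\<bar>)) integrable_on ?J"
          by (intro integrable_continuous_real continuous_intros)
        fix r assume "r \<in> ?J"
        then have r: "\<bar>r\<bar> \<le> T" using Suc.prems by (auto simp: min_def max_def split: if_splits)
        have "norm (f r \<omega> (?v r) - f r \<omega> (u r)) \<le> L * norm (?v r - u r)" by (rule lip)
        also have "\<dots> \<le> L * (B * (1 / 2) ^ k * exp (2 * L * \<bar>r\<bar>))"
          using \<open>0 < L\<close> Suc.IH[OF r] by (intro mult_left_mono) auto
        finally show "norm (f r \<omega> (?v r) - f r \<omega> (u r)) \<le> L * (B * (1 / 2) ^ k) * exp (2 * L * \<bar>r\<bar>)"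
          by (simp add: mult.assoc)
      qed
      also have "\<dots> = L * (B * (1 / 2) ^ k) * integral ?J (\<lambda>r. exp (2 * L * \<bar>r\<bar>))" by simp
      also have "\<dots> \<le> L * (B * (1 / 2) ^ k) * (exp (2 * L * \<bar>s\<bar>) / (2 * L))"
        using integral_exp_abs_le[OF \<open>0 < L\<close>, of s] \<open>0 < L\<close> B0 by (intro mult_left_mono) auto
      also have "\<dots> = B * (1 / 2) ^ Suc k * exp (2 * L * \<bar>s\<bar>)" using \<open>0 < L\<close> by simp
      finally show ?thesis .
    qed
  qed
  have "(\<lambda>k. B * (1 / 2) ^ k * exp (2 * L * \<bar>t\<bar>)) \<longlonglongrightarrow> B * 0 * exp (2 * L * \<bar>t\<bar>)"
    by (intro tendsto_intros LIMSEQ_realpow_zero) auto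
  then have "(\<lambda>k. B * (1 / 2) ^ k * exp (2 * L * \<bar>t\<bar>)) \<longlonglongrightarrow> 0" by simp
  then have "(\<lambda>k. norm (picard f k t (\<omega>, z) - u t)) \<longlonglongrightarrow> 0"
    by (rule tendsto_sandwich[OF _ _ tendsto_const, rotated 2])
       (auto intro!: always_eventually bound simp: T_def)
  then show ?thesis by (simp add: tendsto_norm_zero_iff LIM_zero_iff)
qed

text \<open>A flow known only through its solution property is the pointwise limit of jointly
  measurable iterates.\<close>

lemma borel_measurable_flow:
  fixes f u :: "real \<Rightarrow> 'w \<Rightarrow> 'e::euclidean_space \<Rightarrow> 'e"
  assumes "(\<lambda>(t, \<omega>, z). f t \<omega> z) \<in> borel_measurable (borel \<Otimes>\<^sub>M (M \<Otimes>\<^sub>M borel))"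
    and "0 < L" and "\<And>t \<omega> z z'. \<omega> \<in> space M \<Longrightarrow> norm (f t \<omega> z - f t \<omega> z') \<le> L * norm (z - z')"
    and "\<And>T \<omega>. \<omega> \<in> space M \<Longrightarrow> \<exists>B. \<forall>s. \<bar>s\<bar> \<le> T \<longrightarrow> norm (f s \<omega> 0) \<le> B"
    and "\<And>\<omega> z. \<omega> \<in> space M \<Longrightarrow> continuous_on UNIV (\<lambda>t. u t \<omega> z)"
    and "\<And>\<omega> z. \<omega> \<in> space M \<Longrightarrow> u 0 \<omega> z = z"
    and "\<And>\<omega> z a b. \<omega> \<in> space M \<Longrightarrow> a \<le> b \<Longrightarrow>
      ((\<lambda>s. f s \<omega> (u s \<omega> z)) has_integral (u b \<omega> z - u a \<omega> z)) {a..b}"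
  shows "(\<lambda>(t, \<omega>, z). u t \<omega> z) \<in> borel_measurable (borel \<Otimes>\<^sub>M (M \<Otimes>\<^sub>M borel))"
proof (rule borel_measurable_LIMSEQ_metric[OF borel_measurable_picard[OF assms(1)]])
  fix x :: "real \<times> 'w \<times> 'e" assume "x \<in> space (borel \<Otimes>\<^sub>M M \<Otimes>\<^sub>M borel)"
  then obtain t \<omega> z where x: "x = (t, \<omega>, z)" and \<omega>: "\<omega> \<in> space M" by (auto simp: space_pair_measure)
  have "(\<lambda>k. picard f k t (\<omega>, z)) \<longlonglongrightarrow> u t \<omega> z"
    using assms \<omega> by (intro picard_converges[where M = M and L = L]) auto
  then show "(\<lambda>k. case x of (t, y) \<Rightarrow> picard f k t y) \<longlonglongrightarrow> (case x of (t, \<omega>, z) \<Rightarrow> u t \<omega> z)"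
    by (simp add: x)
qed

section \<open>The matrix exponential\<close>

lemma matrix_power_scaleR:
  fixes A :: "real^'n^'n"
  shows "((**) (t *\<^sub>R A) ^^ k) (mat 1) = t ^ k *\<^sub>R ((**) A ^^ k) (mat 1)"
  by (induction k) (simp_all add: scalar_matrix_assoc[symmetric] matrix_scalar_ac mult.commute)

text \<open>Left multiplication by \<open>A\<close> is a linear map of a finite-dimensional space;
  its bound \<open>C\<close> controls the powers, and the exponential series of \<open>C\<close>
  dominates.\<close>

lemma summable_matrix_exp:
  fixes A :: "real^'n^'n"
  shows "summable (\<lambda>k. inverse (fact k) *\<^sub>R ((**) A ^^ k) (mat 1))"
proof -
  have "linear ((**) A :: real^'n^'n \<Rightarrow> real^'n^'n)"
    by (intro linearI) (simp_all add: matrix_add_ldistrib matrix_scalar_ac scalar_matrix_assoc[symmetric])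
  then obtain C where C: "C > 0" "\<And>B :: real^'n^'n. norm (A ** B) \<le> C * norm B"
    by (rule linear_bounded_pos) blast
  have bound: "norm (((**) A ^^ k) (mat 1)) \<le> C ^ k * norm (mat 1 :: real^'n^'n)" for k
  proof (induction k)
    case (Suc k)
    have "norm (((**) A ^^ Suc k) (mat 1)) \<le> C * norm (((**) A ^^ k) (mat 1))" using C(2) by simp
    also have "\<dots> \<le> C * (C ^ k * norm (mat 1 :: real^'n^'n))" using Suc C(1) by (intro mult_left_mono) auto
    finally show ?case by simp
  qed simp
  show ?thesis
  proof (rule summable_comparison_test')
    show "summable (\<lambda>k. norm (mat 1 :: real^'n^'n) * (inverse (fact k) * C ^ k))"
      by (intro summable_mult summable_exp)
    show "norm (inverse (fact k) *\<^sub>R ((**) A ^^ k) (mat 1))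
        \<le> norm (mat 1 :: real^'n^'n) * (inverse (fact k) * C ^ k)" for k
      using mult_left_mono[OF bound[of k], of "inverse (fact k)"] by (simp add: mult_ac)
  qed
qed

text \<open>Pairing with \<open>x\<close> on both sides turns the matrix exponential into a scalar
  power series in \<open>t\<close>; the derivative at 0 is its first coefficient.\<close>

lemma has_real_derivative_inner_matrix_exp:
  fixes A :: "real^'n^'n"
  shows "((\<lambda>t. x \<bullet> (matrix_exp (t *\<^sub>R A) *v x)) has_real_derivative x \<bullet> (A *v x)) (at 0)"
proof -
  define c where "c k = inverse (fact k) * (x \<bullet> (((**) A ^^ k) (mat 1) *v x))" for k
  have "linear (\<lambda>N :: real^'n^'n. x \<bullet> (N *v x))"
    by (intro linearI)
       (simp_all add: matrix_vector_mult_add_rdistrib inner_add_right scaleR_matrix_vector_assoc[symmetric])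
  then have bl: "bounded_linear (\<lambda>N :: real^'n^'n. x \<bullet> (N *v x))"
    by (simp add: linear_conv_bounded_linear)
  have summand: "x \<bullet> ((inverse (fact k) *\<^sub>R ((**) (t *\<^sub>R A) ^^ k) (mat 1)) *v x) = c k * t ^ k" for t k
    by (simp add: matrix_power_scaleR c_def scaleR_matrix_vector_assoc[symmetric] mult_ac)
  have summable: "summable (\<lambda>k. c k * t ^ k)" for t
    using bounded_linear.summable[OF bl summable_matrix_exp[of "t *\<^sub>R A"]] unfolding summand .
  have eq: "x \<bullet> (matrix_exp (t *\<^sub>R A) *v x) = (\<Sum>k. c k * t ^ k)" for t
    unfolding matrix_exp_def bounded_linear.suminf[OF bl summable_matrix_exp] summand ..
  have "((\<lambda>t. \<Sum>k. c k * t ^ k) has_real_derivative (\<Sum>k. diffs c k * 0 ^ k)) (at 0)"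
    by (rule termdiffs_strong_converges_everywhere[OF summable])
  also have "(\<Sum>k. diffs c k * 0 ^ k) = x \<bullet> (A *v x)"
    by (simp add: powser_zero diffs_def c_def)
  finally show ?thesis by (simp add: eq)
qed

lemma matrix_exp_0_vector: "matrix_exp (0 *\<^sub>R A) *v x = x" for A :: "real^'n^'n"
proof -
  have "matrix_exp (0 *\<^sub>R A) = (\<Sum>k. 0 ^ k *\<^sub>R (inverse (fact k) *\<^sub>R ((**) A ^^ k) (mat 1)))"
    unfolding matrix_exp_def matrix_power_scaleR by (simp add: mult.commute)
  also have "\<dots> = (\<Sum>k\<in>{0}. 0 ^ k *\<^sub>R (inverse (fact k) *\<^sub>R ((**) A ^^ k) (mat 1)))"
    by (rule suminf_finite) auto
  finally show ?thesis by simp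
qed

lemma inner_matrix_exp_le:
  fixes A :: "real^'n^'n"
  assumes "norm (matrix_exp (t *\<^sub>R A) *v x) \<le> exp (g * t) * norm x"
  shows "x \<bullet> (matrix_exp (t *\<^sub>R A) *v x) \<le> (norm x)\<^sup>2 * exp (g * t)"
proof -
  have "x \<bullet> (matrix_exp (t *\<^sub>R A) *v x) \<le> norm x * norm (matrix_exp (t *\<^sub>R A) *v x)"
    by (rule norm_cauchy_schwarz)
  also have "\<dots> \<le> norm x * (exp (g * t) * norm x)" using assms by (intro mult_left_mono) auto
  finally show ?thesis by (simp add: power2_eq_square mult_ac)
qed

text \<open>By Cauchy-Schwarz \<open>?f\<close> is nonnegative for \<open>t \<le> 0\<close>, and it
  vanishes at 0, because the bound has the constant 1 in front of the exponential. So its derivative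
  \<open>g * (norm x)\<^sup>2 - x \<bullet> (A *v x)\<close> at 0 cannot be positive. This is the
  form in which (A1) enters the cone estimates.\<close>

lemma backward_contraction_imp_inner_ge:
  fixes A :: "real^'n^'n"
  assumes "\<And>t. t \<le> 0 \<Longrightarrow> norm (matrix_exp (t *\<^sub>R A) *v x) \<le> exp (g * t) * norm x"
  shows "g * (norm x)\<^sup>2 \<le> x \<bullet> (A *v x)"
proof (rule ccontr)
  assume neg: "\<not> ?thesis"
  let ?f = "\<lambda>t. (norm x)\<^sup>2 * exp (g * t) - x \<bullet> (matrix_exp (t *\<^sub>R A) *v x)"
  have "(?f has_real_derivative g * (norm x)\<^sup>2 - x \<bullet> (A *v x)) (at 0)"
    by (auto intro!: derivative_eq_intros has_real_derivative_inner_matrix_exp)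
  from DERIV_pos_inc_left[OF this] neg
  obtain d where d: "d > 0" "\<And>h. 0 < h \<Longrightarrow> h < d \<Longrightarrow> ?f (0 - h) < ?f 0" by auto
  have "?f 0 = 0" by (simp add: matrix_exp_0_vector[unfolded scaleR_zero_left] power2_norm_eq_inner)
  moreover have "0 \<le> ?f (0 - d / 2)" using inner_matrix_exp_le[OF assms[of "0 - d / 2"]] d by simp
  ultimately show False using d(2)[of "d / 2"] d(1) by linarith
qed

lemma forward_contraction_imp_inner_le:
  fixes A :: "real^'n^'n"
  assumes "\<And>t. 0 \<le> t \<Longrightarrow> norm (matrix_exp (t *\<^sub>R A) *v x) \<le> exp (g * t) * norm x"
  shows "x \<bullet> (A *v x) \<le> g * (norm x)\<^sup>2"
proof (rule ccontr)
  assume neg: "\<not> ?thesis"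
  let ?f = "\<lambda>t. (norm x)\<^sup>2 * exp (g * t) - x \<bullet> (matrix_exp (t *\<^sub>R A) *v x)"
  have "(?f has_real_derivative g * (norm x)\<^sup>2 - x \<bullet> (A *v x)) (at 0)"
    by (auto intro!: derivative_eq_intros has_real_derivative_inner_matrix_exp)
  from DERIV_neg_dec_right[OF this] neg
  obtain d where d: "d > 0" "\<And>h. 0 < h \<Longrightarrow> h < d \<Longrightarrow> ?f (0 + h) < ?f 0" by auto
  have "?f 0 = 0" by (simp add: matrix_exp_0_vector[unfolded scaleR_zero_left] power2_norm_eq_inner)
  moreover have "0 \<le> ?f (0 + d / 2)" using inner_matrix_exp_le[OF assms[of "0 + d / 2"]] d by simp
  ultimately show False using d(2)[of "d / 2"] d(1) by linarith
qed

section \<open>The Ornstein--Uhlenbeck integral\<close>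

definition RS_sum ::
    "(real \<Rightarrow> real^'n^'m) \<Rightarrow> (real \<Rightarrow> real^'n) \<Rightarrow> (real \<times> real set) set \<Rightarrow> real^'m" where
  "RS_sum \<Phi> \<omega> p = (\<Sum>(x, k)\<in>p. \<Phi> x *v (\<omega> (Sup k) - \<omega> (Inf k)))"

text \<open>One sequence of divisions, chosen independently of the path: along it the
  Riemann-Stieltjes integral is a pointwise limit of finite sums of increments, hence measurable in
  the path.\<close>

definition fine_division :: "real \<Rightarrow> nat \<Rightarrow> (real \<times> real set) set" where
  "fine_division a k = (SOME p. p tagged_division_of {a..0} \<and> (\<lambda>x. ball x (1 / real (Suc k))) fine p)"

lemma fine_division:
  "fine_division a k tagged_division_of {a..0}" "(\<lambda>x. ball x (1 / real (Suc k))) fine (fine_division a k)"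
proof -
  have "gauge (\<lambda>x :: real. ball x (1 / real (Suc k)))" by (intro gauge_ball) simp
  then obtain p where "p tagged_division_of {a..0}" "(\<lambda>x. ball x (1 / real (Suc k))) fine p"
    by (rule fine_division_exists_real)
  then have "\<exists>p. p tagged_division_of {a..0} \<and> (\<lambda>x. ball x (1 / real (Suc k))) fine p" by blast
  from someI_ex[OF this] show "fine_division a k tagged_division_of {a..0}"
    "(\<lambda>x. ball x (1 / real (Suc k))) fine (fine_division a k)"
    by (simp_all add: fine_division_def)
qed

lemma RS_sum_tendsto:
  assumes "has_RS_integral \<Phi> \<omega> I a 0"
  shows "(\<lambda>k. RS_sum \<Phi> \<omega> (fine_division a k)) \<longlonglongrightarrow> I"
proof (rule metric_LIMSEQ_I)
  fix e :: real assume "e > 0"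
  with assms have "\<exists>d>0. \<forall>p. p tagged_division_of {a..0} \<and> (\<lambda>x. ball x d) fine p \<longrightarrow>
      norm (RS_sum \<Phi> \<omega> p - I) < e"
    unfolding has_RS_integral_def RS_sum_def by (elim allE impE)
  then obtain d where d: "d > 0" "\<And>p. p tagged_division_of {a..0} \<Longrightarrow> (\<lambda>x. ball x d) fine p \<Longrightarrow>
      norm (RS_sum \<Phi> \<omega> p - I) < e" by metis
  obtain n where n: "1 / real (Suc n) < d" using d(1) nat_approx_posE by blast
  show "\<exists>n. \<forall>k\<ge>n. dist (RS_sum \<Phi> \<omega> (fine_division a k)) I < e"
  proof (intro exI allI impI)
    fix k assume "n \<le> k"
    then have "1 / real (Suc k) \<le> 1 / real (Suc n)" by (intro divide_left_mono) auto
    with n have "1 / real (Suc k) \<le> d" by linarith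
    then have "(\<lambda>x. ball x d) fine fine_division a k"
      using fine_division(2)[where a = a and k = k] subset_ball[of "1 / real (Suc k)" d]
      unfolding fine_def by blast
    then show "dist (RS_sum \<Phi> \<omega> (fine_division a k)) I < e"
      using d(2)[OF fine_division(1)] by (simp add: dist_norm)
  qed
qed

text \<open>Both candidates are limits along the same divisions, and the windows with
  \<open>a \<le> 0\<close> determine the limit at minus infinity. This makes the description in
  \<open>eta\<close> determinate.\<close>

lemma has_OU_integral_unique:
  assumes "has_OU_integral F \<epsilon> \<omega> I" "has_OU_integral F \<epsilon> \<omega> I'"
  shows "I = I'"
proof -
  let ?\<Phi> = "\<lambda>s. matrix_exp ((- s / \<epsilon>) *\<^sub>R F)"
  obtain J where J: "\<And>a. a \<le> 0 \<Longrightarrow> has_RS_integral ?\<Phi> \<omega> (J a) a 0" "(J \<longlongrightarrow> I) at_bot"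
    using assms(1) by (auto simp: has_OU_integral_def)
  obtain J' where J': "\<And>a. a \<le> 0 \<Longrightarrow> has_RS_integral ?\<Phi> \<omega> (J' a) a 0" "(J' \<longlongrightarrow> I') at_bot"
    using assms(2) by (auto simp: has_OU_integral_def)
  have eq: "J a = J' a" if "a \<le> 0" for a
    using RS_sum_tendsto[OF J(1)[OF that]] RS_sum_tendsto[OF J'(1)[OF that]] by (rule LIMSEQ_unique)
  have "(J \<longlongrightarrow> I') at_bot"
    by (rule Lim_transform_eventually[OF J'(2)])
       (auto intro!: eventually_mono[OF eventually_le_at_bot[of 0]] simp: eq)
  with J(2) show ?thesis by (intro tendsto_unique) auto
qed

text \<open>\<open>eta\<close> is a double limit, over refining divisions and then over growing
  windows, of finite sums of increments. The family \<open>X\<close> is arbitrary so that shifted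
  paths can be inserted.\<close>

lemma borel_measurable_eta:
  fixes X :: "'w \<Rightarrow> real \<Rightarrow> real^'n"
  assumes X[measurable]: "\<And>s. (\<lambda>x. X x s) \<in> borel_measurable M"
    and ex: "\<And>x. x \<in> space M \<Longrightarrow> \<exists>I. has_OU_integral F \<epsilon> (X x) I"
  shows "(\<lambda>x. eta F \<alpha> \<epsilon> (X x)) \<in> borel_measurable M"
proof -
  let ?\<Phi> = "\<lambda>s. matrix_exp ((- s / \<epsilon>) *\<^sub>R F)"
  have "\<forall>x\<in>space M. \<exists>JI. (\<forall>a\<le>0. has_RS_integral ?\<Phi> (X x) (fst JI a) a 0) \<and> (fst JI \<longlongrightarrow> snd JI) at_bot"
  proof
    fix x assume "x \<in> space M"
    then obtain I J where "\<forall>a\<le>0. has_RS_integral ?\<Phi> (X x) (J a) a 0" "(J \<longlongrightarrow> I) at_bot"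
      using ex unfolding has_OU_integral_def by blast
    then show "\<exists>JI. (\<forall>a\<le>0. has_RS_integral ?\<Phi> (X x) (fst JI a) a 0) \<and> (fst JI \<longlongrightarrow> snd JI) at_bot"
      by (intro exI[of _ "(J, I)"]) (simp only: fst_conv snd_conv)
  qed
  then obtain JI where JI: "\<And>x. x \<in> space M \<Longrightarrow>
      (\<forall>a\<le>0. has_RS_integral ?\<Phi> (X x) (fst (JI x) a) a 0) \<and> (fst (JI x) \<longlongrightarrow> snd (JI x)) at_bot"
    unfolding bchoice_iff by blast
  define J where "J x = fst (JI x)" for x
  define I where "I x = snd (JI x)" for x
  have J: "\<And>x a. x \<in> space M \<Longrightarrow> a \<le> 0 \<Longrightarrow> has_RS_integral ?\<Phi> (X x) (J x a) a 0"
    and I: "\<And>x. x \<in> space M \<Longrightarrow> (J x \<longlongrightarrow> I x) at_bot" using JI by (auto simp: J_def I_def)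
  have mult[measurable]: "(\<lambda>v. N *v v) \<in> borel_measurable borel" for N :: "real^'n^'n"
    by (intro borel_measurable_continuous_onI linear_continuous_on matrix_vector_mul_bounded_linear)
  have "(\<lambda>x. RS_sum ?\<Phi> (X x) p) \<in> borel_measurable M" for p
    unfolding RS_sum_def split_def by measurable
  then have J_meas: "(\<lambda>x. J x a) \<in> borel_measurable M" if "a \<le> 0" for a
    by (rule borel_measurable_LIMSEQ_metric) (rule RS_sum_tendsto[OF J[OF _ that]])
  have bot: "filterlim (\<lambda>n. - real n) at_bot sequentially"
    by (simp add: filterlim_uminus_at_bot filterlim_real_sequentially)
  have [measurable]: "I \<in> borel_measurable M"
  proof (rule borel_measurable_LIMSEQ_metric[of "\<lambda>n x. J x (- real n)"])
    show "(\<lambda>n. J x (- real n)) \<longlonglongrightarrow> I x" if "x \<in> space M" for x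
      using I[OF that] bot by (rule filterlim_compose)
  qed (auto intro: J_meas)
  have "eta F \<alpha> \<epsilon> (X x) = (\<epsilon> powr (- 1 / \<alpha>)) *\<^sub>R I x" if "x \<in> space M" for x
  proof -
    have "has_OU_integral F \<epsilon> (X x) (I x)"
      unfolding has_OU_integral_def using J I that by blast
    then have "(THE I. has_OU_integral F \<epsilon> (X x) I) = I x"
      by (intro the_equality) (auto intro: has_OU_integral_unique)
    then show ?thesis by (simp add: eta_def)
  qed
  then show ?thesis by (subst measurable_cong) auto
qed

section \<open>The cone condition\<close>

text \<open>Algebraic core of the estimate for \<open>V\<close>: \<open>a\<close> and
  \<open>p\<close> are the norms of the fast and the slow component, \<open>r\<close> is the size of
  the noise, \<open>i = 1 / \<epsilon>\<close>, \<open>d = \<delta>\<close>,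
  \<open>c = \<gamma>\<close>. In terms of \<open>b = l * p\<close> it compares quadratic forms. The
  self-interaction cancels the \<open>- K\<close>, leaving the rate \<open>i * (c + d)\<close> for
  \<open>a\<^sup>2\<close>; half of \<open>i * d\<close> is given up. \<open>Kl\<close> makes the
  slow influence on the fast equation a fraction of \<open>d\<close>, and \<open>small\<close> makes
  the coupling in the slow equation a fraction of \<open>i * d\<close>.\<close>

lemma cone_inequality:
  fixes i K d c l a p r :: real
  assumes i: "0 < i" and K: "0 < K" and d: "0 < d" and c: "0 < c" and l: "0 < l"
    and Kl: "4 * K \<le> l * d" and small: "K + l * K \<le> i * d / 4"
    and nonneg: "0 \<le> a" "0 \<le> p" "0 \<le> r"
  shows "i * ((- d - c - K) * a\<^sup>2 + a * (K * (p + a + r))) + l\<^sup>2 * (p * (K * (p + a + r)))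
    \<le> - (i * (c + d / 2)) * (a\<^sup>2 - l\<^sup>2 * p\<^sup>2) + (i * 2 * K\<^sup>2 / d + l * K) * r\<^sup>2"
proof -
  define b where "b = l * p"
  have ab: "2 * (a * b) \<le> a\<^sup>2 + b\<^sup>2" "2 * (b * r) \<le> b\<^sup>2 + r\<^sup>2"
    using sum_squares_bound[of a b] sum_squares_bound[of b r] by auto
  have h1: "a * (K * p) \<le> d / 8 * (a\<^sup>2 + b\<^sup>2)"
  proof -
    have "K * (a * p) \<le> (l * d / 4) * (a * p)"
      using Kl nonneg by (intro mult_right_mono) auto
    also have "\<dots> = d / 4 * (a * b)" by (simp add: b_def)
    also have "\<dots> \<le> d / 4 * ((a\<^sup>2 + b\<^sup>2) / 2)" using ab d by (intro mult_left_mono) auto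
    finally show ?thesis by (simp add: algebra_simps)
  qed
  have h2: "a * (K * r) \<le> d / 8 * a\<^sup>2 + 2 * K\<^sup>2 / d * r\<^sup>2"
  proof -
    \<comment> \<open>Young's inequality as a completed square, weighted so that the noise costs
      only \<open>d / 8\<close> of the decay.\<close>
    have "0 \<le> (d * a - 4 * K * r)\<^sup>2 / (8 * d)" using d by simp
    also have "\<dots> = d / 8 * a\<^sup>2 + 2 * K\<^sup>2 / d * r\<^sup>2 - a * (K * r)"
      using d by (simp add: field_simps power2_eq_square)
    finally show ?thesis by simp
  qed
  have h3: "l\<^sup>2 * (p * (K * (p + a + r))) = K * b\<^sup>2 + l * K * (a * b) + l * K * (b * r)"
    by (simp add: b_def algebra_simps power2_eq_square)
  have h4: "l * K * (a * b) \<le> l * K * ((a\<^sup>2 + b\<^sup>2) / 2)" "l * K * (b * r) \<le> l * K * ((b\<^sup>2 + r\<^sup>2) / 2)"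
    using ab l K by (auto intro!: mult_left_mono)
  have lK: "0 < l * K" using l K by simp
  have h5: "(K + l * K) * b\<^sup>2 \<le> i * d / 4 * b\<^sup>2" "l * K * a\<^sup>2 \<le> i * d / 4 * a\<^sup>2"
    using small K lK by (intro mult_right_mono; simp)+
  have lKr: "0 \<le> l * K * r\<^sup>2" "0 \<le> l * K * a\<^sup>2" using lK by auto
  have "i * ((- d - c - K) * a\<^sup>2 + a * (K * (p + a + r)))
      = i * ((- d - c) * a\<^sup>2 + a * (K * p) + a * (K * r))"
    by (simp add: algebra_simps power2_eq_square)
  also have "\<dots> \<le> i * ((- d - c) * a\<^sup>2 + d / 8 * (a\<^sup>2 + b\<^sup>2) + (d / 8 * a\<^sup>2 + 2 * K\<^sup>2 / d * r\<^sup>2))"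
    using h1 h2 i by (intro mult_left_mono) linarith+
  also have "\<dots> = - (i * c * a\<^sup>2) - i * d * a\<^sup>2 * 3 / 4 + i * d * b\<^sup>2 / 8 + i * 2 * K\<^sup>2 / d * r\<^sup>2"
    by (simp add: algebra_simps add_divide_distrib)
  finally have *: "i * ((- d - c - K) * a\<^sup>2 + a * (K * (p + a + r)))
    \<le> - (i * c * a\<^sup>2) - i * d * a\<^sup>2 * 3 / 4 + i * d * b\<^sup>2 / 8 + i * 2 * K\<^sup>2 / d * r\<^sup>2" .
  \<comment> \<open>With the products as atoms the remaining comparison is linear.\<close>
  define u v u' v' W where "u = i * c * a\<^sup>2" and "v = i * d * a\<^sup>2" and "u' = i * c * b\<^sup>2"
    and "v' = i * d * b\<^sup>2" and "W = i * 2 * K\<^sup>2 / d * r\<^sup>2"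
  note defs = u_def v_def u'_def v'_def W_def
  have uv: "0 \<le> u'" "0 \<le> v'" "0 \<le> v" using i c d by (auto simp: defs)
  have rhs: "- (i * (c + d / 2)) * (a\<^sup>2 - l\<^sup>2 * p\<^sup>2) + (i * 2 * K\<^sup>2 / d + l * K) * r\<^sup>2
      = - u - v / 2 + u' + v' / 2 + (W + l * K * r\<^sup>2)"
    by (simp add: b_def defs algebra_simps power_mult_distrib)
  have 1: "i * ((- d - c - K) * a\<^sup>2 + a * (K * (p + a + r))) \<le> - u - v * 3 / 4 + v' / 8 + W"
    using * by (simp only: defs)
  have 2: "l\<^sup>2 * (p * (K * (p + a + r))) \<le> l * K * a\<^sup>2 / 2 + (K + l * K) * b\<^sup>2 + l * K * r\<^sup>2 / 2"
    using h3 h4 by (simp add: algebra_simps add_divide_distrib)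
  have 3: "(K + l * K) * b\<^sup>2 \<le> v' / 4" "l * K * a\<^sup>2 \<le> v / 4" using h5 by (auto simp: defs)
  have "X + Y \<le> - u - v / 2 + u' + v' / 2 + (W + Z)"
    if "X \<le> - u - v * 3 / 4 + v' / 8 + W" "Y \<le> X' / 2 + Y' + Z / 2" "Y' \<le> v' / 4" "X' \<le> v / 4" "0 \<le> Z"
    for X Y Z X' Y' using that uv by linarith
  from this[OF 1 2 3 lKr(1)] show ?thesis unfolding rhs .
qed

lemma has_real_derivative_norm_power2:
  fixes f :: "real \<Rightarrow> 'a::real_inner"
  assumes "(f has_vector_derivative f') (at t within X)"
  shows "((\<lambda>t. (norm (f t))\<^sup>2) has_real_derivative 2 * (f t \<bullet> f')) (at t within X)"
proof -
  have "((\<lambda>t. f t \<bullet> f t) has_vector_derivative f t \<bullet> f' + f' \<bullet> f t) (at t within X)"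
    using bounded_bilinear.has_vector_derivative[OF bounded_bilinear_inner assms assms] .
  then show ?thesis
    by (simp add: power2_norm_eq_inner has_real_derivative_iff_has_vector_derivative inner_commute)
qed

text \<open>The linear parts enter the cone estimates through their quadratic forms, for which (A1)
  provides the bounds. \<open>gap\<close> is the condition on the slope \<open>L\<close>. The first
  part of \<open>small\<close> lets the fast rate absorb the slow equation for every slope up to
  \<open>2 * L\<close>; the second limits the rate at which the squared slow component can grow
  backwards to \<kappa> in the a priori bound.\<close>

locale slow_fast =
  fixes A :: "'x::euclidean_space \<Rightarrow> 'x" and B :: "'y::euclidean_space \<Rightarrow> 'y"
    and g1 :: "'x \<times> 'y \<Rightarrow> 'x" and g2 :: "'x \<times> 'y \<Rightarrow> 'y"
    and \<epsilon> \<gamma>f K \<gamma> L :: real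
  assumes linear: "linear A" "linear B"
    and eps: "0 < \<epsilon>" and K: "0 < K" and gamma: "0 < \<gamma>" and L: "0 < L"
    and A_nonneg: "\<And>x. 0 \<le> x \<bullet> A x"
    and B_neg: "\<And>y. y \<bullet> B y \<le> \<gamma>f * (norm y)\<^sup>2"
    and g1_lip: "\<And>x1 y1 x2 y2. norm (g1 (x1, y1) - g1 (x2, y2)) \<le> K * (norm (x1 - x2) + norm (y1 - y2))"
    and g2_lip: "\<And>x1 y1 x2 y2. norm (g2 (x1, y1) - g2 (x2, y2)) \<le> K * (norm (x1 - x2) + norm (y1 - y2))"
    and g_zero: "g1 (0, 0) = 0" "g2 (0, 0) = 0"
    and gap: "4 * K \<le> L * (- \<gamma>f - K - \<gamma>)"
    and small: "\<epsilon> * (K + 2 * L * K) \<le> (- \<gamma>f - K - \<gamma>) / 4" "\<epsilon> * (K * (4 + L\<^sup>2)) \<le> \<gamma>"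
begin

abbreviation "\<kappa> \<equiv> \<gamma> / \<epsilon>"
abbreviation "\<delta> \<equiv> - \<gamma>f - K - \<gamma>"

text \<open>\<open>\<mu>\<close> is the rate that \<open>cone_inequality\<close> yields for
  \<open>c = \<gamma>\<close> and \<open>d = \<delta>\<close>; half of the gap puts it above
  \<open>\<kappa>\<close>. \<open>D\<^sub>r\<close> is the noise coefficient there for the largest
  slope \<open>2 * L\<close>.\<close>

definition "\<mu> = 1 / \<epsilon> * (\<gamma> + \<delta> / 2)"
definition "D\<^sub>r = 1 / \<epsilon> * 2 * K\<^sup>2 / \<delta> + 2 * L * K"

text \<open>The difference of two solutions is of this kind with \<open>r = 0\<close>, a single solution with \<open>r\<close> the
  size of the noise.\<close>
definition controlled :: "(real \<Rightarrow> 'x) \<Rightarrow> (real \<Rightarrow> 'y) \<Rightarrow> (real \<Rightarrow> real) \<Rightarrow> bool" where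
  "controlled p q r \<longleftrightarrow> continuous_on UNIV p \<and> continuous_on UNIV q \<and>
     (\<forall>t. 0 \<le> r t \<and> (\<exists>a b. (p has_vector_derivative A (p t) + a) (at_right t) \<and>
        (q has_vector_derivative (1 / \<epsilon>) *\<^sub>R (B (q t) + b)) (at_right t) \<and>
        norm a \<le> K * (norm (p t) + norm (q t) + r t) \<and> norm b \<le> K * (norm (p t) + norm (q t) + r t)))"

text \<open>This is \<open>V\<close>; the slope \<open>l\<close> stays a parameter because both
  \<open>L\<close> and \<open>2 * L\<close> occur.\<close>

definition cone :: "real \<Rightarrow> (real \<Rightarrow> 'x) \<Rightarrow> (real \<Rightarrow> 'y) \<Rightarrow> real \<Rightarrow> real" where
  "cone l p q t = (norm (q t))\<^sup>2 - l\<^sup>2 * (norm (p t))\<^sup>2"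

text \<open>Here \<open>e\<close> is one fixed path of the noise. The equation is stated with right
  derivatives, since a jump of \<open>e\<close> can be a kink of \<open>u\<close>.\<close>

definition sol :: "(real \<Rightarrow> 'y) \<Rightarrow> (real \<Rightarrow> 'x \<times> 'y) \<Rightarrow> bool" where
  "sol e u \<longleftrightarrow> continuous_on UNIV u \<and>
     (\<forall>t. ((\<lambda>t. fst (u t)) has_vector_derivative A (fst (u t)) + g1 (fst (u t), snd (u t) + e t)) (at_right t) \<and>
          ((\<lambda>t. snd (u t)) has_vector_derivative
             (1 / \<epsilon>) *\<^sub>R B (snd (u t)) + (1 / \<epsilon>) *\<^sub>R g2 (fst (u t), snd (u t) + e t)) (at_right t))"

text \<open>Encodes membership of the backward orbit in \<open>C_minus\<close>, as \<beta> is
  \<open>- \<kappa>\<close>; \<open>M_hat_iff\<close> makes the connection. The values of these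
  orbits at time 0 make up the manifold.\<close>

definition slow_sol :: "(real \<Rightarrow> 'y) \<Rightarrow> (real \<Rightarrow> 'x \<times> 'y) \<Rightarrow> bool" where
  "slow_sol e u \<longleftrightarrow> sol e u \<and>
     (\<exists>C. \<forall>t\<le>0. norm (fst (u t)) \<le> C * exp (- \<kappa> * t) \<and> norm (snd (u t)) \<le> C * exp (- \<kappa> * t))"

section \<open>Gronwall estimates for controlled pairs\<close>

lemma delta_pos: "0 < \<delta>"
proof -
  have "0 < L * \<delta>" using gap K by linarith
  then show ?thesis using L by (simp add: zero_less_mult_iff)
qed

lemma kappa_pos: "0 < \<kappa>" using gamma eps by simp

lemma mu_gt_kappa: "\<mu> - \<kappa> = \<delta> / (2 * \<epsilon>)"
  by (simp add: \<mu>_def add_divide_distrib diff_divide_distrib)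

lemma D_r_nonneg: "0 \<le> D\<^sub>r"
  using delta_pos eps K L by (simp add: D\<^sub>r_def del: minus_diff_eq)

text \<open>Cauchy-Schwarz reduces the derivative to an expression in \<open>norm (p t)\<close>,
  \<open>norm (q t)\<close> and \<open>r t\<close>, to which \<open>cone_inequality\<close> applies.
  The range of slopes serves the graph estimate at its lower end and tracking at its upper
  end.\<close>

lemma controlled_cone:
  assumes "controlled p q r" and l: "L \<le> l" "l \<le> 2 * L"
  shows "\<exists>D. (cone l p q has_real_derivative D) (at_right t) \<and> D \<le> - 2 * \<mu> * cone l p q t + 2 * D\<^sub>r * (r t)\<^sup>2"
proof -
  obtain a b where r: "0 \<le> r t"
    and dp: "(p has_vector_derivative A (p t) + a) (at_right t)"
    and dq: "(q has_vector_derivative (1 / \<epsilon>) *\<^sub>R (B (q t) + b)) (at_right t)"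
    and a: "norm a \<le> K * (norm (p t) + norm (q t) + r t)"
    and b: "norm b \<le> K * (norm (p t) + norm (q t) + r t)"
    using assms(1) unfolding controlled_def by blast
  let ?p = "norm (p t)" and ?q = "norm (q t)" and ?i = "1 / \<epsilon>"
  let ?D = "2 * (q t \<bullet> ((1 / \<epsilon>) *\<^sub>R (B (q t) + b))) - l\<^sup>2 * (2 * (p t \<bullet> (A (p t) + a)))"
  have "(cone l p q has_real_derivative ?D) (at_right t)"
    unfolding cone_def[abs_def]
    by (intro DERIV_diff DERIV_cmult has_real_derivative_norm_power2 dp dq)
  moreover have "?D \<le> - 2 * \<mu> * cone l p q t + 2 * D\<^sub>r * (r t)\<^sup>2"
  proof -
    have l0: "0 < l" using l L by linarith
    have qb: "q t \<bullet> (B (q t) + b) \<le> (- \<delta> - \<gamma> - K) * ?q\<^sup>2 + ?q * (K * (?p + ?q + r t))"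
    proof -
      have "q t \<bullet> b \<le> ?q * norm b" by (rule norm_cauchy_schwarz)
      also have "\<dots> \<le> ?q * (K * (?p + ?q + r t))" using b by (intro mult_left_mono) auto
      finally show ?thesis using B_neg[of "q t"] by (simp add: inner_add_right)
    qed
    have pa: "- (p t \<bullet> (A (p t) + a)) \<le> ?p * (K * (?p + ?q + r t))"
    proof -
      have "- (p t \<bullet> a) \<le> ?p * norm a" using norm_cauchy_schwarz[of "p t" "- a"] by simp
      also have "\<dots> \<le> ?p * (K * (?p + ?q + r t))" using a by (intro mult_left_mono) auto
      finally show ?thesis using A_nonneg[of "p t"] by (simp add: inner_add_right)
    qed
    have "?i * (q t \<bullet> (B (q t) + b)) \<le> ?i * ((- \<delta> - \<gamma> - K) * ?q\<^sup>2 + ?q * (K * (?p + ?q + r t)))"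
      using qb eps by (intro mult_left_mono) auto
    moreover have "l\<^sup>2 * - (p t \<bullet> (A (p t) + a)) \<le> l\<^sup>2 * (?p * (K * (?p + ?q + r t)))"
      using pa by (intro mult_left_mono) auto
    moreover have "?i * ((- \<delta> - \<gamma> - K) * ?q\<^sup>2 + ?q * (K * (?p + ?q + r t))) + l\<^sup>2 * (?p * (K * (?p + ?q + r t)))
       \<le> - (?i * (\<gamma> + \<delta> / 2)) * (?q\<^sup>2 - l\<^sup>2 * ?p\<^sup>2) + (?i * 2 * K\<^sup>2 / \<delta> + l * K) * (r t)\<^sup>2"
    proof (rule cone_inequality[OF _ K delta_pos gamma l0])
      have "L * \<delta> \<le> l * \<delta>" using l delta_pos by (intro mult_right_mono) auto
      then show "4 * K \<le> l * \<delta>" using gap by linarith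
      have "K + l * K \<le> K + 2 * L * K" using l K by (intro add_left_mono mult_right_mono) auto
      also have "\<dots> \<le> ?i * \<delta> / 4" using small(1) eps by (simp add: field_simps)
      finally show "K + l * K \<le> ?i * \<delta> / 4" .
    qed (use eps r in auto)
    moreover have "(?i * 2 * K\<^sup>2 / \<delta> + l * K) * (r t)\<^sup>2 \<le> D\<^sub>r * (r t)\<^sup>2"
      unfolding D\<^sub>r_def using l K by (intro mult_right_mono add_left_mono) auto
    moreover have "?D = 2 * (?i * (q t \<bullet> (B (q t) + b))) + 2 * (l\<^sup>2 * - (p t \<bullet> (A (p t) + a)))"
      by simp
    ultimately have "?D \<le> 2 * (- (?i * (\<gamma> + \<delta> / 2)) * (?q\<^sup>2 - l\<^sup>2 * ?p\<^sup>2)) + 2 * (D\<^sub>r * (r t)\<^sup>2)"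
      by linarith
    then show ?thesis unfolding cone_def \<mu>_def by (simp only: mult.assoc mult_minus_left mult_minus_right)
  qed
  ultimately show ?thesis by blast
qed

lemma continuous_on_cone:
  "controlled p q r \<Longrightarrow> continuous_on X (cone l p q)"
  unfolding cone_def[abs_def] controlled_def
  by (intro continuous_intros) (auto intro: continuous_on_subset)

text \<open>It is read in both directions of time: a nonpositive value persists forwards, a
  nonnegative one backwards.\<close>

lemma cone_decreasing:
  assumes "controlled p q (\<lambda>_. 0)" "L \<le> l" "l \<le> 2 * L" "a \<le> b"
  shows "cone l p q b \<le> exp (- 2 * \<mu> * (b - a)) * cone l p q a"
  by (rule right_gronwall[OF \<open>a \<le> b\<close> continuous_on_cone[OF assms(1)]])
     (use controlled_cone[OF assms(1-3)] in auto)

text \<open>Inside the cone \<open>norm (q t) \<le> L * norm (p t)\<close>, so the coupling is at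
  most \<open>K * (1 + L) * norm (p t)\<close>, and \<open>A\<close> can only increase the
  norm.\<close>

lemma slow_component_lower:
  assumes ctrl: "controlled p q (\<lambda>_. 0)" and "a \<le> b" and cone: "cone L p q a \<le> 0"
  shows "exp (- 2 * K * (1 + L) * (b - a)) * (norm (p a))\<^sup>2 \<le> (norm (p b))\<^sup>2"
proof (rule right_gronwall_lower[OF \<open>a \<le> b\<close>])
  show "continuous_on {a..b} (\<lambda>t. (norm (p t))\<^sup>2)"
    using ctrl unfolding controlled_def by (intro continuous_intros) (auto intro: continuous_on_subset)
  fix t assume t: "a \<le> t" "t < b"
  obtain a' where dp: "(p has_vector_derivative A (p t) + a') (at_right t)"
    and a': "norm a' \<le> K * (norm (p t) + norm (q t))"
    using ctrl by (fastforce simp: controlled_def)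
  have "cone L p q t \<le> exp (- 2 * \<mu> * (t - a)) * cone L p q a"
    using t L by (intro cone_decreasing ctrl) auto
  also have "\<dots> \<le> 0" using cone by (simp add: mult_le_0_iff)
  finally have "(norm (q t))\<^sup>2 \<le> (L * norm (p t))\<^sup>2" by (simp add: cone_def power_mult_distrib)
  then have q: "norm (q t) \<le> L * norm (p t)" using L by (simp add: power2_le_iff_abs_le)
  have "- (p t \<bullet> a') \<le> norm (p t) * norm a'" using norm_cauchy_schwarz[of "p t" "- a'"] by simp
  also have "\<dots> \<le> norm (p t) * (K * (norm (p t) + L * norm (p t)))"
    using a' q K by (intro mult_left_mono order.trans[OF a']) auto
  finally have "- 2 * K * (1 + L) * (norm (p t))\<^sup>2 \<le> 2 * (p t \<bullet> (A (p t) + a'))"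
    using A_nonneg[of "p t"] by (simp add: inner_add_right algebra_simps power2_eq_square)
  then show "\<exists>D. ((\<lambda>t. (norm (p t))\<^sup>2) has_real_derivative D) (at_right t) \<and>
      - 2 * K * (1 + L) * (norm (p t))\<^sup>2 \<le> D"
    using has_real_derivative_norm_power2[OF dp] by blast
qed

text \<open>Outside the cone the fast component dominates: \<open>gap\<close> gives
  \<open>K * norm (p t) \<le> \<delta> * norm (q t)\<close>, and the rates add up to
  \<open>\<gamma>f + K + \<delta> = - \<gamma>\<close>.\<close>

lemma fast_component_decay:
  assumes ctrl: "controlled p q (\<lambda>_. 0)" and "a \<le> b" and l: "L \<le> l"
    and cone: "\<And>t. a \<le> t \<Longrightarrow> t \<le> b \<Longrightarrow> 0 \<le> cone l p q t"
  shows "(norm (q b))\<^sup>2 \<le> exp (- 2 * \<kappa> * (b - a)) * (norm (q a))\<^sup>2"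
proof (rule right_gronwall[OF \<open>a \<le> b\<close>])
  show "continuous_on {a..b} (\<lambda>t. (norm (q t))\<^sup>2)"
    using ctrl unfolding controlled_def by (intro continuous_intros) (auto intro: continuous_on_subset)
  fix t assume t: "a \<le> t" "t < b"
  obtain b' where dq: "(q has_vector_derivative (1 / \<epsilon>) *\<^sub>R (B (q t) + b')) (at_right t)"
    and b': "norm b' \<le> K * (norm (p t) + norm (q t))"
    using ctrl by (fastforce simp: controlled_def)
  have "(l * norm (p t))\<^sup>2 \<le> (norm (q t))\<^sup>2" using cone[of t] t by (simp add: cone_def power_mult_distrib)
  then have p: "l * norm (p t) \<le> norm (q t)" using L l by (simp add: power2_le_iff_abs_le)
  have "K * norm (p t) \<le> L * \<delta> / 4 * norm (p t)" using gap by (intro mult_right_mono) auto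
  also have "\<dots> \<le> \<delta> / 4 * (l * norm (p t))" using l delta_pos
      mult_right_mono[OF l, of "\<delta> / 4 * norm (p t)"] by (simp add: mult_ac del: minus_diff_eq)
  also have "\<dots> \<le> \<delta> * norm (q t)" using p delta_pos L l by (intro mult_mono) auto
  finally have Kp: "K * norm (p t) \<le> \<delta> * norm (q t)" .
  have "q t \<bullet> b' \<le> norm (q t) * norm b'" by (rule norm_cauchy_schwarz)
  also have "\<dots> \<le> norm (q t) * (\<delta> * norm (q t) + K * norm (q t))"
    using b' Kp by (intro mult_left_mono) (auto simp: algebra_simps)
  finally have "q t \<bullet> (B (q t) + b') \<le> - \<gamma> * (norm (q t))\<^sup>2"
    using B_neg[of "q t"] by (simp add: inner_add_right algebra_simps power2_eq_square)
  then have "1 / \<epsilon> * (q t \<bullet> (B (q t) + b')) \<le> 1 / \<epsilon> * (- \<gamma> * (norm (q t))\<^sup>2)"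
    using eps by (intro mult_left_mono) auto
  then have "2 * (q t \<bullet> ((1 / \<epsilon>) *\<^sub>R (B (q t) + b'))) \<le> - 2 * \<kappa> * (norm (q t))\<^sup>2" by simp
  then show "\<exists>D. ((\<lambda>t. (norm (q t))\<^sup>2) has_real_derivative D) (at_right t) \<and> D \<le> - 2 * \<kappa> * (norm (q t))\<^sup>2"
    using has_real_derivative_norm_power2[OF dq] by blast
qed

text \<open>Crude growth in both time directions with one constant for all pairs. Uniqueness of
  solutions and continuous dependence on their values follow from it.\<close>

lemma energy_bound:
  obtains C where "\<And>p q s t. controlled p q (\<lambda>_. 0) \<Longrightarrow>
    (norm (p t))\<^sup>2 + (norm (q t))\<^sup>2 \<le> exp (C * \<bar>t - s\<bar>) * ((norm (p s))\<^sup>2 + (norm (q s))\<^sup>2)"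
proof -
  obtain a where a: "a > 0" "\<And>x. norm (A x) \<le> a * norm x" using linear_bounded_pos[OF linear(1)] by blast
  obtain b where b: "b > 0" "\<And>x. norm (B x) \<le> b * norm x" using linear_bounded_pos[OF linear(2)] by blast
  define C where "C = 2 * (a + 2 * K) + 2 * (1 / \<epsilon> * (b + 2 * K))"
  define N where "N p q t = (norm (p t))\<^sup>2 + (norm (q t))\<^sup>2" for p :: "real \<Rightarrow> 'x" and q :: "real \<Rightarrow> 'y" and t
  have der: "\<exists>D. (N p q has_real_derivative D) (at_right t) \<and> \<bar>D\<bar> \<le> C * N p q t"
    if ctrl: "controlled p q (\<lambda>_. 0)" for p q t
  proof -
    obtain a' b' where dp: "(p has_vector_derivative A (p t) + a') (at_right t)"
      and dq: "(q has_vector_derivative (1 / \<epsilon>) *\<^sub>R (B (q t) + b')) (at_right t)"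
      and a': "norm a' \<le> K * (norm (p t) + norm (q t))" and b': "norm b' \<le> K * (norm (p t) + norm (q t))"
      using ctrl by (fastforce simp: controlled_def)
    let ?p = "norm (p t)" and ?q = "norm (q t)"
    have pq: "?p * ?q \<le> N p q t" "?p * ?p \<le> N p q t" "?q * ?q \<le> N p q t"
      using sum_squares_bound[of ?p ?q] mult_nonneg_nonneg[of ?p ?q]
      by (auto simp: N_def power2_eq_square intro: order.trans[rotated])
    have "\<bar>p t \<bullet> (A (p t) + a')\<bar> \<le> ?p * norm (A (p t) + a')" by (rule Cauchy_Schwarz_ineq2)
    also have "\<dots> \<le> ?p * (a * ?p + K * (?p + ?q))"
      using a(2)[of "p t"] a' by (intro mult_left_mono norm_triangle_mono) auto
    also have "\<dots> = a * (?p * ?p) + K * (?p * ?p) + K * (?p * ?q)" by (simp add: algebra_simps)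
    also have "\<dots> \<le> a * N p q t + K * N p q t + K * N p q t"
      using a(1) K pq by (intro add_mono mult_left_mono) auto
    finally have 1: "\<bar>p t \<bullet> (A (p t) + a')\<bar> \<le> (a + 2 * K) * N p q t" by (simp add: algebra_simps)
    have "\<bar>q t \<bullet> (B (q t) + b')\<bar> \<le> ?q * norm (B (q t) + b')" by (rule Cauchy_Schwarz_ineq2)
    also have "\<dots> \<le> ?q * (b * ?q + K * (?p + ?q))"
      using b(2)[of "q t"] b' by (intro mult_left_mono norm_triangle_mono) auto
    also have "\<dots> = b * (?q * ?q) + K * (?q * ?q) + K * (?p * ?q)" by (simp add: algebra_simps)
    also have "\<dots> \<le> b * N p q t + K * N p q t + K * N p q t"
      using b(1) K pq by (intro add_mono mult_left_mono) auto
    finally have "\<bar>q t \<bullet> (B (q t) + b')\<bar> \<le> (b + 2 * K) * N p q t" by (simp add: algebra_simps)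
    then have "1 / \<epsilon> * \<bar>q t \<bullet> (B (q t) + b')\<bar> \<le> 1 / \<epsilon> * ((b + 2 * K) * N p q t)"
      using eps by (intro mult_left_mono) auto
    then have 2: "\<bar>q t \<bullet> ((1 / \<epsilon>) *\<^sub>R (B (q t) + b'))\<bar> \<le> 1 / \<epsilon> * ((b + 2 * K) * N p q t)"
      using eps by (simp add: abs_mult)
    let ?D = "2 * (p t \<bullet> (A (p t) + a')) + 2 * (q t \<bullet> ((1 / \<epsilon>) *\<^sub>R (B (q t) + b')))"
    have "\<bar>?D\<bar> \<le> 2 * \<bar>p t \<bullet> (A (p t) + a')\<bar> + 2 * \<bar>q t \<bullet> ((1 / \<epsilon>) *\<^sub>R (B (q t) + b'))\<bar>"
      using abs_triangle_ineq[of "2 * (p t \<bullet> (A (p t) + a'))" "2 * (q t \<bullet> ((1 / \<epsilon>) *\<^sub>R (B (q t) + b')))"]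
      unfolding abs_mult by simp
    also have "\<dots> \<le> 2 * ((a + 2 * K) * N p q t) + 2 * (1 / \<epsilon> * ((b + 2 * K) * N p q t))"
      using 1 2 by (intro add_mono mult_left_mono) auto
    also have "\<dots> = C * N p q t" by (simp add: C_def algebra_simps)
    finally have D: "\<bar>?D\<bar> \<le> C * N p q t" .
    have "(N p q has_real_derivative ?D) (at_right t)"
      unfolding N_def[abs_def]
      by (intro DERIV_add has_real_derivative_norm_power2 dp dq)
    with D show ?thesis by blast
  qed
  have cont: "continuous_on X (N p q)" if "controlled p q (\<lambda>_. 0)" for X p q
    using that unfolding N_def[abs_def] controlled_def
    by (intro continuous_intros) (auto intro: continuous_on_subset)
  have "N p q t \<le> exp (C * \<bar>t - s\<bar>) * N p q s" if ctrl: "controlled p q (\<lambda>_. 0)" for p q s t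
  proof (cases "s \<le> t")
    case True
    have "N p q t \<le> exp (C * (t - s)) * N p q s"
    proof (rule right_gronwall[OF True cont[OF ctrl]])
      fix r
      obtain D where "(N p q has_real_derivative D) (at_right r)" "\<bar>D\<bar> \<le> C * N p q r"
        using der[OF ctrl] by blast
      then show "\<exists>D. (N p q has_real_derivative D) (at_right r) \<and> D \<le> C * N p q r"
        by (intro exI[of _ D]) auto
    qed
    then show ?thesis using True by simp
  next
    case False
    have "exp (- C * (s - t)) * N p q t \<le> N p q s"
    proof (rule right_gronwall_lower[OF _ cont[OF ctrl]])
      fix r
      obtain D where "(N p q has_real_derivative D) (at_right r)" "\<bar>D\<bar> \<le> C * N p q r"
        using der[OF ctrl] by blast
      then show "\<exists>D. (N p q has_real_derivative D) (at_right r) \<and> - C * N p q r \<le> D"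
        by (intro exI[of _ D]) auto
    qed (use False in auto)
    then have "exp (C * (s - t)) * (exp (- C * (s - t)) * N p q t) \<le> exp (C * (s - t)) * N p q s"
      by (intro mult_left_mono) auto
    then have "N p q t \<le> exp (C * (s - t)) * N p q s"
      by (simp add: mult.assoc[symmetric] exp_add[symmetric])
    then show ?thesis using False by (simp add: abs_if)
  qed
  then show ?thesis using that unfolding N_def by blast
qed


section \<open>Solutions for one fixed noise path\<close>

lemma sol_diff_controlled:
  assumes "sol e u" "sol e v"
  shows "controlled (\<lambda>t. fst (u t) - fst (v t)) (\<lambda>t. snd (u t) - snd (v t)) (\<lambda>_. 0)"
  unfolding controlled_def
proof (intro conjI allI)
  show "continuous_on UNIV (\<lambda>t. fst (u t) - fst (v t))" "continuous_on UNIV (\<lambda>t. snd (u t) - snd (v t))"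
    using assms unfolding sol_def by (intro continuous_intros; simp)+
  fix t
  let ?a = "g1 (fst (u t), snd (u t) + e t) - g1 (fst (v t), snd (v t) + e t)"
  let ?b = "g2 (fst (u t), snd (u t) + e t) - g2 (fst (v t), snd (v t) + e t)"
  have "((\<lambda>t. fst (u t) - fst (v t)) has_vector_derivative
      (A (fst (u t)) + g1 (fst (u t), snd (u t) + e t)) - (A (fst (v t)) + g1 (fst (v t), snd (v t) + e t))) (at_right t)"
    using assms unfolding sol_def by (intro has_vector_derivative_diff) auto
  then have 1: "((\<lambda>t. fst (u t) - fst (v t)) has_vector_derivative A (fst (u t) - fst (v t)) + ?a) (at_right t)"
    by (simp add: linear_diff[OF linear(1)] algebra_simps)
  have "((\<lambda>t. snd (u t) - snd (v t)) has_vector_derivative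
      ((1 / \<epsilon>) *\<^sub>R B (snd (u t)) + (1 / \<epsilon>) *\<^sub>R g2 (fst (u t), snd (u t) + e t)) -
      ((1 / \<epsilon>) *\<^sub>R B (snd (v t)) + (1 / \<epsilon>) *\<^sub>R g2 (fst (v t), snd (v t) + e t))) (at_right t)"
    using assms unfolding sol_def by (intro has_vector_derivative_diff) auto
  moreover have "((1 / \<epsilon>) *\<^sub>R B (snd (u t)) + (1 / \<epsilon>) *\<^sub>R g2 (fst (u t), snd (u t) + e t)) -
      ((1 / \<epsilon>) *\<^sub>R B (snd (v t)) + (1 / \<epsilon>) *\<^sub>R g2 (fst (v t), snd (v t) + e t))
      = (1 / \<epsilon>) *\<^sub>R (B (snd (u t) - snd (v t)) + ?b)"
    by (simp add: linear_diff[OF linear(2)] algebra_simps)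
  ultimately have 2: "((\<lambda>t. snd (u t) - snd (v t)) has_vector_derivative
      (1 / \<epsilon>) *\<^sub>R (B (snd (u t) - snd (v t)) + ?b)) (at_right t)" by simp
  show "\<exists>a b. ((\<lambda>t. fst (u t) - fst (v t)) has_vector_derivative A (fst (u t) - fst (v t)) + a) (at_right t) \<and>
       ((\<lambda>t. snd (u t) - snd (v t)) has_vector_derivative (1 / \<epsilon>) *\<^sub>R (B (snd (u t) - snd (v t)) + b)) (at_right t) \<and>
       norm a \<le> K * (norm (fst (u t) - fst (v t)) + norm (snd (u t) - snd (v t)) + 0) \<and>
       norm b \<le> K * (norm (fst (u t) - fst (v t)) + norm (snd (u t) - snd (v t)) + 0)"
    using 1 2 g1_lip[of "fst (u t)" "snd (u t) + e t" "fst (v t)" "snd (v t) + e t"]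
      g2_lip[of "fst (u t)" "snd (u t) + e t" "fst (v t)" "snd (v t) + e t"]
    by (intro exI[of _ ?a] exI[of _ ?b]) auto
qed auto

text \<open>Comparison with the origin, where \<open>g1\<close> and \<open>g2\<close> vanish, leaves
  the noise as the forcing \<open>r\<close>.\<close>

lemma sol_controlled:
  assumes "sol e u"
  shows "controlled (\<lambda>t. fst (u t)) (\<lambda>t. snd (u t)) (\<lambda>t. norm (e t))"
  unfolding controlled_def
proof (intro conjI allI)
  show "continuous_on UNIV (\<lambda>t. fst (u t))" "continuous_on UNIV (\<lambda>t. snd (u t))"
    using assms unfolding sol_def by (intro continuous_intros; simp)+
  fix t
  let ?a = "g1 (fst (u t), snd (u t) + e t)" and ?b = "g2 (fst (u t), snd (u t) + e t)"
  have "K * (norm (fst (u t)) + norm (snd (u t) + e t)) \<le> K * (norm (fst (u t)) + norm (snd (u t)) + norm (e t))"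
    using K norm_triangle_ineq[of "snd (u t)" "e t"] by (intro mult_left_mono) auto
  then have "norm ?a \<le> K * (norm (fst (u t)) + norm (snd (u t)) + norm (e t))"
      "norm ?b \<le> K * (norm (fst (u t)) + norm (snd (u t)) + norm (e t))"
    using g1_lip[of "fst (u t)" "snd (u t) + e t" 0 0] g2_lip[of "fst (u t)" "snd (u t) + e t" 0 0]
    by (auto simp: g_zero)
  with assms show "\<exists>a b. ((\<lambda>t. fst (u t)) has_vector_derivative A (fst (u t)) + a) (at_right t) \<and>
       ((\<lambda>t. snd (u t)) has_vector_derivative (1 / \<epsilon>) *\<^sub>R (B (snd (u t)) + b)) (at_right t) \<and>
       norm a \<le> K * (norm (fst (u t)) + norm (snd (u t)) + norm (e t)) \<and>
       norm b \<le> K * (norm (fst (u t)) + norm (snd (u t)) + norm (e t))"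
    by (intro exI[of _ ?a] exI[of _ ?b]) (auto simp: sol_def scaleR_add_right)
qed auto

lemma sol_energy_bound:
  obtains C where "\<And>e u v s t. sol e u \<Longrightarrow> sol e v \<Longrightarrow>
    (norm (u t - v t))\<^sup>2 \<le> exp (C * \<bar>t - s\<bar>) * (norm (u s - v s))\<^sup>2"
proof -
  obtain C where C: "\<And>p q s t. controlled p q (\<lambda>_. 0) \<Longrightarrow>
    (norm (p t))\<^sup>2 + (norm (q t))\<^sup>2 \<le> exp (C * \<bar>t - s\<bar>) * ((norm (p s))\<^sup>2 + (norm (q s))\<^sup>2)"
    by (rule energy_bound) blast
  have "(norm (u t - v t))\<^sup>2 \<le> exp (C * \<bar>t - s\<bar>) * (norm (u s - v s))\<^sup>2"
    if "sol e u" "sol e v" for e u v s t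
    using C[OF sol_diff_controlled[OF that], of t s]
    by (simp add: norm_prod_def)
  then show ?thesis using that by blast
qed

lemma sol_unique:
  assumes "sol e u" "sol e v" "u s = v s"
  shows "u = v"
proof
  fix t
  obtain C where "\<And>e u v s t. sol e u \<Longrightarrow> sol e v \<Longrightarrow>
    (norm (u t - v t))\<^sup>2 \<le> exp (C * \<bar>t - s\<bar>) * (norm (u s - v s))\<^sup>2" by (rule sol_energy_bound) blast
  from this[OF assms(1,2), of t s] assms(3) show "u t = v t" by simp
qed

lemma sol_tendsto:
  assumes "\<And>n. sol e (U n)" "sol e u" "(\<lambda>n. U n s) \<longlonglongrightarrow> u s"
  shows "(\<lambda>n. U n t) \<longlonglongrightarrow> u t"
proof -
  obtain C where C: "\<And>e u v s t. sol e u \<Longrightarrow> sol e v \<Longrightarrow>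
    (norm (u t - v t))\<^sup>2 \<le> exp (C * \<bar>t - s\<bar>) * (norm (u s - v s))\<^sup>2" by (rule sol_energy_bound) blast
  have "(\<lambda>n. U n s - u s) \<longlonglongrightarrow> 0" using assms(3) by (rule LIM_zero)
  then have "(\<lambda>n. exp (C * \<bar>t - s\<bar>) * (norm (U n s - u s))\<^sup>2) \<longlonglongrightarrow> exp (C * \<bar>t - s\<bar>) * (norm (0 :: 'x \<times> 'y))\<^sup>2"
    by (intro tendsto_intros)
  then have lim: "(\<lambda>n. exp (C * \<bar>t - s\<bar>) * (norm (U n s - u s))\<^sup>2) \<longlonglongrightarrow> 0" by simp
  have "(\<lambda>n. (norm (U n t - u t))\<^sup>2) \<longlonglongrightarrow> 0"
    by (rule tendsto_sandwich[OF _ _ tendsto_const lim]) (auto intro!: always_eventually C assms)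
  then have "(\<lambda>n. sqrt ((norm (U n t - u t))\<^sup>2)) \<longlonglongrightarrow> sqrt 0" by (intro tendsto_intros)
  then show ?thesis by (simp add: tendsto_norm_zero_iff LIM_zero_iff)
qed

text \<open>Surjectivity of the slow component of the flow on a Lipschitz graph: the cone condition makes
  this map expanding.\<close>
lemma sol_with_slow_component:
  assumes ex: "\<And>z. \<exists>u. sol e u \<and> u s = z" and "s \<le> t"
    and H: "\<And>x x'. norm (H x - H x') \<le> L * norm (x - x')"
  obtains u :: "real \<Rightarrow> 'x \<times> 'y" where "sol e u" "snd (u s) = H (fst (u s))" "fst (u t) = \<xi>"
proof -
  have "\<exists>U. \<forall>x. sol e (U x) \<and> U x s = (x, H x)" by (intro choice allI ex)
  then obtain U where U: "\<And>x. sol e (U x)" "\<And>x. U x s = (x, H x)" by blast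
  obtain C where C: "\<And>e u v s t. sol e u \<Longrightarrow> sol e v \<Longrightarrow>
    (norm (u t - v t))\<^sup>2 \<le> exp (C * \<bar>t - s\<bar>) * (norm (u s - v s))\<^sup>2" by (rule sol_energy_bound) blast
  define f where "f x = fst (U x t)" for x
  have "continuous_on UNIV f"
    unfolding continuous_on_sequentially
  proof (intro allI ballI impI, elim conjE)
    fix x :: 'x and X assume X: "X \<longlonglongrightarrow> x"
    have "(\<lambda>n. norm (X n - x)) \<longlonglongrightarrow> 0" using X by (simp add: LIM_zero tendsto_norm_zero)
    then have lim: "(\<lambda>n. L * norm (X n - x)) \<longlonglongrightarrow> 0" by (rule tendsto_mult_right_zero)
    have "(\<lambda>n. norm (H (X n) - H x)) \<longlonglongrightarrow> 0"
      by (rule tendsto_sandwich[OF _ _ tendsto_const lim]) (auto intro!: always_eventually H)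
    then have "(\<lambda>n. H (X n)) \<longlonglongrightarrow> H x" by (simp add: tendsto_norm_zero_iff LIM_zero_iff)
    with X have "(\<lambda>n. U (X n) s) \<longlonglongrightarrow> U x s" unfolding U by (intro tendsto_intros)
    then have "(\<lambda>n. U (X n) t) \<longlonglongrightarrow> U x t" by (rule sol_tendsto[OF U(1) U(1)])
    then show "(f \<circ> X) \<longlonglongrightarrow> f x" unfolding f_def o_def by (rule tendsto_fst)
  qed
  moreover have "exp (- K * (1 + L) * (t - s)) * norm (x - x') \<le> norm (f x - f x')" for x x'
  proof -
    \<comment> \<open>The Lipschitz graph puts the initial difference into the cone. The factor
      obtained may be less than 1; surjectivity only requires it to be positive.\<close>
    have "(norm (H x - H x'))\<^sup>2 \<le> (L * norm (x - x'))\<^sup>2" using H by (intro power_mono) auto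
    then have "cone L (\<lambda>t. fst (U x t) - fst (U x' t)) (\<lambda>t. snd (U x t) - snd (U x' t)) s \<le> 0"
      by (simp add: cone_def U power_mult_distrib)
    from slow_component_lower[OF sol_diff_controlled[OF U(1) U(1)] \<open>s \<le> t\<close> this]
    have "exp (- 2 * K * (1 + L) * (t - s)) * (norm (x - x'))\<^sup>2 \<le> (norm (f x - f x'))\<^sup>2"
      by (simp add: U f_def)
    also have "exp (- 2 * K * (1 + L) * (t - s)) = (exp (- K * (1 + L) * (t - s)))\<^sup>2"
      by (simp add: exp_of_nat_mult[symmetric] power2_eq_square exp_add[symmetric])
    finally have "(exp (- K * (1 + L) * (t - s)) * norm (x - x'))\<^sup>2 \<le> (norm (f x - f x'))\<^sup>2"
      by (simp only: power_mult_distrib)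
    then show ?thesis by (rule power2_le_imp_le) simp
  qed
  ultimately have "surj f" by (intro expanding_imp_surj[of f]) auto
  then obtain x where "f x = \<xi>" by (metis surjE)
  then show ?thesis using U by (intro that[of "U x"]) (auto simp: f_def)
qed

text \<open>The weight bounds \<open>cone\<close> at time \<open>- t\<close> by a multiple of
  \<open>exp (2 * \<kappa> * t)\<close>, and up to time 0 it decays by
  \<open>exp (- 2 * \<mu> * t)\<close>; the product tends to 0. Equal slow components then force
  equal fast ones.\<close>

lemma slow_sol_cone:
  assumes "slow_sol e u" "slow_sol e v"
  shows "norm (snd (u 0) - snd (v 0)) \<le> L * norm (fst (u 0) - fst (v 0))"
proof -
  let ?p = "\<lambda>t. fst (u t) - fst (v t)" and ?q = "\<lambda>t. snd (u t) - snd (v t)"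
  have ctrl: "controlled ?p ?q (\<lambda>_. 0)"
    using assms by (intro sol_diff_controlled) (auto simp: slow_sol_def)
  obtain C where C: "\<And>t. t \<le> 0 \<Longrightarrow> norm (snd (u t)) \<le> C * exp (- \<kappa> * t)" using assms(1) by (auto simp: slow_sol_def)
  obtain C' where C': "\<And>t. t \<le> 0 \<Longrightarrow> norm (snd (v t)) \<le> C' * exp (- \<kappa> * t)" using assms(2) by (auto simp: slow_sol_def)
  have bound: "cone L ?p ?q 0 \<le> (C + C')\<^sup>2 * exp (- 2 * (\<mu> - \<kappa>) * t)" if "t \<ge> 0" for t
  proof -
    have "norm (?q (- t)) \<le> norm (snd (u (- t))) + norm (snd (v (- t)))" by (rule norm_triangle_ineq4)
    also have "\<dots> \<le> (C + C') * exp (\<kappa> * t)" using C[of "- t"] C'[of "- t"] that by (simp add: algebra_simps)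
    finally have "(norm (?q (- t)))\<^sup>2 \<le> ((C + C') * exp (\<kappa> * t))\<^sup>2" by (intro power_mono) auto
    moreover have "((C + C') * exp (\<kappa> * t))\<^sup>2 = (C + C')\<^sup>2 * exp (2 * \<kappa> * t)"
      by (simp add: power_mult_distrib power2_eq_square exp_add[symmetric])
    moreover have "cone L ?p ?q (- t) \<le> (norm (?q (- t)))\<^sup>2" by (simp add: cone_def)
    ultimately have *: "cone L ?p ?q (- t) \<le> (C + C')\<^sup>2 * exp (2 * \<kappa> * t)" by linarith
    have "cone L ?p ?q 0 \<le> exp (- 2 * \<mu> * t) * cone L ?p ?q (- t)"
      using cone_decreasing[OF ctrl, of L "- t" 0] L that by simp
    also have "\<dots> \<le> exp (- 2 * \<mu> * t) * ((C + C')\<^sup>2 * exp (2 * \<kappa> * t))"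
      using * by (intro mult_left_mono) auto
    also have "\<dots> = (C + C')\<^sup>2 * (exp (- 2 * \<mu> * t) * exp (2 * \<kappa> * t))" by simp
    also have "exp (- 2 * \<mu> * t) * exp (2 * \<kappa> * t) = exp (- 2 * (\<mu> - \<kappa>) * t)"
      by (simp only: exp_add[symmetric]) (simp add: algebra_simps)
    finally show ?thesis .
  qed
  have "\<mu> - \<kappa> > 0" using delta_pos eps unfolding mu_gt_kappa by simp
  then have "((\<lambda>t. (C + C')\<^sup>2 * exp (- 2 * (\<mu> - \<kappa>) * t)) \<longlongrightarrow> (C + C')\<^sup>2 * 0) at_top"
    by (intro tendsto_mult tendsto_const filterlim_compose[OF exp_at_bot]
        filterlim_tendsto_neg_mult_at_bot[OF tendsto_const _ filterlim_ident]) simp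
  then have "cone L ?p ?q 0 \<le> (C + C')\<^sup>2 * 0"
    by (rule tendsto_lowerbound[OF _ eventually_mono[OF eventually_ge_at_top[of 0] bound]]) auto
  then have "(norm (?q 0))\<^sup>2 \<le> (L * norm (?p 0))\<^sup>2" by (simp add: cone_def power_mult_distrib)
  then show ?thesis using L by (intro power2_le_imp_le[OF _ mult_nonneg_nonneg]) auto
qed

text \<open>The a priori bound, uniform in the starting time \<open>- T\<close>. Multiples of
  \<open>w\<close> serve as barriers: \<open>R * w\<close> keeps \<open>cone\<close> bounded
  forwards from \<open>- T\<close>, which eliminates \<open>q\<close>, and \<open>R' * w\<close>
  keeps the squared norm of \<open>p\<close> bounded backwards from time 0.\<close>

lemma controlled_growth_bound:
  assumes "0 \<le> N"
  obtains C where "\<And>p q r T t. \<lbrakk>controlled p q r; \<And>t. t \<le> 0 \<Longrightarrow> r t \<le> N * exp (- \<kappa> * t);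
      q (- T) = 0; norm (p 0) \<le> X; - T \<le> t; t \<le> 0\<rbrakk>
      \<Longrightarrow> norm (p t) \<le> C * exp (- \<kappa> * t) \<and> norm (q t) \<le> C * exp (- \<kappa> * t)"
proof -
  \<comment> \<open>Solves \<open>(\<mu> - \<kappa>) * R = D\<^sub>r * N\<^sup>2\<close>, so that
    \<open>R * w\<close> satisfies the inequality for \<open>cone\<close> with equality when the
    noise has its maximal size.\<close>
  define R where "R = 2 * \<epsilon> * D\<^sub>r * N\<^sup>2 / \<delta>"
  \<comment> \<open>The first summand covers the value of \<open>p\<close> at time 0, the second the
    forcing: \<open>\<kappa> * R'\<close> is at least \<open>K * (R + N\<^sup>2)\<close>.\<close>
  define R' where "R' = X\<^sup>2 + K * (R + N\<^sup>2) / \<kappa>"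
  define w where "w t = exp (- 2 * \<kappa> * t)" for t
  have R: "R \<ge> 0" unfolding R_def using D_r_nonneg delta_pos eps
    by (intro divide_nonneg_pos mult_nonneg_nonneg) auto
  have R': "R' \<ge> 0" unfolding R'_def using R kappa_pos K eps
    by (intro add_nonneg_nonneg divide_nonneg_pos mult_nonneg_nonneg zero_le_power2) auto
  have dw: "(w has_real_derivative - 2 * \<kappa> * w t) (at_right t)" for t
    unfolding w_def[abs_def] using eps by (auto intro!: derivative_eq_intros)
  have w2: "(N * exp (- \<kappa> * t))\<^sup>2 = N\<^sup>2 * w t" for N t :: real
    by (simp add: power_mult_distrib w_def power2_eq_square exp_add[symmetric])
  have "(norm (p t))\<^sup>2 \<le> R' * w t \<and> (norm (q t))\<^sup>2 \<le> (L\<^sup>2 * R' + R) * w t"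
    if ctrl: "controlled p q r" and rN: "\<And>t. t \<le> 0 \<Longrightarrow> r t \<le> N * exp (- \<kappa> * t)"
      and q: "q (- T) = 0" and p: "norm (p 0) \<le> X" and t: "- T \<le> t" "t \<le> 0" for p q r T t
  proof -
    have cont: "continuous_on Y p" "continuous_on Y q" "continuous_on Y w" for Y
      using ctrl eps by (auto simp: controlled_def w_def[abs_def] intro!: continuous_intros intro: continuous_on_subset)
    have r2: "(r s)\<^sup>2 \<le> N\<^sup>2 * w s" if "s \<le> 0" for s
    proof -
      have "0 \<le> r s" using ctrl by (auto simp: controlled_def)
      then have "(r s)\<^sup>2 \<le> (N * exp (- \<kappa> * s))\<^sup>2" using rN[OF that] by (intro power_mono)
      then show ?thesis by (simp only: w2)
    qed
    have fast: "(norm (q s))\<^sup>2 \<le> L\<^sup>2 * (norm (p s))\<^sup>2 + R * w s" if s: "- T \<le> s" "s \<le> 0" for s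
    proof -
      have "cone L p q s - R * w s \<le> exp (- 2 * \<mu> * (s - - T)) * (cone L p q (- T) - R * w (- T))"
      proof (rule right_gronwall[OF s(1)])
        show "continuous_on {- T..s} (\<lambda>t. cone L p q t - R * w t)"
          by (intro continuous_intros continuous_on_cone[OF ctrl] cont)
        fix t assume t: "- T \<le> t" "t < s"
        obtain D where D: "(cone L p q has_real_derivative D) (at_right t)"
          "D \<le> - 2 * \<mu> * cone L p q t + 2 * D\<^sub>r * (r t)\<^sup>2"
          using controlled_cone[OF ctrl, of L t] L by auto
        have "2 * D\<^sub>r * (r t)\<^sup>2 \<le> 2 * D\<^sub>r * (N\<^sup>2 * w t)"
          using t s D_r_nonneg by (intro mult_left_mono r2) auto
        moreover have "D\<^sub>r * N\<^sup>2 = (\<mu> - \<kappa>) * R"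
        proof -
          have "D\<^sub>r * N\<^sup>2 = d / (2 * \<epsilon>) * (2 * \<epsilon> * D\<^sub>r * N\<^sup>2 / d)" if "0 < d" for d
            using that eps by simp
          then show ?thesis unfolding mu_gt_kappa R_def using delta_pos by blast
        qed
        ultimately have "2 * D\<^sub>r * (r t)\<^sup>2 \<le> 2 * ((\<mu> - \<kappa>) * R) * w t"
          by (metis mult.assoc)
        with D(2) have "D - R * (- 2 * \<kappa> * w t) \<le> - 2 * \<mu> * (cone L p q t - R * w t)"
          by (simp add: algebra_simps)
        moreover have "((\<lambda>t. cone L p q t - R * w t) has_real_derivative D - R * (- 2 * \<kappa> * w t)) (at_right t)"
          by (intro DERIV_diff DERIV_cmult D dw)
        ultimately show "\<exists>D. ((\<lambda>t. cone L p q t - R * w t) has_real_derivative D) (at_right t) \<and>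
            D \<le> - 2 * \<mu> * (cone L p q t - R * w t)" by blast
      qed
      also have "\<dots> \<le> 0"
      proof (intro mult_nonneg_nonpos)
        have "0 \<le> R * w (- T)" using R by (simp add: w_def)
        moreover have "cone L p q (- T) = - (L\<^sup>2 * (norm (p (- T)))\<^sup>2)" by (simp add: cone_def q)
        moreover have "0 \<le> L\<^sup>2 * (norm (p (- T)))\<^sup>2" by simp
        ultimately show "cone L p q (- T) - R * w (- T) \<le> 0" by linarith
      qed simp
      finally show ?thesis by (simp add: cone_def)
    qed
    \<comment> \<open>Of the 4, two come from the square itself and one from each mixed product;
      \<open>L\<^sup>2\<close> comes from replacing \<open>q\<close> by its barrier. As
      \<open>c \<le> \<kappa>\<close>, at least \<kappa> of the rate \<open>2 * \<kappa>\<close> of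
      \<open>w\<close> is left against the forcing.\<close>
    define c where "c = K * (4 + L\<^sup>2)"
    have c: "c \<le> \<kappa>" using small(2) eps by (simp add: c_def field_simps)
    have "exp (- c * (0 - t)) * ((norm (p t))\<^sup>2 - R' * w t) \<le> (norm (p 0))\<^sup>2 - R' * w 0"
    proof (rule right_gronwall_lower[OF t(2)])
      show "continuous_on {t..0} (\<lambda>t. (norm (p t))\<^sup>2 - R' * w t)"
        by (intro continuous_intros cont)
      fix s assume s: "t \<le> s" "s < 0"
      obtain a where dp: "(p has_vector_derivative A (p s) + a) (at_right s)"
        and a: "norm a \<le> K * (norm (p s) + norm (q s) + r s)"
        using ctrl unfolding controlled_def by blast
      let ?p = "norm (p s)" and ?q = "norm (q s)"
      have "- (p s \<bullet> a) \<le> ?p * norm a" using norm_cauchy_schwarz[of "p s" "- a"] by simp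
      also have "\<dots> \<le> ?p * (K * (?p + ?q + r s))" using a by (intro mult_left_mono) auto
      also have "\<dots> = K * (?p\<^sup>2 + ?p * ?q + ?p * r s)" by (simp add: algebra_simps power2_eq_square)
      finally have "- 2 * (p s \<bullet> a) \<le> K * (2 * ?p\<^sup>2 + 2 * ?p * ?q + 2 * ?p * r s)"
        by (simp add: algebra_simps)
      also have "\<dots> \<le> K * (4 * ?p\<^sup>2 + ?q\<^sup>2 + (r s)\<^sup>2)"
        using K sum_squares_bound[of ?p ?q] sum_squares_bound[of ?p "r s"] by (intro mult_left_mono) auto
      also have "\<dots> \<le> K * (4 * ?p\<^sup>2 + (L\<^sup>2 * ?p\<^sup>2 + R * w s) + N\<^sup>2 * w s)"
        using K fast[of s] r2[of s] s t by (intro mult_left_mono add_mono) auto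
      also have "\<dots> = c * ?p\<^sup>2 + K * (R + N\<^sup>2) * w s" by (simp add: c_def algebra_simps)
      also have "K * (R + N\<^sup>2) * w s \<le> \<kappa> * R' * w s"
      proof (rule mult_right_mono)
          have "k * (X\<^sup>2 + c / k) = k * X\<^sup>2 + c" if "0 < k" for k c :: real
            using that by (simp add: distrib_left)
          then have "\<kappa> * R' = \<kappa> * X\<^sup>2 + K * (R + N\<^sup>2)"
            unfolding R'_def using kappa_pos by blast
          moreover have "0 \<le> \<kappa> * X\<^sup>2" using kappa_pos by (intro mult_nonneg_nonneg) auto
          ultimately show "K * (R + N\<^sup>2) \<le> \<kappa> * R'" by linarith
        qed (simp add: w_def)
      also have "\<kappa> * R' * w s \<le> (2 * \<kappa> - c) * R' * w s"
        using c R' by (intro mult_right_mono) (auto simp: w_def)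
      finally have "- 2 * (p s \<bullet> a) \<le> c * ?p\<^sup>2 + (2 * \<kappa> - c) * R' * w s" by simp
      then have "- c * (?p\<^sup>2 - R' * w s) \<le> 2 * (p s \<bullet> (A (p s) + a)) - R' * (- 2 * \<kappa> * w s)"
        using A_nonneg[of "p s"] by (simp add: inner_add_right algebra_simps)
      moreover have "((\<lambda>t. (norm (p t))\<^sup>2 - R' * w t) has_real_derivative
          2 * (p s \<bullet> (A (p s) + a)) - R' * (- 2 * \<kappa> * w s)) (at_right s)"
        by (intro DERIV_diff DERIV_cmult dw has_real_derivative_norm_power2 dp)
      ultimately show "\<exists>D. ((\<lambda>t. (norm (p t))\<^sup>2 - R' * w t) has_real_derivative D) (at_right s) \<and>
          - c * ((norm (p s))\<^sup>2 - R' * w s) \<le> D" by blast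
    qed
    also have "(norm (p 0))\<^sup>2 - R' * w 0 \<le> 0"
    proof -
      have "(norm (p 0))\<^sup>2 \<le> X\<^sup>2" using p by (intro power_mono) auto
      moreover have "0 \<le> K * (R + N\<^sup>2) / \<kappa>" using K R kappa_pos by (intro divide_nonneg_pos mult_nonneg_nonneg) auto
      ultimately show ?thesis by (simp add: R'_def w_def)
    qed
    finally have slow: "(norm (p t))\<^sup>2 \<le> R' * w t" by (simp add: mult_le_0_iff)
    have "L\<^sup>2 * (norm (p t))\<^sup>2 \<le> L\<^sup>2 * (R' * w t)" using slow by (intro mult_left_mono) auto
    with fast[OF t] slow show ?thesis by (simp add: algebra_simps)
  qed
  note bound = this
  define C where "C = sqrt (R' + (L\<^sup>2 * R' + R))"
  have nn: "0 \<le> L\<^sup>2 * R' + R" using R R' by simp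
  have C2: "C\<^sup>2 = R' + (L\<^sup>2 * R' + R)" "0 \<le> C" using nn R' by (auto simp: C_def)
  show ?thesis
  proof (rule that)
    fix p q r T t
    assume "controlled p q r" "\<And>t. t \<le> 0 \<Longrightarrow> r t \<le> N * exp (- \<kappa> * t)"
      "q (- T) = 0" "norm (p 0) \<le> X" "- T \<le> t" "t \<le> 0"
    note b = bound[OF this]
    have w: "0 \<le> w t" by (simp add: w_def)
    have "(norm (p t))\<^sup>2 \<le> C\<^sup>2 * w t" "(norm (q t))\<^sup>2 \<le> C\<^sup>2 * w t"
      using b mult_nonneg_nonneg[OF R' w] mult_nonneg_nonneg[OF nn w] unfolding C2(1) by (auto simp: algebra_simps)
    then have "(norm (p t))\<^sup>2 \<le> (C * exp (- \<kappa> * t))\<^sup>2" "(norm (q t))\<^sup>2 \<le> (C * exp (- \<kappa> * t))\<^sup>2"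
      by (simp_all only: w2)
    then show "norm (p t) \<le> C * exp (- \<kappa> * t) \<and> norm (q t) \<le> C * exp (- \<kappa> * t)"
      using C2(2) by (auto intro!: power2_le_imp_le)
  qed
qed


text \<open>The a priori bound makes the values at time 0 bounded. Along a convergent subsequence,
  continuous dependence carries the convergence to every other time, and the weighted bound survives
  in the limit.\<close>

lemma slow_sol_exists:
  assumes ex: "\<And>s z. \<exists>u. sol e u \<and> u s = z"
    and e: "0 \<le> N" "\<And>t. t \<le> 0 \<Longrightarrow> norm (e t) \<le> N * exp (- \<kappa> * t)"
  obtains u where "slow_sol e u" "fst (u 0) = x"
proof -
  have "\<exists>u. sol e u \<and> snd (u (- real n)) = 0 \<and> fst (u 0) = x" for n
  proof -
    \<comment> \<open>The zero section serves as the Lipschitz graph on which the orbit starts at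
      time \<open>- n\<close>.\<close>
    obtain u where "sol e u" "snd (u (- real n)) = (\<lambda>x. 0) (fst (u (- real n)))" "fst (u 0) = x"
      by (rule sol_with_slow_component[OF ex, where H = "\<lambda>_. 0" and s = "- real n" and t = 0 and \<xi> = x])
         (use L in auto)
    then show ?thesis by auto
  qed
  then obtain U where U: "\<And>n. sol e (U n)" "\<And>n. snd (U n (- real n)) = 0" "\<And>n. fst (U n 0) = x"
    by metis
  obtain C where C: "\<And>p q r T t. \<lbrakk>controlled p q r; \<And>t. t \<le> 0 \<Longrightarrow> r t \<le> N * exp (- \<kappa> * t);
      q (- T) = 0; norm (p 0) \<le> norm x; - T \<le> t; t \<le> 0\<rbrakk>
      \<Longrightarrow> norm (p t) \<le> C * exp (- \<kappa> * t) \<and> norm (q t) \<le> C * exp (- \<kappa> * t)"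
    by (rule controlled_growth_bound[OF e(1), of "norm x"]) blast
  have bound: "norm (fst (U n t)) \<le> C * exp (- \<kappa> * t) \<and> norm (snd (U n t)) \<le> C * exp (- \<kappa> * t)"
    if "- real n \<le> t" "t \<le> 0" for n t
    by (rule C[OF sol_controlled[OF U(1)[of n]], of "real n" t]) (use e U that in auto)
  have "bounded (range (\<lambda>n. snd (U n 0)))"
    unfolding bounded_iff using bound[of _ 0] by (intro exI[of _ C]) auto
  then obtain y r where r: "strict_mono r" and lim: "((\<lambda>n. snd (U n 0)) \<circ> r) \<longlonglongrightarrow> y"
    using bounded_imp_convergent_subsequence by blast
  obtain u where u: "sol e u" "u 0 = (x, y)" using ex by blast
  have "(\<lambda>n. (x, snd (U (r n) 0))) \<longlonglongrightarrow> (x, y)"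
    using lim by (intro tendsto_intros) (simp add: o_def)
  also have "(\<lambda>n. (x, snd (U (r n) 0))) = (\<lambda>n. U (r n) 0)" using U(3) by (auto simp: prod_eq_iff)
  finally have "(\<lambda>n. U (r n) 0) \<longlonglongrightarrow> u 0" by (simp add: u)
  then have conv: "(\<lambda>n. U (r n) t) \<longlonglongrightarrow> u t" for t by (rule sol_tendsto[OF U(1) u(1)])
  have "norm (fst (u t)) \<le> C * exp (- \<kappa> * t) \<and> norm (snd (u t)) \<le> C * exp (- \<kappa> * t)" if "t \<le> 0" for t
  proof -
    \<comment> \<open>For fixed \<open>t\<close> the bound holds for the orbits that start before
      \<open>t\<close>, that is, for all large \<open>n\<close>.\<close>
    obtain n0 where n0: "- t \<le> real n0" using real_arch_simple by blast
    have "- real (r n) \<le> t" if "n \<ge> n0" for n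
      using seq_suble[OF r, of n] that n0 by linarith
    then have "\<forall>n\<ge>n0. norm (fst (U (r n) t)) \<le> C * exp (- \<kappa> * t)"
      "\<forall>n\<ge>n0. norm (snd (U (r n) t)) \<le> C * exp (- \<kappa> * t)"
      using bound \<open>t \<le> 0\<close> by blast+
    moreover have "(\<lambda>n. norm (fst (U (r n) t))) \<longlonglongrightarrow> norm (fst (u t))"
      "(\<lambda>n. norm (snd (U (r n) t))) \<longlonglongrightarrow> norm (snd (u t))"
      by (intro tendsto_intros conv)+
    ultimately show ?thesis by (intro conjI) (blast intro: LIMSEQ_le_const2)+
  qed
  then have "slow_sol e u" using u by (auto simp: slow_sol_def)
  then show ?thesis using that u by auto
qed

lemma slow_sol_tracking:
  assumes ex: "\<And>s z. \<exists>u. sol e u \<and> u s = z"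
    and e: "0 \<le> N" "\<And>t. t \<le> 0 \<Longrightarrow> norm (e t) \<le> N * exp (- \<kappa> * t)"
    and u: "sol e u"
  obtains v where "slow_sol e v"
    "\<And>t. 0 \<le> t \<Longrightarrow> norm (u t - v t) \<le> (1 + 1 / (2 * L)) * exp (- \<kappa> * t) * norm (u 0 - v 0)"
proof -
  have "\<exists>v. slow_sol e v \<and> fst (v 0) = x" for x using slow_sol_exists[OF ex e] by metis
  then obtain V where V: "\<And>x. slow_sol e (V x)" "\<And>x. fst (V x 0) = x" by metis
  \<comment> \<open>By \<open>slow_sol_cone\<close> this graph of slow orbits at time 0 has
    Lipschitz constant \<open>L\<close>, as \<open>sol_with_slow_component\<close> demands.\<close>
  define H where "H x = snd (V x 0)" for x
  have V0: "V x 0 = (x, H x)" for x by (simp add: H_def V prod_eq_iff)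
  have H: "norm (H x - H x') \<le> L * norm (x - x')" for x x'
    using slow_sol_cone[OF V(1) V(1), of x x'] by (simp add: H_def V)
  define x where "x = fst (u 0)"
  define y where "y = snd (u 0)"
  have "\<exists>v. sol e v \<and> snd (v 0) = H (fst (v 0)) \<and> fst (v (real n)) = fst (u (real n))" for n
    by (rule sol_with_slow_component[OF ex, where H = H and s = 0 and t = "real n"]) (use H in auto)
  then obtain v where v: "\<And>n. sol e (v n)" "\<And>n. snd (v n 0) = H (fst (v n 0))"
    "\<And>n. fst (v n (real n)) = fst (u (real n))" by metis
  \<comment> \<open>With equal slow components at time \<open>n\<close> this form is nonnegative
    there, hence at all earlier times.\<close>
  let ?cone = "\<lambda>w. cone (2 * L) (\<lambda>t. fst (u t) - fst (w t)) (\<lambda>t. snd (u t) - snd (w t))"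
  have cone_v: "0 \<le> ?cone (v n) t" if "t \<le> real n" for n t
  proof -
    have "0 \<le> ?cone (v n) (real n)" by (simp add: cone_def v)
    also have "\<dots> \<le> exp (- 2 * \<mu> * (real n - t)) * ?cone (v n) t"
      using L that by (intro cone_decreasing sol_diff_controlled[OF u v(1)]) auto
    finally show ?thesis by (simp add: zero_le_mult_iff)
  qed
  \<comment> \<open>Slope \<open>2 * L\<close> gives \<open>2 * L\<close> times the distance on the
    left, while the Lipschitz bound for \<open>H\<close> returns only \<open>L\<close> times it on
    the right. With slope \<open>L\<close> the two would cancel and bound nothing.\<close>
  have "norm (x - fst (v n 0)) \<le> norm (y - H x) / L" for n
  proof -
    have "(2 * L * norm (x - fst (v n 0)))\<^sup>2 \<le> (norm (y - H (fst (v n 0))))\<^sup>2"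
      using cone_v[of 0 n] by (simp add: cone_def x_def y_def v power_mult_distrib)
    then have "2 * L * norm (x - fst (v n 0)) \<le> norm (y - H (fst (v n 0)))" by (rule power2_le_imp_le) simp
    also have "\<dots> \<le> norm (y - H x) + norm (H x - H (fst (v n 0)))"
      using norm_triangle_ineq[of "y - H x" "H x - H (fst (v n 0))"] by simp
    also have "\<dots> \<le> norm (y - H x) + L * norm (x - fst (v n 0))" using H by simp
    finally show ?thesis using L by (simp add: field_simps)
  qed
  then have "bounded (range (\<lambda>n. fst (v n 0)))"
    unfolding bounded_any_center[of _ x] by (intro exI[of _ "norm (y - H x) / L"]) (auto simp: dist_norm)
  then obtain x' r where r: "strict_mono r" and lim: "((\<lambda>n. fst (v n 0)) \<circ> r) \<longlonglongrightarrow> x'"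
    using bounded_imp_convergent_subsequence by blast
  let ?w = "V x'"
  have w: "sol e ?w" using V by (simp add: slow_sol_def)
  have lim1: "(\<lambda>n. fst (v (r n) 0)) \<longlonglongrightarrow> x'" using lim by (simp add: o_def)
  then have "(\<lambda>n. norm (fst (v (r n) 0) - x')) \<longlonglongrightarrow> 0" by (simp add: LIM_zero tendsto_norm_zero)
  then have lim2: "(\<lambda>n. L * norm (fst (v (r n) 0) - x')) \<longlonglongrightarrow> 0" by (rule tendsto_mult_right_zero)
  have "(\<lambda>n. norm (H (fst (v (r n) 0)) - H x')) \<longlonglongrightarrow> 0"
    by (rule tendsto_sandwich[OF _ _ tendsto_const lim2]) (auto intro!: always_eventually H)
  then have "(\<lambda>n. H (fst (v (r n) 0))) \<longlonglongrightarrow> H x'" by (simp add: tendsto_norm_zero_iff LIM_zero_iff)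
  with lim1 have "(\<lambda>n. (fst (v (r n) 0), H (fst (v (r n) 0)))) \<longlonglongrightarrow> (x', H x')" by (rule tendsto_Pair)
  also have "(\<lambda>n. (fst (v (r n) 0), H (fst (v (r n) 0)))) = (\<lambda>n. v (r n) 0)" using v(2) by (auto simp: prod_eq_iff)
  finally have "(\<lambda>n. v (r n) 0) \<longlonglongrightarrow> ?w 0" by (simp add: V0)
  then have conv: "(\<lambda>n. v (r n) t) \<longlonglongrightarrow> ?w t" for t by (rule sol_tendsto[OF v(1) w])
  have cone_w: "0 \<le> ?cone ?w t" for t
  proof -
    obtain n0 where n0: "t \<le> real n0" using real_arch_simple by blast
    have "0 \<le> ?cone (v (r n)) t" if "n \<ge> n0" for n
      using seq_suble[OF r, of n] that n0 by (intro cone_v) linarith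
    moreover have "(\<lambda>n. ?cone (v (r n)) t) \<longlonglongrightarrow> ?cone ?w t"
      unfolding cone_def by (intro tendsto_intros conv)
    ultimately show ?thesis by (intro LIMSEQ_le_const) auto
  qed
  show ?thesis
  proof (rule that[of ?w])
    fix t :: real assume t: "0 \<le> t"
    let ?p = "\<lambda>t. fst (u t) - fst (?w t)" and ?q = "\<lambda>t. snd (u t) - snd (?w t)"
    have "(norm (?q t))\<^sup>2 \<le> exp (- 2 * \<kappa> * (t - 0)) * (norm (?q 0))\<^sup>2"
      using L by (intro fast_component_decay[OF sol_diff_controlled[OF u w] t, of "2 * L"] cone_w) auto
    also have "\<dots> = (exp (- \<kappa> * t) * norm (?q 0))\<^sup>2"
      by (simp add: power_mult_distrib power2_eq_square exp_add[symmetric])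
    finally have q: "norm (?q t) \<le> exp (- \<kappa> * t) * norm (?q 0)" by (rule power2_le_imp_le) simp
    have "(2 * L * norm (?p t))\<^sup>2 \<le> (norm (?q t))\<^sup>2"
      using cone_w[of t] by (simp add: cone_def power_mult_distrib)
    then have "2 * L * norm (?p t) \<le> norm (?q t)" by (rule power2_le_imp_le) simp
    then have p: "norm (?p t) \<le> norm (?q t) / (2 * L)" using L by (simp add: field_simps)
    \<comment> \<open>Origin of the tracking constant: the norm of a pair is at most the sum of the
      norms, and the slow part is at most \<open>1 / (2 * L)\<close> times the fast part.\<close>
    have "norm (u t - ?w t) \<le> norm (?p t) + norm (?q t)"
      using norm_Pair_le[of "?p t" "?q t"] by (simp add: minus_prod_def)
    also have "\<dots> \<le> (1 + 1 / (2 * L)) * norm (?q t)" using p by (simp add: algebra_simps)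
    also have "\<dots> \<le> (1 + 1 / (2 * L)) * (exp (- \<kappa> * t) * norm (?q 0))"
      using q L by (intro mult_left_mono) auto
    also have "\<dots> \<le> (1 + 1 / (2 * L)) * (exp (- \<kappa> * t) * norm (u 0 - ?w 0))"
      using L by (intro mult_left_mono) (auto simp: norm_prod_def real_le_rsqrt)
    finally show "norm (u t - ?w t) \<le> (1 + 1 / (2 * L)) * exp (- \<kappa> * t) * norm (u 0 - ?w 0)" by simp
  qed (rule V)
qed

end

section \<open>The slow manifold\<close>

lemma path_shift_path_shift: "path_shift t (path_shift s \<omega>) = path_shift (t + s) \<omega>"
  by (simp add: path_shift_def add.assoc)

lemma cadlag_add_continuous:
  fixes f g :: "real \<Rightarrow> 'a::real_normed_vector"
  assumes f: "cadlag f" and g: "continuous_on UNIV g"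
  shows "cadlag (\<lambda>t. f t + g t)"
  unfolding cadlag_def
proof (intro allI conjI)
  fix t
  have g': "(g \<longlongrightarrow> g t) (at t within X)" for X
    using g by (auto simp: continuous_on_def intro: tendsto_within_subset)
  show "continuous (at_right t) (\<lambda>t. f t + g t)"
    using f g' unfolding cadlag_def continuous_within by (intro tendsto_add) auto
  obtain l where "(f \<longlongrightarrow> l) (at_left t)" using f by (auto simp: cadlag_def)
  then have "((\<lambda>t. f t + g t) \<longlongrightarrow> l + g t) (at_left t)" by (intro tendsto_add g')
  then show "\<exists>l. ((\<lambda>t. f t + g t) \<longlongrightarrow> l) (at_left t)" by blast
qed

locale random_slow_fast =
  slow_fast "(*v) S" "(*v) F" g1 g2 \<epsilon> \<gamma>f K \<gamma> L
  for S :: "real^'m^'m" and F :: "real^'n^'n" and g1 :: "(real^'m) \<times> (real^'n) \<Rightarrow> real^'m"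
    and g2 :: "(real^'m) \<times> (real^'n) \<Rightarrow> real^'n" and \<epsilon> \<gamma>f K \<gamma> L :: real +
  fixes \<sigma> \<alpha> :: real and P :: "(real \<Rightarrow> real^'n) measure" and \<Omega> :: "(real \<Rightarrow> real^'n) set"
  assumes law: "stable_levy_law \<alpha> P"
    and admissible: "admissible_paths S F g1 g2 \<sigma> \<alpha> \<epsilon> P \<Omega>"
begin

abbreviation "M \<equiv> restrict_space P \<Omega>"
abbreviation "tsol \<equiv> transformed_solution S F g1 g2 \<sigma> \<alpha> \<epsilon>"
abbreviation "flow \<equiv> phi_hat S F g1 g2 \<sigma> \<alpha> \<epsilon>"
abbreviation "Mh \<equiv> M_hat S F g1 g2 \<sigma> \<alpha> \<gamma> \<epsilon>"
abbreviation "hh \<equiv> h_hat S F g1 g2 \<sigma> \<alpha> \<gamma> \<epsilon>"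

definition noise :: "(real \<Rightarrow> real^'n) \<Rightarrow> real \<Rightarrow> real^'n" where
  "noise \<omega> t = \<sigma> *\<^sub>R eta F \<alpha> \<epsilon> (path_shift t \<omega>)"

lemma Omega_subset: "\<Omega> \<subseteq> D0" and Omega_sets: "\<Omega> \<in> sets P"
  using admissible law sets.sets_into_space[of \<Omega> P] by (auto simp: admissible_paths_def stable_levy_law_def)

lemma space_M: "space M = \<Omega>"
  using Omega_subset law by (auto simp: space_restrict_space stable_levy_law_def)

lemma shift_Omega: "\<omega> \<in> \<Omega> \<Longrightarrow> path_shift t \<omega> \<in> \<Omega>"
  using admissible by (auto simp: admissible_paths_def)

lemma shift_0: "\<omega> \<in> \<Omega> \<Longrightarrow> path_shift 0 \<omega> = \<omega>"
  using Omega_subset by (auto simp: path_shift_def D0_def)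

lemma noise_shift: "noise (path_shift s \<omega>) t = noise \<omega> (t + s)"
  by (simp add: noise_def path_shift_path_shift)

lemma cadlag_noise:
  assumes "\<omega> \<in> \<Omega>"
  shows "cadlag (noise \<omega>)"
proof -
  have "cadlag (\<lambda>t. eta F \<alpha> \<epsilon> (path_shift t \<omega>))" using admissible assms by (simp add: admissible_paths_def)
  then have eta: "continuous (at_right t) (\<lambda>t. eta F \<alpha> \<epsilon> (path_shift t \<omega>))"
    "\<exists>l. ((\<lambda>t. eta F \<alpha> \<epsilon> (path_shift t \<omega>)) \<longlongrightarrow> l) (at_left t)" for t
    unfolding cadlag_def by blast+
  show ?thesis unfolding cadlag_def noise_def[abs_def]
  proof (intro allI conjI)
    fix t
    show "continuous (at_right t) (\<lambda>t. \<sigma> *\<^sub>R eta F \<alpha> \<epsilon> (path_shift t \<omega>))"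
      by (rule continuous_scaleR[OF continuous_const eta(1)])
    show "\<exists>l. ((\<lambda>t. \<sigma> *\<^sub>R eta F \<alpha> \<epsilon> (path_shift t \<omega>)) \<longlongrightarrow> l) (at_left t)"
      using eta(2)[of t] tendsto_scaleR[OF tendsto_const] by blast
  qed
qed

lemma noise_growth:
  assumes "\<omega> \<in> \<Omega>"
  obtains N where "0 \<le> N" "\<And>t. t \<le> 0 \<Longrightarrow> norm (noise \<omega> t) \<le> N * exp (- \<kappa> * t)"
proof -
  have "((\<lambda>t. norm (eta F \<alpha> \<epsilon> (path_shift t \<omega>)) / \<bar>t\<bar>) \<longlongrightarrow> 0) at_infinity"
    using admissible assms by (simp add: admissible_paths_def)
  then have "((\<lambda>t. \<bar>\<sigma>\<bar> * (norm (eta F \<alpha> \<epsilon> (path_shift t \<omega>)) / \<bar>t\<bar>)) \<longlongrightarrow> \<bar>\<sigma>\<bar> * 0) at_infinity"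
    by (intro tendsto_intros)
  then have "((\<lambda>t. norm (noise \<omega> t) / \<bar>t\<bar>) \<longlongrightarrow> 0) at_infinity" by (simp add: noise_def)
  from cadlag_sublinear_exp_bound[OF cadlag_noise[OF assms] this kappa_pos] that
  show ?thesis by blast
qed

text \<open>The noise is continuous from the right, and the Lipschitz bounds carry this through
  \<open>g1\<close> and \<open>g2\<close> to the integrands.\<close>

lemma tsol_imp_sol:
  assumes "\<omega> \<in> \<Omega>" "tsol \<omega> u"
  shows "sol (noise \<omega>) u"
  unfolding sol_def
proof (intro conjI allI)
  show cu: "continuous_on UNIV u" using assms by (simp add: transformed_solution_def)
  fix t
  have u: "(u \<longlongrightarrow> u t) (at_right t)"
    using cu by (auto simp: continuous_on_def intro: tendsto_within_subset)
  have e: "(noise \<omega> \<longlongrightarrow> noise \<omega> t) (at_right t)"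
    using cadlag_noise[OF assms(1)] by (simp add: cadlag_def continuous_within)
  let ?z = "\<lambda>s. (fst (u s), snd (u s) + noise \<omega> s)"
  have z: "(?z \<longlongrightarrow> ?z t) (at_right t)" by (intro tendsto_intros u e)
  have lim: "((\<lambda>s. g (?z s)) \<longlongrightarrow> g (?z t)) (at_right t)"
    if g: "\<And>x1 y1 x2 y2. norm (g (x1, y1) - g (x2, y2)) \<le> K * (norm (x1 - x2) + norm (y1 - y2))"
    for g :: "(real^'m) \<times> (real^'n) \<Rightarrow> 'z::real_normed_vector"
  proof -
    have "((\<lambda>s. K * (norm (fst (?z s) - fst (?z t)) + norm (snd (?z s) - snd (?z t)))) \<longlongrightarrow>
        K * (norm (fst (?z t) - fst (?z t)) + norm (snd (?z t) - snd (?z t)))) (at_right t)"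
      by (intro tendsto_intros z)
    then have "((\<lambda>s. K * (norm (fst (?z s) - fst (?z t)) + norm (snd (?z s) - snd (?z t)))) \<longlongrightarrow> 0) (at_right t)"
      by simp
    then have "((\<lambda>s. g (?z s) - g (?z t)) \<longlongrightarrow> 0) (at_right t)"
      by (rule Lim_null_comparison[rotated]) (use g in \<open>auto intro!: always_eventually\<close>)
    then show ?thesis by (simp add: LIM_zero_iff)
  qed
  have mat: "((\<lambda>s. N *v f s) \<longlongrightarrow> N *v f t) (at_right t)" if "(f \<longlongrightarrow> f t) (at_right t)"
    for N :: "real^'a^'a" and f :: "real \<Rightarrow> real^'a"
    by (rule bounded_linear.tendsto[OF matrix_vector_mul_bounded_linear that])
  show "((\<lambda>t. fst (u t)) has_vector_derivative S *v fst (u t) + g1 (fst (u t), snd (u t) + noise \<omega> t)) (at_right t)"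
  proof (rule has_integral_imp_right_derivative)
    show "((\<lambda>s. S *v fst (u s) + g1 (fst (u s), snd (u s) + noise \<omega> s)) has_integral fst (u b) - fst (u a)) {a..b}"
      if "a \<le> b" for a b
      using assms that by (simp add: transformed_solution_def noise_def)
    show "continuous (at_right t) (\<lambda>s. S *v fst (u s) + g1 (fst (u s), snd (u s) + noise \<omega> s))"
      unfolding continuous_within by (intro tendsto_add mat lim[OF g1_lip] tendsto_fst u)
  qed
  show "((\<lambda>t. snd (u t)) has_vector_derivative (1 / \<epsilon>) *\<^sub>R (F *v snd (u t)) +
      (1 / \<epsilon>) *\<^sub>R g2 (fst (u t), snd (u t) + noise \<omega> t)) (at_right t)"
  proof (rule has_integral_imp_right_derivative)
    show "((\<lambda>s. (1 / \<epsilon>) *\<^sub>R (F *v snd (u s)) + (1 / \<epsilon>) *\<^sub>R g2 (fst (u s), snd (u s) + noise \<omega> s))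
        has_integral snd (u b) - snd (u a)) {a..b}" if "a \<le> b" for a b
      using assms that by (simp add: transformed_solution_def noise_def)
    show "continuous (at_right t) (\<lambda>s. (1 / \<epsilon>) *\<^sub>R (F *v snd (u s)) +
        (1 / \<epsilon>) *\<^sub>R g2 (fst (u s), snd (u s) + noise \<omega> s))"
      unfolding continuous_within by (intro tendsto_add tendsto_scaleR tendsto_const mat lim[OF g2_lip] tendsto_snd u)
  qed
qed

text \<open>Shifting time amounts to shifting the noise path. The cocycle property and solutions
  through a point at an arbitrary time rest on this.\<close>

lemma tsol_shift:
  assumes "tsol \<omega> u"
  shows "tsol (path_shift s \<omega>) (\<lambda>t. u (t + s))"
  unfolding transformed_solution_def
proof (intro conjI allI impI)
  show "continuous_on UNIV (\<lambda>t. u (t + s))"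
    by (rule continuous_on_compose2[of UNIV u])
       (use assms in \<open>auto simp: transformed_solution_def intro!: continuous_intros\<close>)
  have e: "eta F \<alpha> \<epsilon> (path_shift r (path_shift s \<omega>)) = eta F \<alpha> \<epsilon> (path_shift (r + s) \<omega>)" for r
    by (simp add: path_shift_path_shift)
  have shift: "((\<lambda>x. f (x + s)) has_integral I) {a..b}" if "(f has_integral I) {a + s..b + s}"
    for f :: "real \<Rightarrow> 'z::real_normed_vector" and I a b
    using has_integral_shift_real_ivl[OF that, of s] by simp
  fix a b :: real assume "a \<le> b"
  then have "a + s \<le> b + s" by simp
  with assms have *: "((\<lambda>r. S *v fst (u r) + g1 (fst (u r), snd (u r) + \<sigma> *\<^sub>R eta F \<alpha> \<epsilon> (path_shift r \<omega>)))
          has_integral (fst (u (b + s)) - fst (u (a + s)))) {a + s..b + s}"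
    "((\<lambda>r. (1 / \<epsilon>) *\<^sub>R (F *v snd (u r)) + (1 / \<epsilon>) *\<^sub>R g2 (fst (u r), snd (u r) + \<sigma> *\<^sub>R eta F \<alpha> \<epsilon> (path_shift r \<omega>)))
          has_integral (snd (u (b + s)) - snd (u (a + s)))) {a + s..b + s}"
    unfolding transformed_solution_def by blast+
  show "((\<lambda>r. S *v fst (u (r + s)) + g1 (fst (u (r + s)), snd (u (r + s)) +
            \<sigma> *\<^sub>R eta F \<alpha> \<epsilon> (path_shift r (path_shift s \<omega>))))
          has_integral (fst (u (b + s)) - fst (u (a + s)))) {a..b}"
    unfolding e by (rule shift[OF *(1)])
  show "((\<lambda>r. (1 / \<epsilon>) *\<^sub>R (F *v snd (u (r + s))) + (1 / \<epsilon>) *\<^sub>R g2 (fst (u (r + s)), snd (u (r + s)) +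
            \<sigma> *\<^sub>R eta F \<alpha> \<epsilon> (path_shift r (path_shift s \<omega>))))
          has_integral (snd (u (b + s)) - snd (u (a + s)))) {a..b}"
    unfolding e by (rule shift[OF *(2)])
qed

lemma tsol_unique: "\<omega> \<in> \<Omega> \<Longrightarrow> tsol \<omega> u \<Longrightarrow> tsol \<omega> v \<Longrightarrow> u s = v s \<Longrightarrow> u = v"
  by (rule sol_unique[OF tsol_imp_sol tsol_imp_sol])

lemma flow_tsol:
  assumes "\<omega> \<in> \<Omega>"
  shows "tsol \<omega> (\<lambda>t. flow t \<omega> z)" "flow 0 \<omega> z = z"
proof -
  obtain u where u: "tsol \<omega> u" "u 0 = z" using admissible assms unfolding admissible_paths_def by blast
  have "(THE u. tsol \<omega> u \<and> u 0 = z) = u"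
    using u tsol_unique[OF assms, where s = 0] by (intro the_equality) auto
  then have "flow t \<omega> z = u t" for t by (simp add: phi_hat_def)
  then have "(\<lambda>t. flow t \<omega> z) = u" by (intro ext)
  then show "tsol \<omega> (\<lambda>t. flow t \<omega> z)" "flow 0 \<omega> z = z" using u by (auto dest: fun_cong)
qed

lemma flow_eqI:
  assumes "\<omega> \<in> \<Omega>" "tsol \<omega> u" "u 0 = z"
  shows "u = (\<lambda>t. flow t \<omega> z)"
  using tsol_unique[OF assms(1,2) flow_tsol(1)[OF assms(1)], of 0 z] assms flow_tsol(2)[OF assms(1)] by simp

lemma flow_sol: "\<omega> \<in> \<Omega> \<Longrightarrow> sol (noise \<omega>) (\<lambda>t. flow t \<omega> z)"
  by (intro tsol_imp_sol flow_tsol)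

lemma flow_cocycle:
  assumes "\<omega> \<in> \<Omega>"
  shows "flow (t + s) \<omega> z = flow t (path_shift s \<omega>) (flow s \<omega> z)"
proof -
  have "(\<lambda>t. flow (t + s) \<omega> z) = (\<lambda>t. flow t (path_shift s \<omega>) (flow s \<omega> z))"
    by (rule flow_eqI[OF shift_Omega[OF assms] tsol_shift[OF flow_tsol(1)[OF assms]]]) simp
  then show ?thesis by (rule fun_cong)
qed

text \<open>Right derivatives need not be integrated back: the flow is a solution in the same sense
  with the same value at time 0.\<close>

lemma sol_noise_eq_flow:
  assumes "\<omega> \<in> \<Omega>" "sol (noise \<omega>) u"
  shows "u = (\<lambda>t. flow t \<omega> (u 0))"
  by (rule sol_unique[OF assms(2) flow_sol[OF assms(1)], of 0]) (simp add: flow_tsol assms)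

text \<open>Admissibility prescribes values at time 0 only. The equation is solved for the path seen
  from time \<open>s\<close>, and the solution is shifted back.\<close>

lemma sol_through:
  assumes "\<omega> \<in> \<Omega>"
  shows "\<exists>u. sol (noise \<omega>) u \<and> u s = z"
proof (intro exI conjI)
  have "tsol (path_shift (- s) (path_shift s \<omega>)) (\<lambda>t. flow (t + - s) (path_shift s \<omega>) z)"
    by (rule tsol_shift[OF flow_tsol(1)[OF shift_Omega[OF assms]]])
  then have "tsol \<omega> (\<lambda>t. flow (t + - s) (path_shift s \<omega>) z)"
    using shift_0[OF assms] by (simp add: path_shift_path_shift)
  then show "sol (noise \<omega>) (\<lambda>t. flow (t + - s) (path_shift s \<omega>) z)" by (rule tsol_imp_sol[OF assms])
  show "flow (s + - s) (path_shift s \<omega>) z = z" using flow_tsol(2)[OF shift_Omega[OF assms]] by simp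
qed

text \<open>Moving the weight to the other side turns finiteness of each supremum into an
  exponential bound; the larger constant serves both components.\<close>

lemma M_hat_iff:
  assumes "\<omega> \<in> \<Omega>"
  shows "z \<in> Mh \<omega> \<longleftrightarrow> slow_sol (noise \<omega>) (\<lambda>t. flow t \<omega> z)"
proof -
  let ?u = "\<lambda>t. flow t \<omega> z"
  have cont: "continuous_on X ?u" for X
    using flow_tsol(1)[OF assms, of z] by (auto simp: transformed_solution_def intro: continuous_on_subset)
  have weight: "norm (exp (- (- \<gamma> / \<epsilon>) * t) *\<^sub>R x) \<le> C \<longleftrightarrow> norm x \<le> C * exp (- \<kappa> * t)"
    for x :: "'z::real_normed_vector" and C t
    by (simp add: exp_minus field_simps)
  have bdd: "bdd_above ((\<lambda>t. norm (exp (- (- \<gamma> / \<epsilon>) * t) *\<^sub>R f t)) ` {..0}) \<longleftrightarrow>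
      (\<exists>C. \<forall>t\<le>0. norm (f t) \<le> C * exp (- \<kappa> * t))" for f :: "real \<Rightarrow> 'z::real_normed_vector"
    unfolding bdd_above_def weight[symmetric] by auto
  have "z \<in> Mh \<omega> \<longleftrightarrow> (\<exists>C. \<forall>t\<le>0. norm (fst (?u t)) \<le> C * exp (- \<kappa> * t)) \<and>
      (\<exists>C. \<forall>t\<le>0. norm (snd (?u t)) \<le> C * exp (- \<kappa> * t))"
    unfolding M_hat_def C_minus_def mem_Collect_eq bdd using cont by blast
  also have "\<dots> \<longleftrightarrow> (\<exists>C. \<forall>t\<le>0. norm (fst (?u t)) \<le> C * exp (- \<kappa> * t) \<and> norm (snd (?u t)) \<le> C * exp (- \<kappa> * t))"
  proof (intro iffI; elim conjE exE)
    fix C C' assume C: "\<forall>t\<le>0. norm (fst (?u t)) \<le> C * exp (- \<kappa> * t)" "\<forall>t\<le>0. norm (snd (?u t)) \<le> C' * exp (- \<kappa> * t)"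
    have "C * exp (- \<kappa> * t) \<le> max C C' * exp (- \<kappa> * t)" "C' * exp (- \<kappa> * t) \<le> max C C' * exp (- \<kappa> * t)" for t
      by (intro mult_right_mono; simp)+
    with C show "\<exists>C. \<forall>t\<le>0. norm (fst (?u t)) \<le> C * exp (- \<kappa> * t) \<and> norm (snd (?u t)) \<le> C * exp (- \<kappa> * t)"
      by (intro exI[of _ "max C C'"]) (meson order.trans)
  qed blast
  also have "\<dots> \<longleftrightarrow> slow_sol (noise \<omega>) ?u" using flow_sol[OF assms] by (simp add: slow_sol_def)
  finally show ?thesis .
qed

lemma M_hat_cone:
  assumes "\<omega> \<in> \<Omega>" "(x, y) \<in> Mh \<omega>" "(x', y') \<in> Mh \<omega>"
  shows "norm (y - y') \<le> L * norm (x - x')"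
  using slow_sol_cone[of "noise \<omega>" "\<lambda>t. flow t \<omega> (x, y)" "\<lambda>t. flow t \<omega> (x', y')"] assms
  by (simp add: M_hat_iff flow_tsol)

text \<open>\<open>slow_sol_exists\<close> supplies a point over \<open>x\<close>, and
  \<open>M_hat_cone\<close> with equal slow components leaves only one, so the description in
  \<open>h_hat\<close> is determinate.\<close>

lemma M_hat_graph:
  assumes \<omega>: "\<omega> \<in> \<Omega>"
  shows "(x, y) \<in> Mh \<omega> \<longleftrightarrow> y = hh \<omega> x"
proof -
  obtain N where N: "0 \<le> N" "\<And>t. t \<le> 0 \<Longrightarrow> norm (noise \<omega> t) \<le> N * exp (- \<kappa> * t)"
    using noise_growth[OF \<omega>] by blast
  obtain u where u: "slow_sol (noise \<omega>) u" "fst (u 0) = x"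
    using slow_sol_exists[OF sol_through[OF \<omega>] N] by blast
  have "u = (\<lambda>t. flow t \<omega> (u 0))" using u by (intro sol_noise_eq_flow \<omega>) (simp add: slow_sol_def)
  with u have "u 0 \<in> Mh \<omega>" by (subst M_hat_iff[OF \<omega>]) simp
  with u(2) have mem: "(x, snd (u 0)) \<in> Mh \<omega>" by (metis prod.collapse)
  have unique: "y = y'" if "(x, y) \<in> Mh \<omega>" "(x, y') \<in> Mh \<omega>" for y y'
    using M_hat_cone[OF \<omega> that] by simp
  have eq: "hh \<omega> x = snd (u 0)"
    unfolding h_hat_def using mem unique by (intro the_equality)
  show ?thesis
  proof
    assume "(x, y) \<in> Mh \<omega>"
    from unique[OF this mem] show "y = hh \<omega> x" by (simp only: eq)
  next
    assume "y = hh \<omega> x"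
    with mem show "(x, y) \<in> Mh \<omega>" by (simp only: eq)
  qed
qed

lemma M_hat_eq: "\<omega> \<in> \<Omega> \<Longrightarrow> Mh \<omega> = {(x, hh \<omega> x) | x. True}"
  by (auto simp: M_hat_graph)

lemma h_hat_lipschitz: "\<omega> \<in> \<Omega> \<Longrightarrow> norm (hh \<omega> x - hh \<omega> x') \<le> L * norm (x - x')"
  by (intro M_hat_cone[where \<omega> = \<omega>]) (simp_all add: M_hat_graph)

lemma M_hat_invariant:
  assumes \<omega>: "\<omega> \<in> \<Omega>" and z: "z \<in> Mh \<omega>"
  shows "flow s \<omega> z \<in> Mh (path_shift s \<omega>)"
proof -
  let ?u = "\<lambda>t. flow t \<omega> z"
  obtain C where C: "\<And>t. t \<le> 0 \<Longrightarrow> norm (fst (?u t)) \<le> C * exp (- \<kappa> * t)"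
      "\<And>t. t \<le> 0 \<Longrightarrow> norm (snd (?u t)) \<le> C * exp (- \<kappa> * t)"
    using z unfolding M_hat_iff[OF \<omega>] slow_sol_def by blast
  have "continuous_on {0..\<bar>s\<bar>} ?u"
    using flow_tsol(1)[OF \<omega>, of z] by (auto simp: transformed_solution_def intro: continuous_on_subset)
  then have "bounded (?u ` {0..\<bar>s\<bar>})" by (intro compact_imp_bounded compact_continuous_image) auto
  then obtain R where R: "\<And>t. 0 \<le> t \<Longrightarrow> t \<le> \<bar>s\<bar> \<Longrightarrow> norm (?u t) \<le> R" by (fastforce simp: bounded_iff)
  \<comment> \<open>The factor \<open>exp (- \<kappa> * s)\<close> is the price of moving the origin
    of time by \<open>s\<close>; \<open>R\<close> covers the piece of the orbit between time 0 and a
    positive \<open>s\<close>.\<close>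
  define B where "B = max R (C * exp (- \<kappa> * s))"
  have R0: "0 \<le> R" using order.trans[OF norm_ge_zero R[of 0]] by simp
  have bound: "norm (f (?u (t + s))) \<le> B * exp (- \<kappa> * t)"
    if t: "t \<le> 0" and f: "\<And>z. norm (f z) \<le> norm z" "\<And>t. t \<le> 0 \<Longrightarrow> norm (f (?u t)) \<le> C * exp (- \<kappa> * t)"
    for t and f :: "_ \<Rightarrow> 'z::real_normed_vector"
  proof (cases "t + s \<le> 0")
    case True
    have "norm (f (?u (t + s))) \<le> C * exp (- \<kappa> * (t + s))" by (rule f(2)[OF True])
    also have "\<dots> = C * exp (- \<kappa> * s) * exp (- \<kappa> * t)"
      by (simp add: exp_add[symmetric] distrib_left add.commute mult.assoc add_divide_distrib)
    also have "\<dots> \<le> B * exp (- \<kappa> * t)" by (intro mult_right_mono) (auto simp: B_def)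
    finally show ?thesis .
  next
    case False
    have "norm (f (?u (t + s))) \<le> norm (?u (t + s))" by (rule f(1))
    also have "\<dots> \<le> R" using False t by (intro R) auto
    also have "\<dots> \<le> R * exp (- \<kappa> * t)"
      using R0 t gamma eps mult_left_mono[of 1 "exp (- \<kappa> * t)" R] by (simp add: divide_nonpos_pos mult_nonneg_nonpos)
    also have "\<dots> \<le> B * exp (- \<kappa> * t)" by (intro mult_right_mono) (auto simp: B_def)
    finally show ?thesis .
  qed
  have "norm (fst (?u (t + s))) \<le> B * exp (- \<kappa> * t) \<and> norm (snd (?u (t + s))) \<le> B * exp (- \<kappa> * t)" if "t \<le> 0" for t
    using bound[OF that, of fst] bound[OF that, of snd] C norm_fst_le norm_snd_le
    by (metis prod.collapse)
  then have "slow_sol (noise (path_shift s \<omega>)) (\<lambda>t. flow t (path_shift s \<omega>) (flow s \<omega> z))"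
    unfolding slow_sol_def using flow_sol[OF shift_Omega[OF \<omega>]] by (auto simp: flow_cocycle[OF \<omega>])
  then show ?thesis by (subst M_hat_iff[OF shift_Omega[OF \<omega>]])
qed

lemma M_hat_tracking:
  assumes \<omega>: "\<omega> \<in> \<Omega>"
  shows "\<exists>z'\<in>Mh \<omega>. \<forall>t\<ge>0. norm (flow t \<omega> z - flow t \<omega> z') \<le> (1 + 1 / (2 * L)) * exp (- \<kappa> * t) * norm (z - z')"
proof -
  obtain N where N: "0 \<le> N" "\<And>t. t \<le> 0 \<Longrightarrow> norm (noise \<omega> t) \<le> N * exp (- \<kappa> * t)"
    using noise_growth[OF \<omega>] by blast
  obtain v where v: "slow_sol (noise \<omega>) v"
    "\<And>t. 0 \<le> t \<Longrightarrow> norm (flow t \<omega> z - v t) \<le> (1 + 1 / (2 * L)) * exp (- \<kappa> * t) * norm (flow 0 \<omega> z - v 0)"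
    using slow_sol_tracking[OF sol_through[OF \<omega>] N flow_sol[OF \<omega>]] by blast
  have eq: "v = (\<lambda>t. flow t \<omega> (v 0))" using v by (intro sol_noise_eq_flow \<omega>) (simp add: slow_sol_def)
  with v(1) have "v 0 \<in> Mh \<omega>" by (subst M_hat_iff[OF \<omega>]) simp
  moreover have "norm (flow t \<omega> z - flow t \<omega> (v 0)) \<le> (1 + 1 / (2 * L)) * exp (- \<kappa> * t) * norm (z - v 0)"
    if "0 \<le> t" for t
    using v(2)[OF that] unfolding fun_cong[OF eq, of t] flow_tsol(2)[OF \<omega>] .
  ultimately show ?thesis by blast
qed

end

lemma inv_T_eps: "inv (T_eps F \<sigma> \<alpha> \<epsilon> \<omega>) = (\<lambda>z. z + (0, \<sigma> *\<^sub>R eta F \<alpha> \<epsilon> \<omega>))"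
  by (rule inv_equality) (auto simp: T_eps_def split_beta)

text \<open>The points whose graph point has at least the infimum over \<open>X\<close> as its
  distance form a closed set containing \<open>X\<close>. With a countable \<open>X\<close> the
  distance to a random graph becomes measurable.\<close>

lemma infdist_graph_dense:
  fixes h :: "'a::metric_space \<Rightarrow> 'b::metric_space"
  assumes cont: "continuous_on UNIV h" and X: "closure X = UNIV"
  shows "infdist z {(x, h x) | x. True} = (INF x\<in>X. dist z (x, h x))"
proof -
  let ?d = "\<lambda>x. dist z (x, h x)"
  have X_ne: "X \<noteq> {}" using X by auto
  have bdd: "bdd_below (?d ` Y)" for Y by (auto intro: bdd_belowI[of _ 0])
  have img: "{(x, h x) | x. True} = (\<lambda>x. (x, h x)) ` UNIV" by auto
  have "closed {x. (INF x\<in>X. ?d x) \<le> ?d x}"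
    by (intro closed_Collect_le continuous_intros cont)
  moreover have "X \<subseteq> {x. (INF x\<in>X. ?d x) \<le> ?d x}" using bdd by (auto intro: cINF_lower)
  ultimately have "closure X \<subseteq> {x. (INF x\<in>X. ?d x) \<le> ?d x}" by (rule closure_minimal[rotated])
  then have "(INF x\<in>X. ?d x) \<le> (INF x. ?d x)" using X by (intro cINF_greatest) auto
  moreover have "(INF x. ?d x) \<le> (INF x\<in>X. ?d x)" using X_ne bdd by (intro cINF_superset_mono) auto
  ultimately show ?thesis unfolding infdist_def img by (simp add: image_comp)
qed

lemma has_integral_Pair:
  fixes f :: "real \<Rightarrow> 'a::banach" and g :: "real \<Rightarrow> 'b::banach"
  assumes "(f has_integral I) X" "(g has_integral J) X"
  shows "((\<lambda>x. (f x, g x)) has_integral (I, J)) X"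
proof -
  have "bounded_linear (\<lambda>x :: 'a. (x, 0 :: 'b))" "bounded_linear (\<lambda>x :: 'b. (0 :: 'a, x))"
    by (intro bounded_linear_Pair bounded_linear_ident bounded_linear_zero)+
  then have "((\<lambda>x. (x, 0)) \<circ> f has_integral (I, 0 :: 'b)) X" "((\<lambda>x. (0, x)) \<circ> g has_integral (0 :: 'a, J)) X"
    using assms by (auto dest: has_integral_linear)
  from has_integral_add[OF this] show ?thesis by (simp add: o_def)
qed

lemma norm_fst_diff_le: "norm (fst z - fst z') \<le> norm (z - z')"
  and norm_snd_diff_le: "norm (snd z - snd z') \<le> norm (z - z')"
  for z z' :: "'a::real_normed_vector \<times> 'b::real_normed_vector"
  by (simp_all add: norm_prod_def real_le_rsqrt)

section \<open>Measurability of the flow and of the manifold\<close>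

context random_slow_fast
begin

text \<open>Independence of the increments includes their measurability, so that evaluations need not be
  analysed in the Skorokhod topology.\<close>
lemma coordinate_measurable: "(\<lambda>\<omega>. \<omega> t) \<in> borel_measurable M"
proof -
  have space: "space P = D0" and prob: "prob_space P"
    and indep: "\<And>(s::nat \<Rightarrow> real) n. strict_mono s \<Longrightarrow>
        prob_space.indep_vars P (\<lambda>_. borel) (\<lambda>i \<omega>. \<omega> (s (Suc i)) - \<omega> (s i)) {..<n}"
    using law by (auto simp: stable_levy_law_def)
  have incr: "(\<lambda>\<omega>. \<omega> b - \<omega> a) \<in> borel_measurable P" if "a < b" for a b
  proof -
    \<comment> \<open>An arithmetic progression with first two terms \<open>a\<close> and
      \<open>b\<close>; its first increment is the one in question.\<close>
    have "strict_mono (\<lambda>i. a + real i * (b - a))" using that by (intro strict_monoI) auto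
    from indep[OF this, of 1] show ?thesis
      by (simp add: prob_space.indep_vars_def[OF prob])
  qed
  have zero: "\<omega> 0 = 0" if "\<omega> \<in> space P" for \<omega> using that by (simp add: space D0_def)
  have "(\<lambda>\<omega>. \<omega> t) \<in> borel_measurable P"
  proof (cases t "0 :: real" rule: linorder_cases)
    case less
    have "(\<lambda>\<omega>. - (\<omega> 0 - \<omega> t)) \<in> borel_measurable P" using incr[OF less] by (rule borel_measurable_uminus)
    then show ?thesis by (subst measurable_cong) (auto simp: zero)
  next
    case equal
    then show ?thesis by (subst measurable_cong[where g = "\<lambda>_. 0"]) (auto simp: zero)
  next
    case greater
    show ?thesis using incr[OF greater] by (subst measurable_cong) (auto simp: zero)
  qed
  then show ?thesis by (rule measurable_restrict_space1)
qed

lemma noise_measurable: "(\<lambda>\<omega>. noise \<omega> t) \<in> borel_measurable M"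
proof -
  have "(\<lambda>\<omega>. eta F \<alpha> \<epsilon> (path_shift t \<omega>)) \<in> borel_measurable M"
  proof (rule borel_measurable_eta)
    show "(\<lambda>\<omega>. path_shift t \<omega> s) \<in> borel_measurable M" for s
      unfolding path_shift_def by (intro borel_measurable_diff coordinate_measurable)
    show "\<exists>I. has_OU_integral F \<epsilon> (path_shift t \<omega>) I" if "\<omega> \<in> space M" for \<omega>
      using admissible shift_Omega[of \<omega> t] that by (auto simp: space_M admissible_paths_def)
  qed
  then show ?thesis unfolding noise_def by (intro borel_measurable_scaleR borel_measurable_const)
qed

lemma noise_pair_measurable: "(\<lambda>(t, \<omega>). noise \<omega> t) \<in> borel_measurable (borel \<Otimes>\<^sub>M M)"
  using cadlag_noise noise_measurable
  by (intro borel_measurable_right_continuous_pair) (auto simp: space_M cadlag_def)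

lemma lipschitz_nonlinearity_continuous:
  fixes g :: "(real^'m) \<times> (real^'n) \<Rightarrow> 'z::real_normed_vector"
  assumes "\<And>x1 y1 x2 y2. norm (g (x1, y1) - g (x2, y2)) \<le> K * (norm (x1 - x2) + norm (y1 - y2))"
  shows "continuous_on UNIV g"
proof (rule lipschitz_on_continuous_on[of "2 * K"], rule lipschitz_onI)
  fix z z' :: "(real^'m) \<times> (real^'n)"
  have "norm (g z - g z') \<le> K * (norm (fst z - fst z') + norm (snd z - snd z'))"
    using assms[of "fst z" "snd z" "fst z'" "snd z'"] by simp
  also have "\<dots> \<le> K * (norm (z - z') + norm (z - z'))"
    using K by (intro mult_left_mono add_mono norm_fst_diff_le norm_snd_diff_le) simp
  finally show "dist (g z) (g z') \<le> 2 * K * dist z z'" by (simp add: dist_norm algebra_simps)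
qed (use K in simp)

lemma flow_measurable: "(\<lambda>(t, \<omega>, z). flow t \<omega> z) \<in> borel_measurable (borel \<Otimes>\<^sub>M (M \<Otimes>\<^sub>M borel))"
proof -
  define f where "f t \<omega> z = (S *v fst z + g1 (fst z, snd z + noise \<omega> t),
      (1 / \<epsilon>) *\<^sub>R (F *v snd z) + (1 / \<epsilon>) *\<^sub>R g2 (fst z, snd z + noise \<omega> t))"
    for t \<omega> and z :: "(real^'m) \<times> (real^'n)"
  obtain a where a: "a > 0" "\<And>x. norm (S *v x) \<le> a * norm x" using linear_bounded_pos[OF linear(1)] by blast
  obtain b where b: "b > 0" "\<And>x. norm (F *v x) \<le> b * norm x" using linear_bounded_pos[OF linear(2)] by blast
  \<comment> \<open>A Lipschitz constant of the vector field, summed over both components: the bound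
    of the linear part plus \<open>2 * K\<close>, scaled by \<open>1 / \<epsilon>\<close> in the
    fast equation.\<close>
  define C where "C = (a + 2 * K) + 1 / \<epsilon> * (b + 2 * K)"
  have C: "0 < C" using a(1) b(1) K eps by (auto simp: C_def intro!: add_pos_pos)
  show ?thesis
  proof (rule borel_measurable_flow[where f = f and L = C])
    have [measurable]: "g1 \<in> borel_measurable borel" "g2 \<in> borel_measurable borel"
      by (intro borel_measurable_continuous_onI lipschitz_nonlinearity_continuous g1_lip g2_lip)+
    have [measurable]: "(\<lambda>x. S *v x) \<in> borel_measurable borel" "(\<lambda>x. F *v x) \<in> borel_measurable borel"
      by (intro borel_measurable_continuous_onI linear_continuous_on matrix_vector_mul_bounded_linear)+
    have [measurable]: "(fst :: (real^'m) \<times> (real^'n) \<Rightarrow> _) \<in> borel_measurable borel"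
        "(snd :: (real^'m) \<times> (real^'n) \<Rightarrow> _) \<in> borel_measurable borel"
      by (intro borel_measurable_continuous_onI continuous_intros)+
    have [measurable]: "(\<lambda>x. noise (fst (snd x)) (fst x)) \<in> borel_measurable (borel \<Otimes>\<^sub>M (M \<Otimes>\<^sub>M borel))"
      using measurable_compose[OF _ noise_pair_measurable, of "\<lambda>x. (fst x, fst (snd x))" "borel \<Otimes>\<^sub>M (M \<Otimes>\<^sub>M borel)"]
      by simp
    have "(\<lambda>x. f (fst x) (fst (snd x)) (snd (snd x))) \<in> borel_measurable (borel \<Otimes>\<^sub>M (M \<Otimes>\<^sub>M borel))"
      unfolding f_def by measurable
    then show "(\<lambda>(t, \<omega>, z). f t \<omega> z) \<in> borel_measurable (borel \<Otimes>\<^sub>M (M \<Otimes>\<^sub>M borel))"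
      by (simp add: case_prod_beta')
    show "norm (f t \<omega> z - f t \<omega> z') \<le> C * norm (z - z')" for t \<omega> z z'
    proof -
      let ?x = "fst z - fst z'" and ?y = "snd z - snd z'" and ?z = "norm (z - z')"
      let ?g1 = "g1 (fst z, snd z + noise \<omega> t) - g1 (fst z', snd z' + noise \<omega> t)"
      let ?g2 = "g2 (fst z, snd z + noise \<omega> t) - g2 (fst z', snd z' + noise \<omega> t)"
      have xy: "norm ?x \<le> ?z" "norm ?y \<le> ?z"
        by (rule norm_fst_diff_le norm_snd_diff_le)+
      have "K * (norm ?x + norm ?y) \<le> K * (?z + ?z)" using K xy by (intro mult_left_mono add_mono) auto
      then have g: "norm ?g1 \<le> 2 * K * ?z" "norm ?g2 \<le> 2 * K * ?z"
        using g1_lip[of "fst z" "snd z + noise \<omega> t" "fst z'" "snd z' + noise \<omega> t"]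
          g2_lip[of "fst z" "snd z + noise \<omega> t" "fst z'" "snd z' + noise \<omega> t"] by (simp_all add: algebra_simps)
      have "a * norm ?x \<le> a * ?z" "b * norm ?y \<le> b * ?z" using a(1) b(1) xy by auto
      then have lin: "norm (S *v ?x) \<le> a * ?z" "norm (F *v ?y) \<le> b * ?z" using a(2)[of ?x] b(2)[of ?y] by linarith+
      have "norm (S *v ?x + ?g1) \<le> (a + 2 * K) * ?z"
        using norm_triangle_mono[OF lin(1) g(1)] by (simp add: algebra_simps)
      moreover have "norm ((1 / \<epsilon>) *\<^sub>R (F *v ?y + ?g2)) \<le> 1 / \<epsilon> * ((b + 2 * K) * ?z)"
      proof -
        have "norm (F *v ?y + ?g2) \<le> (b + 2 * K) * ?z"
          using norm_triangle_mono[OF lin(2) g(2)] by (simp add: algebra_simps)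
        then have "1 / \<epsilon> * norm (F *v ?y + ?g2) \<le> 1 / \<epsilon> * ((b + 2 * K) * ?z)"
          using eps by (intro mult_left_mono) auto
        then show ?thesis using eps by (simp only: norm_scaleR) simp
      qed
      moreover have "f t \<omega> z - f t \<omega> z' = (S *v ?x + ?g1, (1 / \<epsilon>) *\<^sub>R (F *v ?y + ?g2))"
        by (simp add: f_def algebra_simps matrix_vector_mult_diff_distrib)
      ultimately have "norm (f t \<omega> z - f t \<omega> z') \<le> (a + 2 * K) * ?z + 1 / \<epsilon> * ((b + 2 * K) * ?z)"
        using norm_Pair_le[of "S *v ?x + ?g1" "(1 / \<epsilon>) *\<^sub>R (F *v ?y + ?g2)"] by simp
      then show ?thesis by (simp add: C_def algebra_simps)
    qed
    show "\<exists>B. \<forall>s. \<bar>s\<bar> \<le> T \<longrightarrow> norm (f s \<omega> 0) \<le> B" if "\<omega> \<in> space M" for T \<omega>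
    proof -
      have "\<omega> \<in> \<Omega>" using that by (simp add: space_M)
      then obtain R where R: "\<And>t. - T \<le> t \<Longrightarrow> t \<le> T \<Longrightarrow> norm (noise \<omega> t) \<le> R"
        using cadlag_bounded_Icc[OF cadlag_noise, of \<omega> "- T" T] by blast
      have "norm (f s \<omega> 0) \<le> K * R + 1 / \<epsilon> * (K * R)" if "\<bar>s\<bar> \<le> T" for s
      proof -
        have "K * norm (noise \<omega> s) \<le> K * R" using R[of s] that K by (intro mult_left_mono) auto
        then have g: "norm (g1 (0, noise \<omega> s)) \<le> K * R" "norm (g2 (0, noise \<omega> s)) \<le> K * R"
          using g1_lip[of 0 "noise \<omega> s" 0 0] g2_lip[of 0 "noise \<omega> s" 0 0] by (auto simp: g_zero)
        have "norm (f s \<omega> 0) \<le> norm (g1 (0, noise \<omega> s)) + norm ((1 / \<epsilon>) *\<^sub>R g2 (0, noise \<omega> s))"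
          using norm_Pair_le[of "g1 (0, noise \<omega> s)" "(1 / \<epsilon>) *\<^sub>R g2 (0, noise \<omega> s)"] by (simp add: f_def)
        also have "\<dots> \<le> K * R + 1 / \<epsilon> * (K * R)"
          using g eps by (intro add_mono) (auto simp: divide_right_mono)
        finally show ?thesis .
      qed
      then show ?thesis by blast
    qed
    show "continuous_on UNIV (\<lambda>t. flow t \<omega> z)" "flow 0 \<omega> z = z" if "\<omega> \<in> space M" for \<omega> z
      using flow_tsol[of \<omega> z] that by (auto simp: space_M transformed_solution_def)
    show "((\<lambda>s. f s \<omega> (flow s \<omega> z)) has_integral flow b \<omega> z - flow a \<omega> z) {a..b}"
      if "\<omega> \<in> space M" "a \<le> b" for \<omega> z a b
    proof -
      have "flow b \<omega> z - flow a \<omega> z = (fst (flow b \<omega> z) - fst (flow a \<omega> z), snd (flow b \<omega> z) - snd (flow a \<omega> z))"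
        by (simp add: prod_eq_iff)
      moreover have "tsol \<omega> (\<lambda>t. flow t \<omega> z)" using that flow_tsol by (simp add: space_M)
      ultimately show ?thesis unfolding f_def noise_def using \<open>a \<le> b\<close>
        by (auto simp: transformed_solution_def intro!: has_integral_Pair)
    qed
  qed (rule C)
qed

lemma flow_tendsto:
  assumes "\<omega> \<in> \<Omega>" "Z \<longlonglongrightarrow> z"
  shows "(\<lambda>n. flow t \<omega> (Z n)) \<longlonglongrightarrow> flow t \<omega> z"
  by (rule sol_tendsto[where U = "\<lambda>n t. flow t \<omega> (Z n)" and u = "\<lambda>t. flow t \<omega> z" and s = 0 and e = "noise \<omega>"])
     (use assms in \<open>simp_all add: flow_tsol flow_sol\<close>)

text \<open>By the cone condition, the backward orbits of \<open>(x, y)\<close> and of the point of the manifold over \<open>x\<close>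
  separate at rate \<open>\<mu> > \<kappa>\<close>, so a bound of order \<open>e\<^bsup>\<kappa>n\<^esup>\<close> at time \<open>- n\<close> forces \<open>y\<close> close to
  \<open>hh \<omega> x\<close>. With a countable \<open>E\<close> the right-hand side is measurable in \<open>\<omega>\<close>.\<close>
lemma h_hat_in_closed_iff:
  assumes \<omega>: "\<omega> \<in> \<Omega>" and D: "closed D" "E \<subseteq> D" "D \<subseteq> closure E"
  shows "hh \<omega> x \<in> D \<longleftrightarrow> (\<exists>N::nat. \<forall>n::nat. \<exists>y\<in>E. norm (flow (- real n) \<omega> (x, y)) < real N * exp (\<kappa> * real n))"
proof -
  let ?h = "hh \<omega> x" and ?v = "\<lambda>t. flow t \<omega> (x, hh \<omega> x)"
  have "slow_sol (noise \<omega>) ?v" using M_hat_graph[OF \<omega>, of x ?h] M_hat_iff[OF \<omega>] by simp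
  then obtain C where C: "\<And>t. t \<le> 0 \<Longrightarrow> norm (fst (?v t)) \<le> C * exp (- \<kappa> * t)"
      "\<And>t. t \<le> 0 \<Longrightarrow> norm (snd (?v t)) \<le> C * exp (- \<kappa> * t)" unfolding slow_sol_def by blast
  show ?thesis
  proof
    assume h: "?h \<in> D"
    \<comment> \<open>The factor 2 accounts for the two components; strictness leaves room to
      replace \<open>hh \<omega> x\<close> by nearby points of \<open>E\<close>.\<close>
    obtain N where N: "2 * C < real N" using reals_Archimedean2 by blast
    show "\<exists>N::nat. \<forall>n::nat. \<exists>y\<in>E. norm (flow (- real n) \<omega> (x, y)) < real N * exp (\<kappa> * real n)"
    proof (intro exI allI)
      fix n
      have "?h \<in> closure E" using h D by blast
      then obtain Y where Y: "\<And>k. Y k \<in> E" "Y \<longlonglongrightarrow> ?h" unfolding closure_sequential by blast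
      have "(\<lambda>k. (x, Y k)) \<longlonglongrightarrow> (x, ?h)" by (intro tendsto_intros Y)
      then have "(\<lambda>k. norm (flow (- real n) \<omega> (x, Y k))) \<longlonglongrightarrow> norm (?v (- real n))"
        by (intro tendsto_norm flow_tendsto \<omega>)
      moreover have "norm (?v (- real n)) < real N * exp (\<kappa> * real n)"
      proof -
        have "norm (?v (- real n)) \<le> norm (fst (?v (- real n))) + norm (snd (?v (- real n)))"
          using norm_Pair_le[of "fst (?v (- real n))" "snd (?v (- real n))"] by simp
        also have "\<dots> \<le> 2 * C * exp (\<kappa> * real n)" using C[of "- real n"] by simp
        also have "\<dots> < real N * exp (\<kappa> * real n)" using N by simp
        finally show ?thesis .
      qed
      ultimately have "eventually (\<lambda>k. norm (flow (- real n) \<omega> (x, Y k)) < real N * exp (\<kappa> * real n)) sequentially"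
        by (rule order_tendstoD)
      then obtain k where "norm (flow (- real n) \<omega> (x, Y k)) < real N * exp (\<kappa> * real n)"
        by (auto simp: eventually_sequentially)
      then show "\<exists>y\<in>E. norm (flow (- real n) \<omega> (x, y)) < real N * exp (\<kappa> * real n)" using Y by blast
    qed
  next
    assume "\<exists>N::nat. \<forall>n::nat. \<exists>y\<in>E. norm (flow (- real n) \<omega> (x, y)) < real N * exp (\<kappa> * real n)"
    then obtain N :: nat where N: "\<forall>n::nat. \<exists>y. y \<in> E \<and> norm (flow (- real n) \<omega> (x, y)) < real N * exp (\<kappa> * real n)"
      by blast
    obtain Y where Y: "\<And>n. Y n \<in> E" "\<And>n. norm (flow (- real n) \<omega> (x, Y n)) < real N * exp (\<kappa> * real n)"
      using choice[OF N] by blast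
    have bound: "(norm (Y n - ?h))\<^sup>2 \<le> (real N + C)\<^sup>2 * exp (- 2 * (\<mu> - \<kappa>)) ^ n" for n
    proof -
      let ?u = "\<lambda>t. flow t \<omega> (x, Y n)"
      let ?p = "\<lambda>t. fst (?u t) - fst (?v t)" and ?q = "\<lambda>t. snd (?u t) - snd (?v t)"
      let ?n = "real n"
      have "norm (?q (- ?n)) \<le> norm (snd (?u (- ?n))) + norm (snd (?v (- ?n)))" by (rule norm_triangle_ineq4)
      also have "norm (snd (?u (- ?n))) \<le> norm (?u (- ?n))" by (metis norm_snd_le prod.collapse)
      also have "\<dots> \<le> real N * exp (\<kappa> * ?n)" using Y(2)[of n] by simp
      also have "norm (snd (?v (- ?n))) \<le> C * exp (\<kappa> * ?n)" using C(2)[of "- ?n"] by simp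
      finally have "norm (?q (- ?n)) \<le> (real N + C) * exp (\<kappa> * ?n)" by (simp add: distrib_right)
      then have "(norm (?q (- ?n)))\<^sup>2 \<le> ((real N + C) * exp (\<kappa> * ?n))\<^sup>2" by (intro power_mono) auto
      moreover have "cone L ?p ?q (- ?n) \<le> (norm (?q (- ?n)))\<^sup>2" by (simp add: cone_def)
      ultimately have *: "cone L ?p ?q (- ?n) \<le> ((real N + C) * exp (\<kappa> * ?n))\<^sup>2" by linarith
      \<comment> \<open>At time 0 both orbits have the slow component \<open>x\<close>, so
        \<open>cone\<close> is there the squared distance of the fast components.\<close>
      have "(norm (Y n - ?h))\<^sup>2 = cone L ?p ?q 0" by (simp add: cone_def flow_tsol[OF \<omega>])
      also have "\<dots> \<le> exp (- 2 * \<mu> * (0 - - ?n)) * cone L ?p ?q (- ?n)"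
        using L by (intro cone_decreasing[OF sol_diff_controlled[OF flow_sol[OF \<omega>] flow_sol[OF \<omega>]]]) auto
      also have "\<dots> \<le> exp (- 2 * \<mu> * (0 - - ?n)) * ((real N + C) * exp (\<kappa> * ?n))\<^sup>2"
        using * by (intro mult_left_mono) auto
      also have "\<dots> = (real N + C)\<^sup>2 * (exp (- 2 * \<mu> * ?n) * (exp (\<kappa> * ?n) * exp (\<kappa> * ?n)))"
        by (simp add: power_mult_distrib power2_eq_square)
      also have "exp (- 2 * \<mu> * ?n) * (exp (\<kappa> * ?n) * exp (\<kappa> * ?n)) = exp (- 2 * (\<mu> - \<kappa>)) ^ n"
        by (simp only: exp_add[symmetric] exp_of_nat_mult[symmetric]) (simp add: algebra_simps)
      finally show ?thesis .
    qed
    have "0 < \<mu> - \<kappa>" using delta_pos eps unfolding mu_gt_kappa by simp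
    then have "- 2 * (\<mu> - \<kappa>) < 0" by (intro mult_neg_pos) simp_all
    then have "exp (- 2 * (\<mu> - \<kappa>)) < 1" by (subst exp_less_one_iff)
    then have "(\<lambda>n. (real N + C)\<^sup>2 * exp (- 2 * (\<mu> - \<kappa>)) ^ n) \<longlonglongrightarrow> (real N + C)\<^sup>2 * 0"
      by (intro tendsto_intros LIMSEQ_realpow_zero) auto
    then have lim: "(\<lambda>n. (real N + C)\<^sup>2 * exp (- 2 * (\<mu> - \<kappa>)) ^ n) \<longlonglongrightarrow> 0" by simp
    have "(\<lambda>n. (norm (Y n - ?h))\<^sup>2) \<longlonglongrightarrow> 0"
      by (rule tendsto_sandwich[OF _ _ tendsto_const lim]) (intro always_eventually allI bound zero_le_power2)+
    then have "(\<lambda>n. sqrt ((norm (Y n - ?h))\<^sup>2)) \<longlonglongrightarrow> sqrt 0" by (intro tendsto_intros)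
    then have "Y \<longlonglongrightarrow> ?h" by (simp add: tendsto_norm_zero_iff LIM_zero_iff)
    moreover have "Y n \<in> D" for n using Y D by blast
    ultimately show "?h \<in> D" using D(1) by (metis closed_sequentially)
  qed
qed

lemma h_hat_measurable: "(\<lambda>\<omega>. hh \<omega> x) \<in> borel_measurable M"
proof (rule borel_measurableI)
  fix U :: "(real^'n) set" assume "open U"
  \<comment> \<open>A countable dense subset of the closed complement: the preimage of the
    complement is then given by countable quantifiers.\<close>
  obtain E where E: "countable E" "E \<subseteq> - U" "- U \<subseteq> closure E" using separable[of "- U"] by metis
  have "(\<lambda>\<omega>. flow t \<omega> z) \<in> borel_measurable M" for t z
    using measurable_compose[OF _ flow_measurable, of "\<lambda>\<omega>. (t, \<omega>, z)" M] by simp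
  then have meas: "(\<lambda>\<omega>. norm (flow t \<omega> z)) \<in> borel_measurable M" for t z
    by (rule measurable_compose[OF _ borel_measurable_norm])
  have "{\<omega> \<in> space M. hh \<omega> x \<in> - U} =
      {\<omega> \<in> space M. \<exists>N::nat. \<forall>n::nat. \<exists>y\<in>E. norm (flow (- real n) \<omega> (x, y)) < real N * exp (\<kappa> * real n)}"
    using h_hat_in_closed_iff[OF _ _ E(2,3), of _ x] \<open>open U\<close> by (auto simp: space_M closed_Compl)
  also have "\<dots> \<in> sets M"
    by (intro sets.sets_Collect_countable_Ex sets.sets_Collect_countable_All sets.sets_Collect_countable_Ex' E(1)
        borel_measurable_less borel_measurable_const meas)
  finally have "space M - {\<omega> \<in> space M. hh \<omega> x \<in> - U} \<in> sets M" by blast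
  also have "space M - {\<omega> \<in> space M. hh \<omega> x \<in> - U} = (\<lambda>\<omega>. hh \<omega> x) -` U \<inter> space M" by auto
  finally show "(\<lambda>\<omega>. hh \<omega> x) -` U \<inter> space M \<in> sets M" .
qed


section \<open>The original system and its slow manifold\<close>

abbreviation "\<phi> \<equiv> phi S F g1 g2 \<sigma> \<alpha> \<epsilon>"

definition manifold :: "(real \<Rightarrow> real^'n) \<Rightarrow> ((real^'m) \<times> (real^'n)) set" where
  "manifold \<omega> = inv (T_eps F \<sigma> \<alpha> \<epsilon> \<omega>) ` Mh \<omega>"

definition graph_map :: "(real \<Rightarrow> real^'n) \<Rightarrow> real^'m \<Rightarrow> real^'n" where
  "graph_map \<omega> x = hh \<omega> x + \<sigma> *\<^sub>R eta F \<alpha> \<epsilon> \<omega>"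

lemma noise_0: "\<omega> \<in> \<Omega> \<Longrightarrow> noise \<omega> 0 = \<sigma> *\<^sub>R eta F \<alpha> \<epsilon> \<omega>"
  by (simp add: noise_def shift_0)

lemma phi_eq: "\<phi> t \<omega> z = flow t \<omega> (z - (0, \<sigma> *\<^sub>R eta F \<alpha> \<epsilon> \<omega>)) + (0, noise \<omega> t)"
  by (cases z) (simp add: phi_def inv_T_eps noise_def, simp add: T_eps_def)

lemma manifold_eq_translate: "manifold \<omega> = (\<lambda>z. z + (0, \<sigma> *\<^sub>R eta F \<alpha> \<epsilon> \<omega>)) ` Mh \<omega>"
  by (simp add: manifold_def inv_T_eps)

lemma manifold_eq_graph: "\<omega> \<in> \<Omega> \<Longrightarrow> manifold \<omega> = {(x, graph_map \<omega> x) | x. True}"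
  unfolding manifold_eq_translate M_hat_eq graph_map_def by (auto simp: image_iff)

lemma has_integral_noise:
  assumes "\<omega> \<in> \<Omega>" "a \<le> b"
  shows "((\<lambda>s. (1 / \<epsilon>) *\<^sub>R (F *v noise \<omega> s)) has_integral
    noise \<omega> b - noise \<omega> a - (\<sigma> * \<epsilon> powr (- 1 / \<alpha>)) *\<^sub>R (\<omega> b - \<omega> a)) {a..b}"
proof -
  have "((\<lambda>s. (1 / \<epsilon>) *\<^sub>R (F *v eta F \<alpha> \<epsilon> (path_shift s \<omega>))) has_integral
      (eta F \<alpha> \<epsilon> (path_shift b \<omega>) - eta F \<alpha> \<epsilon> (path_shift a \<omega>) - (\<epsilon> powr (- 1 / \<alpha>)) *\<^sub>R (\<omega> b - \<omega> a))) {a..b}"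
    using admissible assms unfolding admissible_paths_def by blast
  from has_integral_cmul[OF this, of \<sigma>] show ?thesis
    by (simp add: noise_def algebra_simps matrix_vector_mult_scaleR)
qed

text \<open>The noise solves the linear fast equation with the same jumps, so subtracting its
  integral equation removes the driving term, and the arguments of \<open>g1\<close> and
  \<open>g2\<close> agree. Regularity transfers as well: the transformed integral equations force
  continuity, and a continuous path plus the cadlag noise is cadlag.\<close>

lemma slow_fast_solution_iff:
  assumes \<omega>: "\<omega> \<in> \<Omega>"
  shows "slow_fast_solution S F g1 g2 \<sigma> \<alpha> \<epsilon> \<omega> u \<longleftrightarrow> tsol \<omega> (\<lambda>t. u t - (0, noise \<omega> t))"
proof -
  let ?c = "\<lambda>a b. (\<sigma> * \<epsilon> powr (- 1 / \<alpha>)) *\<^sub>R (\<omega> b - \<omega> a)"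
  let ?v = "\<lambda>t. u t - (0, noise \<omega> t)"
  have arg: "(fst (?v s), snd (?v s) + \<sigma> *\<^sub>R eta F \<alpha> \<epsilon> (path_shift s \<omega>)) = u s" for s
    by (simp add: noise_def)
  have fast: "((\<lambda>s. (1 / \<epsilon>) *\<^sub>R (F *v snd (u s)) + (1 / \<epsilon>) *\<^sub>R g2 (u s)) has_integral
        (snd (u b) - snd (u a) - ?c a b)) {a..b} \<longleftrightarrow>
      ((\<lambda>s. (1 / \<epsilon>) *\<^sub>R (F *v snd (?v s)) + (1 / \<epsilon>) *\<^sub>R g2 (u s)) has_integral
        (snd (?v b) - snd (?v a))) {a..b}" if "a \<le> b" for a b
  proof
    assume "((\<lambda>s. (1 / \<epsilon>) *\<^sub>R (F *v snd (u s)) + (1 / \<epsilon>) *\<^sub>R g2 (u s)) has_integral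
        (snd (u b) - snd (u a) - ?c a b)) {a..b}"
    from has_integral_diff[OF this has_integral_noise[OF \<omega> that]]
    show "((\<lambda>s. (1 / \<epsilon>) *\<^sub>R (F *v snd (?v s)) + (1 / \<epsilon>) *\<^sub>R g2 (u s)) has_integral
        (snd (?v b) - snd (?v a))) {a..b}"
      by (simp add: algebra_simps matrix_vector_mult_diff_distrib)
  next
    assume "((\<lambda>s. (1 / \<epsilon>) *\<^sub>R (F *v snd (?v s)) + (1 / \<epsilon>) *\<^sub>R g2 (u s)) has_integral
        (snd (?v b) - snd (?v a))) {a..b}"
    from has_integral_add[OF this has_integral_noise[OF \<omega> that]]
    show "((\<lambda>s. (1 / \<epsilon>) *\<^sub>R (F *v snd (u s)) + (1 / \<epsilon>) *\<^sub>R g2 (u s)) has_integral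
        (snd (u b) - snd (u a) - ?c a b)) {a..b}"
      by (simp add: algebra_simps matrix_vector_mult_diff_distrib)
  qed
  have cont: "continuous_on UNIV ?v"
    if slow: "\<And>a b. a \<le> b \<Longrightarrow> ((\<lambda>s. S *v fst (u s) + g1 (u s)) has_integral (fst (u b) - fst (u a))) {a..b}"
      and fast: "\<And>a b. a \<le> b \<Longrightarrow> ((\<lambda>s. (1 / \<epsilon>) *\<^sub>R (F *v snd (?v s)) + (1 / \<epsilon>) *\<^sub>R g2 (u s)) has_integral
        (snd (?v b) - snd (?v a))) {a..b}"
  proof -
    have "continuous_on UNIV (\<lambda>t. (fst (u t), snd (?v t)))"
      by (intro continuous_on_Pair has_integral_imp_continuous_on[OF slow] has_integral_imp_continuous_on[OF fast])
    moreover have "(\<lambda>t. (fst (u t), snd (?v t))) = ?v" by (auto simp: prod_eq_iff)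
    ultimately show ?thesis by (simp only:)
  qed
  have cad: "cadlag u" if "continuous_on UNIV ?v"
  proof -
    have "cadlag (\<lambda>t. (0 :: real^'m, noise \<omega> t))"
      unfolding cadlag_def
    proof (intro allI conjI)
      fix t
      have n: "continuous (at_right t) (noise \<omega>)" "\<exists>l. (noise \<omega> \<longlongrightarrow> l) (at_left t)"
        using cadlag_noise[OF \<omega>] unfolding cadlag_def by blast+
      show "continuous (at_right t) (\<lambda>t. (0 :: real^'m, noise \<omega> t))"
        by (intro continuous_Pair continuous_const n)
      show "\<exists>l. ((\<lambda>t. (0 :: real^'m, noise \<omega> t)) \<longlongrightarrow> l) (at_left t)"
        using n(2) tendsto_Pair[OF tendsto_const] by blast
    qed
    from cadlag_add_continuous[OF this that] show ?thesis by simp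
  qed
  show ?thesis
  proof
    assume u: "slow_fast_solution S F g1 g2 \<sigma> \<alpha> \<epsilon> \<omega> u"
    have slow: "((\<lambda>s. S *v fst (u s) + g1 (u s)) has_integral (fst (u b) - fst (u a))) {a..b}" if "a \<le> b" for a b
      using u that unfolding slow_fast_solution_def by blast
    have fst': "((\<lambda>s. (1 / \<epsilon>) *\<^sub>R (F *v snd (?v s)) + (1 / \<epsilon>) *\<^sub>R g2 (u s)) has_integral
        (snd (?v b) - snd (?v a))) {a..b}" if "a \<le> b" for a b
      unfolding fast[OF that, symmetric] using u that unfolding slow_fast_solution_def by blast
    show "tsol \<omega> ?v"
      unfolding transformed_solution_def arg using cont[OF slow fst'] slow fst' by simp
  next
    assume v: "tsol \<omega> ?v"
    then have slow: "((\<lambda>s. S *v fst (u s) + g1 (u s)) has_integral (fst (u b) - fst (u a))) {a..b}"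
      and fst': "((\<lambda>s. (1 / \<epsilon>) *\<^sub>R (F *v snd (?v s)) + (1 / \<epsilon>) *\<^sub>R g2 (u s)) has_integral
        (snd (?v b) - snd (?v a))) {a..b}" if "a \<le> b" for a b
      using that unfolding transformed_solution_def arg by auto
    show "slow_fast_solution S F g1 g2 \<sigma> \<alpha> \<epsilon> \<omega> u"
      unfolding slow_fast_solution_def using cad v slow fast fst' by (auto simp: transformed_solution_def)
  qed
qed

text \<open>Justifies regarding \<open>phi\<close>, which is defined through the transformation, as
  the system generated by the original equation.\<close>

lemma slow_fast_solution_eq_phi:
  assumes \<omega>: "\<omega> \<in> \<Omega>"
  shows "slow_fast_solution S F g1 g2 \<sigma> \<alpha> \<epsilon> \<omega> u \<and> u 0 = z \<longleftrightarrow> u = (\<lambda>t. \<phi> t \<omega> z)"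
proof
  let ?v = "\<lambda>t. u t - (0, noise \<omega> t)"
  assume u: "slow_fast_solution S F g1 g2 \<sigma> \<alpha> \<epsilon> \<omega> u \<and> u 0 = z"
  then have "tsol \<omega> ?v" "?v 0 = z - (0, \<sigma> *\<^sub>R eta F \<alpha> \<epsilon> \<omega>)"
    by (simp_all add: slow_fast_solution_iff[OF \<omega>] noise_0[OF \<omega>])
  then have eq: "?v = (\<lambda>t. flow t \<omega> (z - (0, \<sigma> *\<^sub>R eta F \<alpha> \<epsilon> \<omega>)))" by (rule flow_eqI[OF \<omega>])
  show "u = (\<lambda>t. \<phi> t \<omega> z)"
  proof
    fix t
    have "u t = ?v t + (0, noise \<omega> t)" by simp
    also have "\<dots> = \<phi> t \<omega> z" unfolding fun_cong[OF eq, of t] phi_eq ..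
    finally show "u t = \<phi> t \<omega> z" .
  qed
next
  assume u: "u = (\<lambda>t. \<phi> t \<omega> z)"
  have "(\<lambda>t. u t - (0, noise \<omega> t)) = (\<lambda>t. flow t \<omega> (z - (0, \<sigma> *\<^sub>R eta F \<alpha> \<epsilon> \<omega>)))"
    by (simp add: u phi_eq)
  with flow_tsol[OF \<omega>] show "slow_fast_solution S F g1 g2 \<sigma> \<alpha> \<epsilon> \<omega> u \<and> u 0 = z"
    by (simp add: slow_fast_solution_iff[OF \<omega>]) (simp add: u phi_eq flow_tsol[OF \<omega>] noise_0[OF \<omega>])
qed

lemma phi_random_dynamical_system: "random_dynamical_system M path_shift \<phi>"
  unfolding random_dynamical_system_def
proof (intro conjI ballI allI)
  have n0[measurable]: "(\<lambda>x. noise (fst (snd x)) 0) \<in> borel_measurable (borel \<Otimes>\<^sub>M (M \<Otimes>\<^sub>M (borel :: ((real^'m) \<times> (real^'n)) measure)))"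
    by (rule measurable_compose[OF _ noise_measurable]) measurable
  have nt[measurable]: "(\<lambda>x. noise (fst (snd x)) (fst x)) \<in> borel_measurable (borel \<Otimes>\<^sub>M (M \<Otimes>\<^sub>M (borel :: ((real^'m) \<times> (real^'n)) measure)))"
    using measurable_compose[OF _ noise_pair_measurable, of "\<lambda>x. (fst x, fst (snd x))"
        "borel \<Otimes>\<^sub>M (M \<Otimes>\<^sub>M (borel :: ((real^'m) \<times> (real^'n)) measure))"] by simp
  have "(\<lambda>x. (fst x, fst (snd x), snd (snd x) - (0, noise (fst (snd x)) 0)))
      \<in> (borel \<Otimes>\<^sub>M (M \<Otimes>\<^sub>M (borel :: ((real^'m) \<times> (real^'n)) measure))) \<rightarrow>\<^sub>M (borel \<Otimes>\<^sub>M (M \<Otimes>\<^sub>M borel))"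
    by measurable
  from measurable_compose[OF this flow_measurable]
  have "(\<lambda>x. flow (fst x) (fst (snd x)) (snd (snd x) - (0, noise (fst (snd x)) 0)))
      \<in> borel_measurable (borel \<Otimes>\<^sub>M (M \<Otimes>\<^sub>M borel))" by simp
  then have "(\<lambda>x. flow (fst x) (fst (snd x)) (snd (snd x) - (0, noise (fst (snd x)) 0)) + (0, noise (fst (snd x)) (fst x)))
      \<in> borel_measurable (borel \<Otimes>\<^sub>M (M \<Otimes>\<^sub>M borel))"
    by (intro borel_measurable_add borel_measurable_Pair borel_measurable_const nt)
  \<comment> \<open>For paths in \<Omega>, where \<open>\<omega> 0 = 0\<close>,
    \<open>noise \<omega> 0\<close> is the translation in \<open>phi\<close>; hence the passage by
    congruence on the space.\<close>
  also have "?this \<longleftrightarrow> (\<lambda>(t, \<omega>, z). \<phi> t \<omega> z) \<in> borel_measurable (borel \<Otimes>\<^sub>M (M \<Otimes>\<^sub>M borel))"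
    by (intro measurable_cong) (auto simp: space_pair_measure space_M phi_eq noise_0)
  finally show "(\<lambda>(t, \<omega>, z). \<phi> t \<omega> z) \<in> borel_measurable (borel \<Otimes>\<^sub>M (M \<Otimes>\<^sub>M borel))" .
next
  fix \<omega> assume "\<omega> \<in> space M"
  then have \<omega>: "\<omega> \<in> \<Omega>" by (simp add: space_M)
  show "\<phi> 0 \<omega> = id" by (auto simp: phi_eq flow_tsol[OF \<omega>] noise_0[OF \<omega>])
  fix t s
  have n: "\<sigma> *\<^sub>R eta F \<alpha> \<epsilon> (path_shift s \<omega>) = noise \<omega> s" by (simp add: noise_def)
  show "\<phi> (t + s) \<omega> = \<phi> t (path_shift s \<omega>) \<circ> \<phi> s \<omega>"
  proof
    fix z
    show "\<phi> (t + s) \<omega> z = (\<phi> t (path_shift s \<omega>) \<circ> \<phi> s \<omega>) z"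
      unfolding o_apply phi_eq n by (simp add: noise_shift flow_cocycle[OF \<omega>])
  qed
qed

lemma graph_map_lipschitz: "\<omega> \<in> \<Omega> \<Longrightarrow> L-lipschitz_on UNIV (graph_map \<omega>)"
  using L h_hat_lipschitz by (intro lipschitz_onI) (auto simp: graph_map_def dist_norm)

lemma graph_map_measurable: "(\<lambda>\<omega>. graph_map \<omega> x) \<in> borel_measurable M"
proof -
  have "(\<lambda>\<omega>. hh \<omega> x + noise \<omega> 0) \<in> borel_measurable M"
    by (intro borel_measurable_add h_hat_measurable noise_measurable)
  also have "?this \<longleftrightarrow> ?thesis"
    by (intro measurable_cong) (simp add: graph_map_def noise_0 space_M)
  finally show ?thesis .
qed

lemma manifold_random_set: "random_set M manifold"
  unfolding random_set_def
proof (intro conjI ballI allI)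
  fix \<omega> assume "\<omega> \<in> space M"
  then have \<omega>: "\<omega> \<in> \<Omega>" by (simp add: space_M)
  show "manifold \<omega> \<noteq> {}" by (simp add: manifold_eq_graph[OF \<omega>])
  have "continuous_on UNIV (graph_map \<omega>)" using graph_map_lipschitz[OF \<omega>] by (rule lipschitz_on_continuous_on)
  then have "continuous_on UNIV (\<lambda>z :: (real^'m) \<times> (real^'n). graph_map \<omega> (fst z))"
    by (rule continuous_on_compose2) (auto intro!: continuous_intros)
  then have "closed {z :: (real^'m) \<times> (real^'n). snd z = graph_map \<omega> (fst z)}"
    by (intro closed_Collect_eq continuous_intros)
  also have "{z. snd z = graph_map \<omega> (fst z)} = manifold \<omega>"
    unfolding manifold_eq_graph[OF \<omega>] by (auto simp: prod_eq_iff)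
  finally show "closed (manifold \<omega>)" .
next
  fix z
  obtain X :: "(real^'m) set" where X: "countable X" "UNIV \<subseteq> closure X" using separable[of UNIV] by metis
  have "(\<lambda>\<omega>. INF x\<in>X. dist z (x, graph_map \<omega> x)) \<in> borel_measurable M"
    by (intro borel_measurable_cINF_real X borel_measurable_dist borel_measurable_Pair graph_map_measurable
        borel_measurable_const)
  also have "?this \<longleftrightarrow> (\<lambda>\<omega>. infdist z (manifold \<omega>)) \<in> borel_measurable M"
  proof (rule measurable_cong)
    fix \<omega> assume "\<omega> \<in> space M"
    then have \<omega>: "\<omega> \<in> \<Omega>" by (simp add: space_M)
    have "continuous_on UNIV (graph_map \<omega>)" using graph_map_lipschitz[OF \<omega>] by (rule lipschitz_on_continuous_on)
    then show "(INF x\<in>X. dist z (x, graph_map \<omega> x)) = infdist z (manifold \<omega>)"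
      unfolding manifold_eq_graph[OF \<omega>] using X by (subst infdist_graph_dense) auto
  qed
  finally show "(\<lambda>\<omega>. infdist z (manifold \<omega>)) \<in> borel_measurable M" .
qed

lemma manifold_invariant: "invariant_under M path_shift \<phi> manifold"
  unfolding invariant_under_def
proof (intro ballI allI subsetI)
  fix \<omega> t w assume "\<omega> \<in> space M" "w \<in> \<phi> t \<omega> ` manifold \<omega>"
  then obtain z where \<omega>: "\<omega> \<in> \<Omega>" and z: "z \<in> Mh \<omega>" and w: "w = \<phi> t \<omega> (z + (0, \<sigma> *\<^sub>R eta F \<alpha> \<epsilon> \<omega>))"
    by (auto simp: space_M manifold_eq_translate)
  have "w = flow t \<omega> z + (0, \<sigma> *\<^sub>R eta F \<alpha> \<epsilon> (path_shift t \<omega>))"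
    unfolding w phi_eq by (simp add: noise_def)
  then show "w \<in> manifold (path_shift t \<omega>)"
    unfolding manifold_eq_translate using M_hat_invariant[OF \<omega> z] by blast
qed

text \<open>The translation is the same for both orbits and cancels in the differences. Rate and
  constant are therefore those of the transformed flow, the same for all \<omega>.\<close>

lemma manifold_tracking: "exponential_tracking M \<phi> manifold"
  unfolding exponential_tracking_def
proof (intro exI[of _ \<kappa>] conjI exI[of _ "\<lambda>z z' \<omega>. 1 + 1 / (2 * L)"] allI ballI)
  show "0 < \<kappa>" by (rule kappa_pos)
  show "0 < 1 + 1 / (2 * L)" using L by (intro add_pos_pos) auto
  fix \<omega> z assume "\<omega> \<in> space M"
  then have \<omega>: "\<omega> \<in> \<Omega>" by (simp add: space_M)
  let ?n = "(0 :: real^'m, \<sigma> *\<^sub>R eta F \<alpha> \<epsilon> \<omega>)"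
  obtain z' where z': "z' \<in> Mh \<omega>" "\<And>t. 0 \<le> t \<Longrightarrow>
      norm (flow t \<omega> (z - ?n) - flow t \<omega> z') \<le> (1 + 1 / (2 * L)) * exp (- \<kappa> * t) * norm (z - ?n - z')"
    using M_hat_tracking[OF \<omega>, of "z - ?n"] by blast
  show "\<exists>z'\<in>manifold \<omega>. \<forall>t\<ge>0. norm (\<phi> t \<omega> z - \<phi> t \<omega> z') \<le> (1 + 1 / (2 * L)) * exp (- \<kappa> * t) * norm (z - z')"
  proof (intro bexI[of _ "z' + ?n"] allI impI)
    show "z' + ?n \<in> manifold \<omega>" unfolding manifold_eq_translate using z'(1) by blast
    fix t :: real assume "0 \<le> t"
    from z'(2)[OF this]
    show "norm (\<phi> t \<omega> z - \<phi> t \<omega> (z' + ?n)) \<le> (1 + 1 / (2 * L)) * exp (- \<kappa> * t) * norm (z - (z' + ?n))"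
      unfolding phi_eq by (simp add: diff_diff_eq add.commute[of ?n])
  qed
qed simp

lemma manifold_slow_manifold: "slow_manifold M path_shift \<phi> manifold"
  unfolding slow_manifold_def lipschitz_invariant_manifold_def
proof (intro conjI phi_random_dynamical_system manifold_random_set manifold_invariant manifold_tracking
    exI[of _ graph_map] ballI allI)
  show "manifold \<omega> = {(x, graph_map \<omega> x) |x. True}" if "\<omega> \<in> space M" for \<omega>
    using that by (simp add: space_M manifold_eq_graph)
  show "\<exists>L. L-lipschitz_on UNIV (graph_map \<omega>)" if "\<omega> \<in> space M" for \<omega>
    using graph_map_lipschitz[of \<omega>] that by (auto simp: space_M)
qed (rule graph_map_measurable)

end

theorem theorem3:
  fixes S :: "real^'m^'m" and F :: "real^'n^'n"
    and g1 :: "(real^'m) \<times> (real^'n) \<Rightarrow> real^'m" and g2 :: "(real^'m) \<times> (real^'n) \<Rightarrow> real^'n"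
    and \<sigma> \<alpha> \<gamma>s \<gamma>f K \<gamma> :: real
    and P :: "(real \<Rightarrow> real^'n) measure"
  assumes "\<sigma> > 0" and "1 < \<alpha>" and "\<alpha> < 2"
    and "\<And>l. eigenvalue_of S l \<Longrightarrow> 0 \<le> Re l"
    and "\<And>l. eigenvalue_of F l \<Longrightarrow> Re l < 0"
    and "\<exists>L. L-lipschitz_on UNIV g1" and "\<exists>L. L-lipschitz_on UNIV g2"
    and "g1 (0, 0) = 0" and "g2 (0, 0) = 0"
    and A1: "\<gamma>s > 0" "\<gamma>f < 0"
      "\<And>t x. t \<le> 0 \<Longrightarrow> norm (matrix_exp (t *\<^sub>R S) *v x) \<le> exp (\<gamma>s * t) * norm x"
      "\<And>t y. t \<ge> 0 \<Longrightarrow> norm (matrix_exp (t *\<^sub>R F) *v y) \<le> exp (\<gamma>f * t) * norm y"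
    and A2: "K > 0"
      "\<And>x1 y1 x2 y2. norm (g1 (x1, y1) - g1 (x2, y2)) \<le> K * (norm (x1 - x2) + norm (y1 - y2))"
      "\<And>x1 y1 x2 y2. norm (g2 (x1, y1) - g2 (x2, y2)) \<le> K * (norm (x1 - x2) + norm (y1 - y2))"
    and A3: "K < - \<gamma>f"
    and "\<gamma> > 0" and "K < - (\<gamma> + \<gamma>f)"
    and "stable_levy_law \<alpha> P"
  shows "\<exists>\<epsilon>0>0. \<forall>\<epsilon> \<Omega>. 0 < \<epsilon> \<and> \<epsilon> < \<epsilon>0 \<and> admissible_paths S F g1 g2 \<sigma> \<alpha> \<epsilon> P \<Omega> \<longrightarrow>
    (let \<phi> = phi S F g1 g2 \<sigma> \<alpha> \<epsilon>;
         \<eta> = eta F \<alpha> \<epsilon>;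
         M' = M_hat S F g1 g2 \<sigma> \<alpha> \<gamma> \<epsilon>;
         M = (\<lambda>\<omega>. inv (T_eps F \<sigma> \<alpha> \<epsilon> \<omega>) ` M' \<omega>);
         h = (\<lambda>\<omega> x. h_hat S F g1 g2 \<sigma> \<alpha> \<gamma> \<epsilon> \<omega> x + \<sigma> *\<^sub>R \<eta> \<omega>)
     in
       (\<forall>\<omega>\<in>\<Omega>. \<forall>z u. slow_fast_solution S F g1 g2 \<sigma> \<alpha> \<epsilon> \<omega> u \<and> u 0 = z \<longleftrightarrow> u = (\<lambda>t. \<phi> t \<omega> z)) \<and>
       slow_manifold (restrict_space P \<Omega>) path_shift \<phi> M \<and>
       (\<forall>\<omega>\<in>\<Omega>. M \<omega> = (\<lambda>z. z + (0, \<sigma> *\<^sub>R \<eta> \<omega>)) ` M' \<omega> \<and> M \<omega> = {(x, h \<omega> x) | x. True}))"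
proof -
  define \<delta> where "\<delta> = - \<gamma>f - K - \<gamma>"
  have \<delta>: "0 < \<delta>" using \<open>K < - (\<gamma> + \<gamma>f)\<close> by (simp add: \<delta>_def)
  \<comment> \<open>The smallest slope that satisfies the gap condition.\<close>
  define L where "L = 4 * K / \<delta>"
  have L: "0 < L" and L_gap: "4 * K = L * \<delta>" using \<open>K > 0\<close> \<delta> by (simp_all add: L_def)
  \<comment> \<open>The two smallness conditions of \<open>slow_fast\<close>, solved for \<epsilon>.
    The bound depends on \<open>K\<close>, \<open>\<gamma>f\<close> and \<gamma> only, so it can be
    fixed before \<Omega>.\<close>
  define \<epsilon>0 where "\<epsilon>0 = min (\<delta> / 4 / (K + 2 * L * K)) (\<gamma> / (K * (4 + L\<^sup>2)))"
  have pos: "0 < K + 2 * L * K" "0 < K * (4 + L\<^sup>2)" using \<open>K > 0\<close> L by (auto intro!: add_pos_pos mult_pos_pos)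
  have S_nonneg: "0 \<le> x \<bullet> (S *v x)" for x
  proof -
    have "0 \<le> \<gamma>s * (norm x)\<^sup>2" using \<open>\<gamma>s > 0\<close> by simp
    also have "\<dots> \<le> x \<bullet> (S *v x)" by (rule backward_contraction_imp_inner_ge[OF A1(3)])
    finally show ?thesis .
  qed
  have F_neg: "y \<bullet> (F *v y) \<le> \<gamma>f * (norm y)\<^sup>2" for y
    by (rule forward_contraction_imp_inner_le[OF A1(4)])
  show ?thesis
  proof (intro exI[of _ \<epsilon>0] conjI allI impI)
    show "0 < \<epsilon>0" using pos \<delta> \<open>\<gamma> > 0\<close> by (simp add: \<epsilon>0_def)
    fix \<epsilon> \<Omega> assume asm: "0 < \<epsilon> \<and> \<epsilon> < \<epsilon>0 \<and> admissible_paths S F g1 g2 \<sigma> \<alpha> \<epsilon> P \<Omega>"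
    have small: "\<epsilon> * (K + 2 * L * K) \<le> \<delta> / 4" "\<epsilon> * (K * (4 + L\<^sup>2)) \<le> \<gamma>"
      using asm pos unfolding \<epsilon>0_def min_less_iff_conj by (auto simp only: pos_less_divide_eq less_imp_le)
    interpret random_slow_fast S F g1 g2 \<epsilon> \<gamma>f K \<gamma> L \<sigma> \<alpha> P \<Omega>
    proof (intro random_slow_fast.intro slow_fast.intro random_slow_fast_axioms.intro)
      show "linear ((*v) S)" "linear ((*v) F)" by (rule matrix_vector_mul_linear)+
      show "0 < \<epsilon>" "admissible_paths S F g1 g2 \<sigma> \<alpha> \<epsilon> P \<Omega>" using asm by blast+
      show "0 < K" "0 < \<gamma>" "0 < L" "stable_levy_law \<alpha> P" "g1 (0, 0) = 0" "g2 (0, 0) = 0" by fact+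
      show "0 \<le> x \<bullet> (S *v x)" for x by (rule S_nonneg)
      show "y \<bullet> (F *v y) \<le> \<gamma>f * (norm y)\<^sup>2" for y by (rule F_neg)
      show "norm (g1 (x1, y1) - g1 (x2, y2)) \<le> K * (norm (x1 - x2) + norm (y1 - y2))"
        "norm (g2 (x1, y1) - g2 (x2, y2)) \<le> K * (norm (x1 - x2) + norm (y1 - y2))" for x1 y1 x2 y2
        by (rule A2)+
      show "4 * K \<le> L * (- \<gamma>f - K - \<gamma>)" using L_gap unfolding \<delta>_def by (rule eq_refl)
      show "\<epsilon> * (K + 2 * L * K) \<le> (- \<gamma>f - K - \<gamma>) / 4" using small(1) unfolding \<delta>_def .
      show "\<epsilon> * (K * (4 + L\<^sup>2)) \<le> \<gamma>" by (rule small)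
    qed
    show "let \<phi> = phi S F g1 g2 \<sigma> \<alpha> \<epsilon>;
         \<eta> = eta F \<alpha> \<epsilon>;
         M' = M_hat S F g1 g2 \<sigma> \<alpha> \<gamma> \<epsilon>;
         M = (\<lambda>\<omega>. inv (T_eps F \<sigma> \<alpha> \<epsilon> \<omega>) ` M' \<omega>);
         h = (\<lambda>\<omega> x. h_hat S F g1 g2 \<sigma> \<alpha> \<gamma> \<epsilon> \<omega> x + \<sigma> *\<^sub>R \<eta> \<omega>)
     in
       (\<forall>\<omega>\<in>\<Omega>. \<forall>z u. slow_fast_solution S F g1 g2 \<sigma> \<alpha> \<epsilon> \<omega> u \<and> u 0 = z \<longleftrightarrow> u = (\<lambda>t. \<phi> t \<omega> z)) \<and>
       slow_manifold (restrict_space P \<Omega>) path_shift \<phi> M \<and>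
       (\<forall>\<omega>\<in>\<Omega>. M \<omega> = (\<lambda>z. z + (0, \<sigma> *\<^sub>R \<eta> \<omega>)) ` M' \<omega> \<and> M \<omega> = {(x, h \<omega> x) | x. True})"
      unfolding Let_def manifold_def[symmetric] graph_map_def[symmetric]
      by (intro conjI ballI allI slow_fast_solution_eq_phi manifold_slow_manifold manifold_eq_translate manifold_eq_graph)
  qed
qed

end
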